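(* Let $(H^+/K;-)$ denote the Artin symbol of the abelian extension $H^+/K$, as a map from the ideal group of $\mathcal A$ to $\mathrm{Gal}(H^+/K)$. Then $$(H^+/K;I_\infty)=\sigma_\infty,\qquad (H^+/K;I_0)=\sigma_0,\qquad (H^+/K;(T_i))=M_{\eta_*^i}\quad(0\le i\le N-1),$$ where $\eta_*=\eta^{\frac{1-q}q}$.
   Context: Let $K=\mathbb F_q(\theta)$, identified with $\mathbb F_q(t)$ via $\iota:t\mapsto\theta$. Let $\rho\in\mathbb F_q[t]$ be monic irreducible of degree $N\ge2$, $\eta$ a root, $\Theta=\frac1{\theta-\eta}$, $W_N=\frac{q^N-1}{q-1}$, $H=K(\eta)$. Let $\mathcal A$ be the ring of elements of $\mathbb F_q(t)$ regular away from the place $P_\rho$ of $\rho$, $T_i=t^i/\rho(t)$; $I_\infty=(T_0,\dots,T_{N-1})$ (prime of the place $t=\infty$) and $I_0=(T_0-\frac1{\rho(0)},T_1,\dots,T_{N-1})$ (prime of the place $t=0$). Ideals of $\mathcal A$ are transported to $K$ via $\iota$. Let $\sigma\in\mathrm{Gal}(H/K)$: $\eta\mapsto\eta^q$; $x^{\sum a_i\sigma^i}=\prod\sigma^i(x)^{a_i}$; $\gamma_N(\sigma)=\sum_{i=0}^{N-1}q^i\sigma^{N-1-i}$. Let $u$ be a root of $x^{W_N}=(-\Theta)^{\gamma_N(\sigma)}:=(-1)^{W_N}\Theta^{\gamma_N(\sigma)}$ and $H^+=K(\eta,u)$, an abelian extension of $K$ unramified at all primes of $\mathcal A$. Automorphisms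 of $H^+$: $\sigma_\infty(u)=(\theta-\eta)^{q-1}u^q$, $\sigma_\infty|_H=\sigma$; for $\mu^{W_N}=1$, $M_\mu(u)=\mu u$, $M_\mu|_H=\mathrm{id}$; $\sigma_0=\sigma_\infty M_{\eta_*}$, where $\eta_*=\eta^{(1-q)/q}$ means $(\eta^{q^{N-1}})^{1-q}$, which satisfies $\eta_*^{W_N}=1$. The Artin symbol of a prime $P$ is the unique $s\in\mathrm{Gal}(H^+/K)$ with $s(r)\equiv r^{q^{\deg P}}\bmod R$ for every place $R$ of $H^+$ above $P$ and every $r$ integral at $R$; it is extended multiplicatively to ideals. *)

theory Defs
  imports
    "HOL-Algebra.Algebraic_Closure_Type"
    "HOL-Algebra.Bij"
    "HOL-Algebra.Embedded_Algebras"
    "HOL-Algebra.Generated_Fields"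
    "HOL-Algebra.Ideal_Product"
    "HOL-Algebra.QuotRing"
    "HOL-Library.Cardinality"
begin

text \<open>
  The field \<open>\<bbbF>\<^sub>q\<close> is a type \<open>'f\<close> of sort \<open>{finite, field}\<close>, so \<open>q = CARD('f)\<close>, and \<open>\<bbbF>\<^sub>q(t)\<close> is the type
  \<open>'f poly fract\<close>.  All extensions live in its algebraic closure.  The map \<open>\<iota> : t \<mapsto> \<theta>\<close> is
  \<^const>\<open>to_ac\<close>, so \<open>K = range to_ac\<close>, and subsets of \<open>\<bbbF>\<^sub>q(t)\<close> are transported to \<open>K\<close> as images
  under \<^const>\<open>to_ac\<close>.
\<close>

abbreviation type_ring :: "'a::field ring" where
  "type_ring \<equiv> ring_of_type_algebra"

abbreviation as_ring :: "'a::field set \<Rightarrow> 'a ring" where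
  "as_ring A \<equiv> type_ring\<lparr>carrier := A\<rparr>"

subsection \<open>Places of function fields\<close>

text \<open>
  A place of a function field \<open>F\<close> over \<open>k\<close> is represented by its valuation ring, which determines it;
  the place itself, as a set, is the maximal ideal of that ring.
\<close>

definition valuation_rings :: "'a::field set \<Rightarrow> 'a set \<Rightarrow> 'a set set" where
  "valuation_rings k F =
     {V. subring V type_ring \<and> k \<subset> V \<and> V \<subset> F \<and> (\<forall>z\<in>F. z \<in> V \<or> inverse z \<in> V)}"

definition place_ideal :: "'a::field set \<Rightarrow> 'a set" where
  "place_ideal V = {z \<in> V. z = 0 \<or> inverse z \<notin> V}"

definition const_field :: "'f::field poly fract set" where
  "const_field = range (\<lambda>c. to_fract [:c:])"

definition val_ring_at :: "'f::field poly \<Rightarrow> 'f poly fract set" where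
  "val_ring_at \<rho> = {Fract a b | a b. \<not> \<rho> dvd b}"

subsection \<open>Ideals\<close>

definition ideal_group :: "'a::field set \<Rightarrow> 'a set monoid" where
  "ideal_group A =
     \<lparr>carrier = {I. subgroup I (add_monoid type_ring) \<and> (\<forall>a\<in>A. \<forall>x\<in>I. a * x \<in> I) \<and> I \<noteq> {0} \<and>
                    (\<exists>d\<in>A. d \<noteq> 0 \<and> (\<forall>x\<in>I. d * x \<in> A))},
      monoid.mult = ideal_prod type_ring,
      one = A\<rparr>"

definition localization :: "'a::field set \<Rightarrow> 'a set \<Rightarrow> 'a set" where
  "localization A P = {x / y | x y. x \<in> A \<and> y \<in> A - P}"

text \<open>
  The exponent of the prime \<open>P\<close> in the fractional ideal \<open>I\<close>: the integer \<open>n\<close> such that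
  \<open>I A\<^sub>P = P\<^sup>n A\<^sub>P\<close>.  If \<open>n < 0\<close>, the power of \<open>P\<close> is moved to the other side.
\<close>

definition ideal_ord :: "'a::field set \<Rightarrow> 'a set \<Rightarrow> 'a set \<Rightarrow> int" where
  "ideal_ord A P I =
     (THE n. (I \<otimes>\<^bsub>ideal_group A\<^esub> (P [^]\<^bsub>ideal_group A\<^esub> nat (- n))) \<otimes>\<^bsub>ideal_group A\<^esub> localization A P =
             (P [^]\<^bsub>ideal_group A\<^esub> nat n) \<otimes>\<^bsub>ideal_group A\<^esub> localization A P)"

definition prime_degree :: "'f::field poly fract set \<Rightarrow> 'f poly fract set \<Rightarrow> nat" where
  "prime_degree A P =
     ring.dim (as_ring A Quot P)
       ((\<lambda>c. P +>\<^bsub>as_ring A\<^esub> c) ` const_field) (carrier (as_ring A Quot P))"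

subsection \<open>Galois groups and the Artin symbol\<close>

definition galois_group :: "'a::field set \<Rightarrow> 'a set \<Rightarrow> ('a \<Rightarrow> 'a) monoid" where
  "galois_group L k = (BijGroup L)
     \<lparr>carrier := {s \<in> ring_iso (as_ring L) (as_ring L) \<inter> extensional L. \<forall>x\<in>k. s x = x}\<rparr>"

text \<open>
  \<open>R\<close> lies above the nonzero prime \<open>P\<close> of \<open>A\<close> iff its maximal ideal contracts to \<open>P\<close>.
\<close>

definition artin_symbol_prime ::
  "'f::{finite,field} poly fract set \<Rightarrow> 'f poly fract alg_closure set \<Rightarrow> 'f poly fract set \<Rightarrow>
     ('f poly fract alg_closure \<Rightarrow> 'f poly fract alg_closure)" where
  "artin_symbol_prime A L P =
     (THE s. s \<in> carrier (galois_group L (range to_ac)) \<and>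
        (\<forall>R \<in> valuation_rings (to_ac ` const_field) L.
           place_ideal R \<inter> to_ac ` A = to_ac ` P \<longrightarrow>
           (\<forall>r\<in>R. s r - r ^ (CARD('f) ^ prime_degree A P) \<in> place_ideal R)))"

definition artin_symbol ::
  "'f::{finite,field} poly fract set \<Rightarrow> 'f poly fract alg_closure set \<Rightarrow> 'f poly fract set \<Rightarrow>
     ('f poly fract alg_closure \<Rightarrow> 'f poly fract alg_closure)" where
  "artin_symbol A L = (\<lambda>I \<in> carrier (ideal_group A).
     finprod (galois_group L (range to_ac))
       (\<lambda>P. artin_symbol_prime A L P [^]\<^bsub>galois_group L (range to_ac)\<^esub> ideal_ord A P I)
       {P. primeideal P (as_ring A) \<and> P \<noteq> {0} \<and> ideal_ord A P I \<noteq> 0})"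

subsection \<open>The ring of functions regular away from a place and two of its primes\<close>

definition ring_A :: "'f::field poly \<Rightarrow> 'f poly fract set" where
  "ring_A \<rho> = {x. \<forall>V \<in> valuation_rings const_field UNIV. V \<noteq> val_ring_at \<rho> \<longrightarrow> x \<in> V}"

definition T_fun :: "'f::field poly \<Rightarrow> nat \<Rightarrow> 'f poly fract" where
  "T_fun \<rho> i = Fract (Polynomial.monom 1 i) \<rho>"

definition I_inf :: "'f::field poly \<Rightarrow> 'f poly fract set" where
  "I_inf \<rho> = Idl\<^bsub>as_ring (ring_A \<rho>)\<^esub> (T_fun \<rho> ` {0..<Polynomial.degree \<rho>})"

definition I_zero :: "'f::field poly \<Rightarrow> 'f poly fract set" where
  "I_zero \<rho> = Idl\<^bsub>as_ring (ring_A \<rho>)\<^esub>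
     (insert (T_fun \<rho> 0 - to_fract [:1 / poly \<rho> 0:]) (T_fun \<rho> ` {1..<Polynomial.degree \<rho>}))"

subsection \<open>The extension\<close>

definition W_num :: "nat \<Rightarrow> nat \<Rightarrow> nat" where
  "W_num q N = (q ^ N - 1) div (q - 1)"

definition theta :: "'f::field poly fract alg_closure" where
  "theta = to_ac (to_fract [:0, 1:])"

definition Theta :: "'f::field poly fract alg_closure \<Rightarrow> 'f poly fract alg_closure" where
  "Theta \<eta> = 1 / (theta - \<eta>)"

text \<open>
  Exponents \<open>\<Sum>\<^sub>i a\<^sub>i \<sigma>\<^sup>i\<close> are encoded as polynomials in \<open>\<sigma>\<close> with natural coefficients.
\<close>

definition twisted_power :: "('a::field \<Rightarrow> 'a) \<Rightarrow> 'a \<Rightarrow> nat poly \<Rightarrow> 'a" where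
  "twisted_power s x a = (\<Prod>i\<le>Polynomial.degree a. ((s ^^ i) x) ^ Polynomial.coeff a i)"

definition gamma_exp :: "nat \<Rightarrow> nat \<Rightarrow> nat poly" where
  "gamma_exp q N = (\<Sum>i=0..N-1. Polynomial.monom (q ^ i) (N - 1 - i))"

context
  fixes \<eta> :: "'f::{finite,field} poly fract alg_closure"
begin

definition field_H :: "'f poly fract alg_closure set" where
  "field_H = generate_field type_ring (insert \<eta> (range to_ac))"

definition sigma_H :: "'f poly fract alg_closure \<Rightarrow> 'f poly fract alg_closure" where
  "sigma_H = (THE s. s \<in> carrier (galois_group field_H (range to_ac)) \<and> s \<eta> = \<eta> ^ CARD('f))"

definition eta_star :: "nat \<Rightarrow> 'f poly fract alg_closure" where
  "eta_star N = (\<eta> ^ (CARD('f) ^ (N - 1))) powi (1 - int CARD('f))"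

context
  fixes u :: "'f poly fract alg_closure"
begin

definition field_Hplus :: "'f poly fract alg_closure set" where
  "field_Hplus = generate_field type_ring ({\<eta>, u} \<union> range to_ac)"

definition sigma_inf :: "'f poly fract alg_closure \<Rightarrow> 'f poly fract alg_closure" where
  "sigma_inf = (THE s. s \<in> carrier (galois_group field_Hplus (range to_ac)) \<and>
     s u = (theta - \<eta>) ^ (CARD('f) - 1) * u ^ CARD('f) \<and> restrict s field_H = sigma_H)"

definition M_aut :: "'f poly fract alg_closure \<Rightarrow> 'f poly fract alg_closure \<Rightarrow> 'f poly fract alg_closure" where
  "M_aut \<mu> = (THE s. s \<in> carrier (galois_group field_Hplus (range to_ac)) \<and>
     s u = \<mu> * u \<and> restrict s field_H = (\<lambda>x\<in>field_H. x))"

definition sigma_zero :: "nat \<Rightarrow> 'f poly fract alg_closure \<Rightarrow> 'f poly fract alg_closure" where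
  "sigma_zero N = sigma_inf \<otimes>\<^bsub>galois_group field_Hplus (range to_ac)\<^esub> M_aut (eta_star N)"

end

end

end

theory Submission
  imports Defs "HOL-Number_Theory.Residues"
begin

text \<open>
  Both primes have degree one, with uniformizer \<open>1/\<theta>\<close> and \<open>\<theta>\<close>. After rescaling \<open>u\<close> to an element \<open>v\<close> (\<open>u\<theta>\<close> at infinity,
  \<open>u\<close> at zero), \<open>v\<^sup>W\<close> is a constant times powers of \<open>(1 - d\<pi>)\<^sup>-\<^sup>1\<close> with \<open>d\<close> constant. Let \<open>B\<close> be the ring generated over the
  local ring by \<open>\<eta>\<close>, \<open>v\<close> and these inverses. Modulo \<open>\<pi>\<close> its generators lie in a finite field, so a power \<open>b \<mapsto> b\<^sup>Q\<close> of
  Frobenius is the identity on \<open>B/\<pi>B\<close>. Hence every \<open>b \<in> B\<close> lying in a place above \<open>\<pi>\<close> satisfies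
  \<open>(1 - b\<^sup>Q\<^sup>-\<^sup>1) b \<in> \<pi>B\<close>, which shows that every element integral at the place is a quotient of elements of \<open>B\<close> whose
  denominator is a unit there, and the Frobenius congruence for \<open>\<sigma>\<^sub>\<infinity>\<close> and \<open>\<sigma>\<^sub>0\<close> need only be checked on the
  generators of \<open>B\<close>. The automorphisms exist because \<open>u\<close> has degree \<open>W\<close> over \<open>H\<close>, as seen from the order of \<open>u\<^sup>W\<close> at
  \<open>\<theta> = \<eta>\<close>.

  The divisor of \<open>T\<^sub>i\<close> on \<open>\<A>\<close> is \<open>(N - i)\<close> times the place at infinity plus \<open>i\<close> times the place at zero, and \<open>\<sigma>\<^sub>\<infinity>\<close> has
  order dividing \<open>N\<close>, so \<open>(T\<^sub>i)\<close> has symbol \<open>\<sigma>\<^sub>\<infinity>\<^sup>N\<^sup>-\<^sup>i \<sigma>\<^sub>0\<^sup>i = M\<^sup>i\<close> with \<open>\<sigma>\<^sub>0 = \<sigma>\<^sub>\<infinity> M\<close>.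
\<close>

hide_const (open) UnivPoly.monom UnivPoly.coeff Polynomials.degree Polynomials.lead_coeff
  Divisibility.irreducible

section \<open>Subrings and extensions of embeddings\<close>

text \<open>The Artin symbol is tested at every valuation ring of H^+ over a prime, and such a ring
  is given only abstractly, with neither discreteness nor finiteness over the local ring at hand;
  the explicit ring \<open>B\<close> replaces that structure. As the symbol is defined by unique
  existence, a place above each prime must also be produced, or the congruence would hold vacuously
  for all automorphisms: Chevalley's extension theorem does this. Uniqueness rests on constants
  staying distinct modulo a place; the roots of unity of order dividing W are constants. The
  rescaling comes from 1 + q + ... + q^(N-1) = W: the radicand has a zero of order W at infinity,
  removed by the factor \<theta>, whereas at zero it is a unit. There \<theta> - \<eta> reduces to
  -\<eta>, so \<sigma>(u) differs from u^q by the factor \<eta>^(q-1). The automorphism M corrects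
  this; since \<sigma> raises constants to the q-th power, its parameter must be the q-th root of
  \<eta>^(1-q). Exponents of ideals are computed from the two local rings alone; the other primes do
  not contain the ideals in question.\<close>

locale subring_set =
  fixes S :: "'a::field set"
  assumes one: "1 \<in> S" and diff: "x \<in> S \<Longrightarrow> y \<in> S \<Longrightarrow> x - y \<in> S" and mult: "x \<in> S \<Longrightarrow> y \<in> S \<Longrightarrow> x * y \<in> S"
begin

lemma zero: "0 \<in> S" using diff[OF one one] by simp
lemma uminus: "x \<in> S \<Longrightarrow> - x \<in> S" using diff[OF zero] by fastforce
lemma add: "x \<in> S \<Longrightarrow> y \<in> S \<Longrightarrow> x + y \<in> S" using diff[of x "-y"] uminus[of y] by simp
lemma power: "x \<in> S \<Longrightarrow> x ^ n \<in> S" by (induction n) (auto intro: one mult)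
lemma sum: "(\<And>i. i \<in> I \<Longrightarrow> g i \<in> S) \<Longrightarrow> sum g I \<in> S"
  by (induction I rule: infinite_finite_induct) (auto intro: zero add)
lemma prod: "(\<And>i. i \<in> I \<Longrightarrow> g i \<in> S) \<Longrightarrow> prod g I \<in> S"
  by (induction I rule: infinite_finite_induct) (auto intro: one mult)

lemmas closed = zero one diff uminus add mult power sum prod

definition polys :: "'a poly set" where "polys = {p. \<forall>i. coeff p i \<in> S}"

lemma polys_zero: "0 \<in> polys" by (simp add: polys_def zero)
lemma polys_one: "1 \<in> polys" by (auto simp: polys_def coeff_1 closed)
lemma polys_const: "c \<in> S \<Longrightarrow> [:c:] \<in> polys" by (auto simp: polys_def coeff_pCons closed split: nat.split)
lemma polys_X: "[:0, 1:] \<in> polys" by (auto simp: polys_def coeff_pCons closed split: nat.split)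
lemma polys_diff: "p \<in> polys \<Longrightarrow> r \<in> polys \<Longrightarrow> p - r \<in> polys" by (auto simp: polys_def closed)
lemma polys_add: "p \<in> polys \<Longrightarrow> r \<in> polys \<Longrightarrow> p + r \<in> polys" by (auto simp: polys_def closed)
lemma polys_mult: "p \<in> polys \<Longrightarrow> r \<in> polys \<Longrightarrow> p * r \<in> polys"
  by (auto simp: polys_def coeff_mult closed)
lemma polys_monom: "c \<in> S \<Longrightarrow> monom c n \<in> polys" by (auto simp: polys_def closed)
lemma polys_smult: "c \<in> S \<Longrightarrow> p \<in> polys \<Longrightarrow> smult c p \<in> polys" by (auto simp: polys_def closed)
lemma polys_power: "p \<in> polys \<Longrightarrow> p ^ n \<in> polys" by (induction n) (auto intro: polys_one polys_mult)
lemma polys_prod: "(\<And>i. i \<in> I \<Longrightarrow> g i \<in> polys) \<Longrightarrow> prod g I \<in> polys"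
  by (induction I rule: infinite_finite_induct) (auto intro: polys_one polys_mult)
lemma lead_coeff_in: "p \<in> polys \<Longrightarrow> lead_coeff p \<in> S" by (auto simp: polys_def)

definition adjoin :: "'a \<Rightarrow> 'a set" where "adjoin x = (\<lambda>p. poly p x) ` polys"

lemma adjoinI: "p \<in> polys \<Longrightarrow> poly p x \<in> adjoin x" by (auto simp: adjoin_def)

lemma subring_adjoin: "subring_set (adjoin x)"
proof
  show "1 \<in> adjoin x" using adjoinI[OF polys_one, of x] by simp
  fix a b assume "a \<in> adjoin x" "b \<in> adjoin x"
  then obtain p r where "p \<in> polys" "r \<in> polys" "a = poly p x" "b = poly r x" by (auto simp: adjoin_def)
  then show "a - b \<in> adjoin x" "a * b \<in> adjoin x"
    using adjoinI[OF polys_diff[of p r], of x] adjoinI[OF polys_mult[of p r], of x] by auto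
qed

lemma base_adjoin: "S \<subseteq> adjoin x"
  using adjoinI[OF polys_const, of _ x] by auto

lemma gen_adjoin: "x \<in> adjoin x"
  using adjoinI[OF polys_X, of x] by simp

lemma adjoin_subset:
  assumes "subring_set R" "S \<subseteq> R" "x \<in> R"
  shows "adjoin x \<subseteq> R"
proof -
  interpret R: subring_set R by fact
  show ?thesis using assms(2,3) by (auto simp: adjoin_def poly_altdef polys_def intro!: R.closed)
qed

text \<open>Long division by a monic polynomial never divides coefficients, so everything stays over
  \<open>S\<close>; \<open>min\<close> makes the remainder, a smaller polynomial with root
  \<open>x\<close>, vanish.\<close>

lemma monic_dvd:
  assumes m: "m \<in> polys" "lead_coeff m = 1"
    and min: "\<And>p. p \<in> polys \<Longrightarrow> degree p < degree m \<Longrightarrow> poly p x = 0 \<Longrightarrow> p = 0"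
    and mx: "poly m x = 0"
    and p: "p \<in> polys" "poly p x = 0"
  shows "\<exists>g\<in>polys. p = m * g"
  using p
proof (induction "degree p" arbitrary: p rule: less_induct)
  case less
  show ?case
  proof (cases "degree p < degree m")
    case True
    then have "p = 0" using min less by blast
    then show ?thesis using polys_zero by (intro bexI[of _ 0]) auto
  next
    case False
    define t where "t = monom (lead_coeff p) (degree p - degree m)"
    have t: "t \<in> polys" unfolding t_def by (intro polys_monom lead_coeff_in less)
    define p' where "p' = p - m * t"
    have p': "p' \<in> polys" "poly p' x = 0"
      unfolding p'_def using t m mx less by (auto intro: polys_diff polys_mult)
    show ?thesis
    proof (cases "p = 0")
      case True then show ?thesis using polys_zero by (intro bexI[of _ 0]) auto
    next
      case nz: False
      have m0: "m \<noteq> 0" using m by auto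
      have t0: "t \<noteq> 0" using nz by (simp add: t_def)
      have dt: "degree (m * t) = degree p" using False nz m0 t0
        by (simp add: degree_mult_eq) (simp add: t_def degree_monom_eq)
      have lc: "coeff (m * t) (degree p) = lead_coeff p"
        using dt m(2) lead_coeff_mult[of m t] nz by (simp add: t_def degree_monom_eq)
      \<comment> \<open>The degree cannot drop when \<open>p\<close> is constant; there cancelling
        the leading term leaves zero.\<close>
      have "degree p' < degree p \<or> p' = 0"
      proof (cases "degree p = 0")
        case True
        then have "degree p' = 0" using dt unfolding p'_def by (metis degree_diff_le le_zero_eq order_refl)
        moreover have "coeff p' 0 = 0" using lc True by (simp add: p'_def)
        ultimately have "p' = 0" by (metis leading_coeff_0_iff)
        then show ?thesis ..
      next
        case False
        have "degree p' \<le> degree p" unfolding p'_def using dt by (simp add: degree_diff_le)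
        moreover have "coeff p' (degree p) = 0" using lc by (simp add: p'_def)
        ultimately show ?thesis using eq_zero_or_degree_less by blast
      qed
      then show ?thesis
      proof
        assume "degree p' < degree p"
        from less(1)[OF this p'] obtain g where "g \<in> polys" "p' = m * g" by blast
        then have "p = m * (g + t)" "g + t \<in> polys" using t by (auto simp: p'_def algebra_simps intro: polys_add)
        then show ?thesis by blast
      next
        assume "p' = 0"
        then show ?thesis using t by (intro bexI[of _ t]) (auto simp: p'_def)
      qed
    qed
  qed
qed

text \<open>Maps are total on the ambient field and constrained only on \<open>S\<close>; values
  elsewhere stay arbitrary until \<open>restrict\<close> makes them extensional.\<close>

definition hom_on :: "('a \<Rightarrow> 'a) \<Rightarrow> bool" where
  "hom_on f \<longleftrightarrow> f 1 = 1 \<and> (\<forall>x\<in>S. \<forall>y\<in>S. f (x + y) = f x + f y \<and> f (x * y) = f x * f y)"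

context
  fixes f assumes f: "hom_on f"
begin

lemma hom_on_add: "x \<in> S \<Longrightarrow> y \<in> S \<Longrightarrow> f (x + y) = f x + f y" using f by (auto simp: hom_on_def)
lemma hom_on_mult: "x \<in> S \<Longrightarrow> y \<in> S \<Longrightarrow> f (x * y) = f x * f y" using f by (auto simp: hom_on_def)
lemma hom_on_one: "f 1 = 1" using f by (auto simp: hom_on_def)
lemma hom_on_zero: "f 0 = 0" using hom_on_add[OF zero zero] by (metis add.right_neutral add_left_cancel)
lemma hom_on_uminus: "x \<in> S \<Longrightarrow> f (- x) = - f x"
  using hom_on_add[of x "-x"] uminus[of x] hom_on_zero by (simp add: eq_neg_iff_add_eq_0 add.commute)
lemma hom_on_diff: "x \<in> S \<Longrightarrow> y \<in> S \<Longrightarrow> f (x - y) = f x - f y"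
  using hom_on_add[of x "-y"] uminus[of y] hom_on_uminus by simp
lemma hom_on_power: "x \<in> S \<Longrightarrow> f (x ^ n) = f x ^ n"
  by (induction n) (auto simp: hom_on_one hom_on_mult power)
lemma hom_on_sum: "(\<And>i. i \<in> I \<Longrightarrow> g i \<in> S) \<Longrightarrow> f (sum g I) = (\<Sum>i\<in>I. f (g i))"
  by (induction I rule: infinite_finite_induct) (auto simp: hom_on_zero hom_on_add sum)
lemma hom_on_prod: "(\<And>i. i \<in> I \<Longrightarrow> g i \<in> S) \<Longrightarrow> f (prod g I) = (\<Prod>i\<in>I. f (g i))"
  by (induction I rule: infinite_finite_induct) (auto simp: hom_on_one hom_on_mult prod)

lemma hom_on_inverse:
  assumes "x \<in> S" "inverse x \<in> S"
  shows "f (inverse x) = inverse (f x)"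
proof (cases "x = 0")
  case False
  then have "f x * f (inverse x) = 1" using hom_on_mult[OF assms] by (simp add: hom_on_one)
  then show ?thesis by (metis inverse_unique)
qed (simp add: hom_on_zero)

lemma map_poly_diff_on: "p \<in> polys \<Longrightarrow> r \<in> polys \<Longrightarrow> map_poly f (p - r) = map_poly f p - map_poly f r"
  by (rule poly_eqI) (simp add: coeff_map_poly hom_on_zero hom_on_diff polys_def)
lemma map_poly_add_on: "p \<in> polys \<Longrightarrow> r \<in> polys \<Longrightarrow> map_poly f (p + r) = map_poly f p + map_poly f r"
  by (rule poly_eqI) (simp add: coeff_map_poly hom_on_zero hom_on_add polys_def)
lemma map_poly_mult_on: "p \<in> polys \<Longrightarrow> r \<in> polys \<Longrightarrow> map_poly f (p * r) = map_poly f p * map_poly f r"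
  by (rule poly_eqI) (simp add: coeff_map_poly hom_on_zero hom_on_mult coeff_mult hom_on_sum polys_def closed)

text \<open>By \<open>monic_dvd\<close>, evaluation at \<open>x\<close> has kernel generated by
  \<open>m\<close>. Any root \<open>y\<close> of the image of \<open>m\<close> therefore makes the
  map from p(x) to the image of p evaluated at \<open>y\<close> well defined.\<close>

lemma extend_hom:
  assumes m: "m \<in> polys" "lead_coeff m = 1"
    and min: "\<And>p. p \<in> polys \<Longrightarrow> degree p < degree m \<Longrightarrow> poly p x = 0 \<Longrightarrow> p = 0"
    and mx: "poly m x = 0" and my: "poly (map_poly f m) y = 0"
  shows "\<exists>g. subring_set.hom_on (adjoin x) g \<and> (\<forall>z\<in>S. g z = f z) \<and> g x = y"
proof -
  interpret X: subring_set "adjoin x" by (rule subring_adjoin)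
  define g where "g z = poly (map_poly f (SOME p. p \<in> polys \<and> poly p x = z)) y" for z
  have g: "g (poly p x) = poly (map_poly f p) y" if p: "p \<in> polys" for p
  proof -
    define r where "r = (SOME r. r \<in> polys \<and> poly r x = poly p x)"
    have r: "r \<in> polys \<and> poly r x = poly p x" unfolding r_def by (rule someI[of _ p]) (use p in auto)
    have "\<exists>g\<in>polys. r - p = m * g"
      by (rule monic_dvd[OF m min mx]) (use r p in \<open>auto intro: polys_diff\<close>)
    then obtain h where h: "h \<in> polys" "r - p = m * h" by blast
    have "map_poly f r - map_poly f p = map_poly f m * map_poly f h"
      using r p h m by (simp flip: map_poly_diff_on map_poly_mult_on)
    then have "poly (map_poly f r) y - poly (map_poly f p) y = 0"
      using my by (metis mult_zero_left poly_diff poly_mult)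
    then show ?thesis by (simp add: g_def r_def)
  qed
  have "X.hom_on g" unfolding X.hom_on_def
  proof (intro conjI ballI)
    show "g 1 = 1" using g[OF polys_one] by (simp add: hom_on_one hom_on_zero)
    fix a b assume "a \<in> adjoin x" "b \<in> adjoin x"
    then obtain p r where *: "p \<in> polys" "r \<in> polys" "a = poly p x" "b = poly r x" by (auto simp: adjoin_def)
    show "g (a + b) = g a + g b" using * g[OF polys_add[of p r]] by (simp add: g map_poly_add_on)
    show "g (a * b) = g a * g b" using * g[OF polys_mult[of p r]] by (simp add: g map_poly_mult_on)
  qed
  moreover have "g z = f z" if "z \<in> S" for z
    using g[OF polys_const[OF that]] hom_on_zero by (simp add: map_poly_pCons)
  moreover have "g x = y" using g[OF polys_X] hom_on_zero hom_on_one by (simp add: map_poly_pCons)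
  ultimately show ?thesis by blast
qed

end

end

locale subfield_set = subring_set +
  assumes inverse: "x \<in> S \<Longrightarrow> inverse x \<in> S"
begin
lemma divide: "x \<in> S \<Longrightarrow> y \<in> S \<Longrightarrow> x / y \<in> S" by (auto simp: divide_inverse intro: closed inverse)
end

section \<open>Translation between subsets of a field and the rings of abstract algebra\<close>

lemma type_ring_simps [simp]:
  "carrier (type_ring :: 'a::field ring) = UNIV" "x \<oplus>\<^bsub>type_ring\<^esub> y = (x + y :: 'a::field)"
  "x \<otimes>\<^bsub>type_ring\<^esub> y = (x * y :: 'a)" "\<one>\<^bsub>type_ring\<^esub> = (1 :: 'a)" "\<zero>\<^bsub>type_ring\<^esub> = (0 :: 'a)"
  by (simp_all add: ring_of_type_algebra_def)

lemma type_ring_a_inv [simp]: "\<ominus>\<^bsub>type_ring\<^esub> x = (- x :: 'a::field)"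
proof -
  interpret R: ring "type_ring :: 'a ring" by (rule ring_from_type_algebra)
  show ?thesis using R.minus_equality[of "-x" x] by simp
qed

lemma type_ring_m_inv: "x \<noteq> 0 \<Longrightarrow> inv\<^bsub>type_ring\<^esub> x = (inverse x :: 'a::field)"
proof -
  interpret R: field "type_ring :: 'a ring" by (rule field_from_type_algebra)
  show "x \<noteq> 0 \<Longrightarrow> ?thesis" using R.comm_inv_char[of x "inverse x"] by simp
qed

lemma subring_iff: "subring V (type_ring :: 'a::field ring) \<longleftrightarrow> subring_set V"
proof
  interpret R: ring "type_ring :: 'a ring" by (rule ring_from_type_algebra)
  { assume a: "subring V (type_ring :: 'a ring)"
    show "subring_set V"
    proof
      show "1 \<in> V" using subringE(3)[OF a] by simp
      fix x y assume xy: "x \<in> V" "y \<in> V"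
      then have "- y \<in> V" using subringE(5)[OF a, of y] by simp
      then show "x - y \<in> V" using subringE(7)[OF a, of x "-y"] xy by simp
      show "x * y \<in> V" using subringE(6)[OF a, of x "y"] xy by simp
    qed }
  { assume "subring_set V"
    then interpret V: subring_set V .
    show "subring V (type_ring :: 'a ring)"
      by (rule R.subringI) (auto intro: V.closed) }
qed

text \<open>Replaces the inductive closure by the universal property of the least subfield.\<close>

lemma generate_field_eqI:
  fixes H :: "'a::field set"
  assumes "subfield_set L" "H \<subseteq> L" "\<And>R. subfield_set R \<Longrightarrow> H \<subseteq> R \<Longrightarrow> L \<subseteq> R"
  shows "generate_field type_ring H = L"
proof (rule equalityI)
  interpret L: subfield_set L by fact
  show "generate_field type_ring H \<subseteq> L"
  proof
    fix x assume "x \<in> generate_field type_ring H"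
    then show "x \<in> L"
    proof induction
      case (m_inv h) then show ?case using type_ring_m_inv[of h] L.inverse[of h] by simp
    qed (use assms(2) in \<open>auto intro: L.closed\<close>)
  qed
  have "subfield_set (generate_field type_ring H)"
  proof
    show "1 \<in> generate_field type_ring H" using generate_field.one[of type_ring H] by simp
    fix x y assume xy: "x \<in> generate_field type_ring H" "y \<in> generate_field type_ring H"
    then have "- y \<in> generate_field type_ring H" using generate_field.a_inv[of y type_ring H] by simp
    from generate_field.eng_add[OF xy(1) this] show "x - y \<in> generate_field type_ring H" by simp
    show "x * y \<in> generate_field type_ring H" using generate_field.eng_mult[OF xy] by simp
  next
    fix x assume x: "x \<in> generate_field type_ring H"
    then show "inverse x \<in> generate_field type_ring H"
    proof (cases "x = 0")
      case False then show ?thesis using generate_field.m_inv[OF x] type_ring_m_inv[of x] by simp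
    qed (use x in simp)
  qed
  then show "L \<subseteq> generate_field type_ring H"
    by (rule assms(3)) (auto intro: generate_field.incl)
qed

section \<open>Subrings and embeddings of algebraic extensions\<close>

lemma alg_closure_algebraic_nonzero:
  fixes x :: "'a::field alg_closure"
  assumes "x \<noteq> 0"
  obtains p :: "'a poly" where "poly p 0 \<noteq> 0" "poly (map_poly to_ac p) x = 0"
proof -
  obtain p :: "'a poly" where p: "p \<noteq> 0" "poly (map_poly to_ac p) x = 0" by (rule alg_closure_algebraic)
  have "\<exists>r :: 'a poly. poly r 0 \<noteq> 0 \<and> poly (map_poly to_ac r) x = 0"
    using p
  proof (induction p)
    case (pCons a p)
    show ?case
    proof (cases "a = 0")
      case True
      then have "poly (map_poly to_ac p) x = 0" "p \<noteq> 0" using pCons assms by (auto simp: map_poly_pCons)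
      then show ?thesis using pCons.IH by blast
    next
      case False
      then show ?thesis using pCons.prems by (intro exI[of _ "pCons a p"]) auto
    qed
  qed simp
  then show ?thesis using that by blast
qed

text \<open>From a + x r(x) = 0 with nonzero constant term a one reads off the inverse -r(x)/a, a
  polynomial in x over the base field.\<close>

lemma subfield_set_alg_closure:
  fixes R :: "'a::field alg_closure set"
  assumes "subring_set R" "range to_ac \<subseteq> R"
  shows "subfield_set R"
proof -
  interpret R: subring_set R by fact
  have "inverse x \<in> R" if x: "x \<in> R" for x
  proof (cases "x = 0")
    case False
    then obtain p :: "'a poly" where p: "poly p 0 \<noteq> 0" "poly (map_poly to_ac p) x = 0"
      by (rule alg_closure_algebraic_nonzero)
    obtain a r where ar: "p = pCons a r" by (cases p)
    have eq: "to_ac a + x * poly (map_poly to_ac r) x = 0" and a: "a \<noteq> 0"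
      using p by (auto simp: ar map_poly_pCons)
    have "poly (map_poly to_ac r) x \<in> R"
      unfolding poly_altdef by (intro R.sum R.mult R.power x) (use assms(2) in \<open>auto simp: coeff_map_poly\<close>)
    then have "- poly (map_poly to_ac r) x * to_ac (inverse a) \<in> R"
      using assms(2) by (intro R.mult R.uminus) (auto simp del: to_ac_inverse)
    moreover have "x * (- poly (map_poly to_ac r) x * to_ac (inverse a)) = 1"
    proof -
      have "x * poly (map_poly to_ac r) x = - to_ac a" using eq by (metis add_eq_0_iff)
      then show ?thesis using a by (simp add: mult.assoc[symmetric])
    qed
    ultimately show ?thesis by (metis inverse_unique)
  qed (use x in simp)
  then show ?thesis by (intro subfield_set.intro subfield_set_axioms.intro assms) auto
qed

text \<open>An embedding of an algebraic extension into itself permutes the finitely many roots of each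
  polynomial, so it is onto.\<close>
lemma bij_betw_hom_alg_closure:
  fixes R :: "'a::field alg_closure set"
  assumes "subring_set R" "range to_ac \<subseteq> R" "subring_set.hom_on R f"
    and fix_f: "\<And>x. f (to_ac x) = to_ac x" and im: "f ` R \<subseteq> R"
  shows "bij_betw f R R"
proof -
  interpret R: subring_set R by fact
  interpret RF: subfield_set R by (rule subfield_set_alg_closure[OF assms(1,2)])
  note f = assms(3)
  have inj: "inj_on f R"
  proof (rule inj_onI)
    fix x y assume xy: "x \<in> R" "y \<in> R" "f x = f y"
    then have d: "x - y \<in> R" "f (x - y) = 0" using R.hom_on_diff[OF f] by (auto intro: R.closed)
    show "x = y"
    proof (rule ccontr)
      assume "x \<noteq> y"
      then have "f (x - y) * f (inverse (x - y)) = 1"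
        using R.hom_on_mult[OF f d(1) RF.inverse[OF d(1)]] R.hom_on_one[OF f] by simp
      then show False using d by simp
    qed
  qed
  moreover have "x \<in> f ` R" if x: "x \<in> R" for x
  proof -
    obtain p :: "'a poly" where p: "p \<noteq> 0" "poly (map_poly to_ac p) x = 0" by (rule alg_closure_algebraic)
    define Z where "Z = {z \<in> R. poly (map_poly to_ac p) z = 0}"
    have "map_poly to_ac p \<noteq> 0" using p(1) by (auto simp: poly_eq_iff coeff_map_poly)
    then have fin: "finite Z" unfolding Z_def
      using poly_roots_finite[of "map_poly to_ac p"] by (auto intro: rev_finite_subset)
    have "f ` Z \<subseteq> Z"
    proof (clarsimp simp: Z_def, intro conjI)
      fix z assume z: "z \<in> R" "poly (map_poly to_ac p) z = 0"
      show "f z \<in> R" using im z by auto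
      have c: "to_ac (coeff p i) \<in> R" for i using assms(2) by blast
      have "f (poly (map_poly to_ac p) z) = (\<Sum>i\<le>degree (map_poly to_ac p). f (to_ac (coeff p i) * z ^ i))"
        unfolding poly_altdef
        by (subst R.hom_on_sum[OF f]) (use z c in \<open>auto simp: coeff_map_poly intro: R.mult R.power\<close>)
      also have "\<dots> = poly (map_poly to_ac p) (f z)"
        unfolding poly_altdef using z(1) c
        by (intro sum.cong) (simp_all add: coeff_map_poly R.hom_on_mult[OF f] R.hom_on_power[OF f] R.power fix_f)
      finally have "poly (map_poly to_ac p) (f z) = f (poly (map_poly to_ac p) z)" by simp
      then show "poly (map_poly to_ac p) (f z) = 0" using z R.hom_on_zero[OF f] by simp
    qed
    moreover have "inj_on f Z" using inj by (rule inj_on_subset) (auto simp: Z_def)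
    ultimately have "f ` Z = Z" using fin by (rule endo_inj_surj[rotated])
    then show ?thesis using p x by (auto simp: Z_def)
  qed
  ultimately show ?thesis using im by (auto simp: bij_betw_def)
qed

section \<open>Galois groups as groups of extensional maps\<close>

lemma galois_group_memI:
  fixes R :: "'a::field alg_closure set"
  assumes "subring_set R" "range to_ac \<subseteq> R" "subring_set.hom_on R f"
    and fix_f: "\<And>x. f (to_ac x) = to_ac x" and im: "f ` R \<subseteq> R"
  shows "restrict f R \<in> carrier (galois_group R (range to_ac))"
proof -
  interpret R: subring_set R by fact
  have "bij_betw (restrict f R) R R" using bij_betw_hom_alg_closure[OF assms] by simp
  then show ?thesis using assms(2)
    by (auto simp: galois_group_def ring_iso_def ring_hom_def R.closed fix_f
        R.hom_on_mult[OF assms(3)] R.hom_on_add[OF assms(3)] R.hom_on_one[OF assms(3)] im[THEN subsetD])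
qed

lemma galois_groupD:
  assumes "subring_set R" "s \<in> carrier (galois_group R k)"
  shows "subring_set.hom_on R s" "\<And>x. x \<in> R \<Longrightarrow> s x \<in> R" "s \<in> extensional R" "\<And>x. x \<in> k \<Longrightarrow> s x = x"
    "bij_betw s R R"
  using assms(2) subring_set.hom_on_def[OF assms(1), of s]
  by (auto simp: galois_group_def ring_iso_def ring_hom_def)

lemma galois_group_mult:
  assumes "s \<in> carrier (galois_group R k)" "t \<in> carrier (galois_group R k)"
  shows "s \<otimes>\<^bsub>galois_group R k\<^esub> t = compose R s t"
  using assms by (auto simp: galois_group_def BijGroup_def Bij_def ring_iso_def)

lemma galois_group_one: "\<one>\<^bsub>galois_group R k\<^esub> = (\<lambda>x\<in>R. x)"
  by (simp add: galois_group_def BijGroup_def)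

lemma group_galois_group:
  fixes R k :: "'a::field set"
  assumes "subring_set R" "k \<subseteq> R"
  shows "group (galois_group R k)"
proof (rule groupI)
  interpret R: subring_set R by fact
  let ?G = "galois_group R k"
  have mem: "s \<in> carrier ?G \<longleftrightarrow> s \<in> extensional R \<and> R.hom_on s \<and> bij_betw s R R \<and> (\<forall>x\<in>k. s x = x)" for s
    by (auto simp: galois_group_def ring_iso_def ring_hom_def R.hom_on_def bij_betw_def)
  note D = galois_groupD[OF assms(1)]
  show one: "\<one>\<^bsub>?G\<^esub> \<in> carrier ?G"
    unfolding galois_group_one mem using assms(2)
    by (auto simp: R.hom_on_def R.closed bij_betw_def inj_on_def)
  fix s assume s: "s \<in> carrier ?G"
  show "\<one>\<^bsub>?G\<^esub> \<otimes>\<^bsub>?G\<^esub> s = s"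
    using D[OF s] galois_group_mult[OF one s]
    by (intro ext) (auto simp: galois_group_one compose_def extensional_def)
  show "\<exists>t\<in>carrier ?G. t \<otimes>\<^bsub>?G\<^esub> s = \<one>\<^bsub>?G\<^esub>"
  proof -
    define t where "t = restrict (inv_into R s) R"
    note b = D(5)[OF s]
    have ts: "t (s x) = x" if "x \<in> R" for x using that D(2)[OF s] b by (simp add: t_def bij_betw_def)
    have st: "s (t x) = x" "t x \<in> R" if "x \<in> R" for x
      using that b by (auto simp: t_def bij_betw_def f_inv_into_f inv_into_into)
    have "t \<in> carrier ?G" unfolding mem R.hom_on_def
    proof (intro conjI ballI)
      show "t \<in> extensional R" by (simp add: t_def)
      show "bij_betw t R R" using bij_betw_inv_into[OF b] by (simp add: t_def)
      show "t 1 = 1" using ts[OF R.one] R.hom_on_one[OF D(1)[OF s]] by simp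
      show "t x = x" if "x \<in> k" for x using ts[of x] that assms(2) D(4)[OF s that] by auto
      fix x y assume "x \<in> R" "y \<in> R"
      then show "t (x + y) = t x + t y"
        using ts[of "t x + t y"] R.hom_on_add[OF D(1)[OF s], of "t x" "t y"] st by (simp add: R.closed)
      show "t (x * y) = t x * t y" using \<open>x \<in> R\<close> \<open>y \<in> R\<close>
        using ts[of "t x * t y"] R.hom_on_mult[OF D(1)[OF s], of "t x" "t y"] st by (simp add: R.closed)
    qed
    moreover have "compose R t s = (\<lambda>x\<in>R. x)" by (auto simp: compose_def ts)
    ultimately show ?thesis using galois_group_mult[OF _ s] galois_group_one by metis
  qed
  fix t assume t: "t \<in> carrier ?G"
  show st: "s \<otimes>\<^bsub>?G\<^esub> t \<in> carrier ?G" if "s \<in> carrier ?G" "t \<in> carrier ?G" for s t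
    unfolding galois_group_mult[OF that] mem
  proof (intro conjI ballI)
    show "compose R s t \<in> extensional R" by simp
    show "R.hom_on (compose R s t)" unfolding R.hom_on_def
      using D(1,2)[OF that(1)] D(1,2)[OF that(2)]
      by (auto simp: compose_def R.closed R.hom_on_def)
    show "bij_betw (compose R s t) R R" by (rule bij_betw_compose[OF D(5)[OF that(2)] D(5)[OF that(1)]])
    show "compose R s t x = x" if "x \<in> k" for x
      using that assms(2) D(4)[OF \<open>s \<in> _\<close> that] D(4)[OF \<open>t \<in> _\<close> that] by (auto simp: compose_def)
  qed
  fix r assume r: "r \<in> carrier ?G"
  show "s \<otimes>\<^bsub>?G\<^esub> t \<otimes>\<^bsub>?G\<^esub> r = s \<otimes>\<^bsub>?G\<^esub> (t \<otimes>\<^bsub>?G\<^esub> r)"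
  proof -
    have "s \<otimes>\<^bsub>?G\<^esub> t \<otimes>\<^bsub>?G\<^esub> r = compose R (compose R s t) r"
      using galois_group_mult[OF st[OF s t] r] galois_group_mult[OF s t] by simp
    also have "\<dots> = compose R s (compose R t r)" using D(2)[OF r] by (auto simp: compose_def)
    also have "\<dots> = s \<otimes>\<^bsub>?G\<^esub> (t \<otimes>\<^bsub>?G\<^esub> r)"
      using galois_group_mult[OF s st[OF t r]] galois_group_mult[OF t r] by simp
    finally show ?thesis .
  qed
qed

section \<open>The Frobenius map\<close>

text \<open>Multiplication by a nonzero x permutes the nonzero elements, so their product is
  unchanged when multiplied by x^(q-1).\<close>

lemma finite_field_power_card:
  fixes x :: "'f::{finite,field}"
  shows "x ^ CARD('f) = x"
proof (cases "x = 0")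
  case False
  have "x * (\<Prod>y\<in>UNIV-{0}. x * y) = x * x ^ (CARD('f) - 1) * \<Prod>(UNIV-{0})"
    by (simp add: prod.distrib mult_ac)
  also have "x * x ^ (CARD('f) - 1) = x ^ Suc (CARD('f) - 1)"
    by (subst power_Suc) auto
  also have "Suc (CARD('f) - 1) = CARD('f)" by simp
  also have "(\<Prod>y\<in>UNIV-{0}. x * y) = (\<Prod>y\<in>UNIV-{0}. y)"
    by (rule prod.reindex_bij_witness[of _ "\<lambda>y. y / x" "\<lambda>y. x * y"]) (use False in auto)
  finally show ?thesis by simp
qed simp

lemma card_field_ge_2: "CARD('f::{finite,field}) \<ge> 2"
proof -
  have "card {0, 1 :: 'f} \<le> CARD('f)" by (rule card_mono) auto
  then show ?thesis by simp
qed

text \<open>The polynomial \<open>(X + 1)\<^sup>q - X\<^sup>q - 1\<close> has degree below \<open>q\<close> and vanishes at all \<open>q\<close> elements of the field.\<close>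
lemma of_nat_card_choose:
  assumes k: "0 < k" "k < CARD('f::{finite,field})"
  shows "of_nat (CARD('f) choose k) = (0::'f)"
proof -
  let ?q = "CARD('f)"
  define P :: "'f poly" where "P = (\<Sum>i=1..<?q. monom (of_nat (?q choose i)) i)"
  have "poly P c = poly 0 c" for c
  proof -
    have "c + 1 = (c + 1) ^ ?q" by (simp add: finite_field_power_card)
    also have "\<dots> = (\<Sum>i\<le>?q. of_nat (?q choose i) * c ^ i)" by (simp add: binomial_ring)
    also have "{..?q} = insert 0 (insert ?q {1..<?q})" by auto
    also have "(\<Sum>i\<in>insert 0 (insert ?q {1..<?q}). of_nat (?q choose i) * c ^ i)
      = 1 + (c + (\<Sum>i\<in>{1..<?q}. of_nat (?q choose i) * c ^ i))"
      by (simp add: finite_field_power_card)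
    finally show ?thesis by (simp add: P_def poly_sum poly_monom)
  qed
  moreover have "degree P < ?q"
  proof -
    have "degree P \<le> ?q - 1" unfolding P_def
      by (rule degree_sum_le) (auto intro: order_trans[OF degree_monom_le])
    then show ?thesis using card_field_ge_2[where 'f='f] by linarith
  qed
  ultimately have "P = 0" by (intro poly_eqI_degree[of UNIV]) auto
  then have "coeff P k = 0" by simp
  moreover have "coeff P k = of_nat (?q choose k)"
    using k by (simp add: P_def coeff_sum)
  ultimately show ?thesis by simp
qed

definition const_ac :: "'f::field \<Rightarrow> 'f poly fract alg_closure" where
  "const_ac c = to_ac (to_fract [:c:])"

lemma const_ac_simps [simp]:
  fixes a b :: "'f::field"
  shows
  "const_ac (0::'f) = 0" "const_ac (1::'f) = 1" "const_ac (a + b) = const_ac a + const_ac b"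
  "const_ac (a * b) = const_ac a * const_ac b" "const_ac (- a) = - const_ac a"
  "const_ac (a - b) = const_ac a - const_ac b" "const_ac a = const_ac b \<longleftrightarrow> a = b"
  "const_ac a = 0 \<longleftrightarrow> a = 0" "const_ac (a ^ n) = const_ac a ^ n"
proof -
  show *: "const_ac (1::'f) = 1" "const_ac (a * b) = const_ac a * const_ac b" for a b
    by (auto simp: const_ac_def simp flip: one_pCons to_ac_mult to_fract_mult)
  show "const_ac (a ^ n) = const_ac a ^ n" by (induction n) (auto simp: *)
qed (auto simp: const_ac_def simp flip: to_ac_add to_fract_add to_ac_diff to_fract_diff to_ac_minus to_fract_uminus)

lemma const_ac_of_nat: "const_ac (of_nat n) = of_nat n"
  by (induction n) auto

lemma const_ac_sum: "const_ac (sum g A) = (\<Sum>x\<in>A. const_ac (g x))"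
  by (induction A rule: infinite_finite_induct) auto

context
  fixes F :: "'f::{finite,field} itself" and q
  defines "q \<equiv> CARD('f)"
begin

text \<open>Here q is only a prime power; the inner binomial coefficients vanish by
  \<open>of_nat_card_choose\<close>, carried from F_q into the closure by
  \<open>const_ac\<close>.\<close>

lemma frob_add_1: "(x + y) ^ q = x ^ q + (y :: 'f poly fract alg_closure) ^ q"
proof -
  have "{..q} = insert 0 (insert q {1..<q})" by auto
  moreover have "of_nat (q choose i) = (0 :: 'f poly fract alg_closure)" if "i \<in> {1..<q}" for i
    using of_nat_card_choose[where 'f='f, of i] that by (metis atLeastLessThan_iff const_ac_of_nat const_ac_simps(1) less_eq_Suc_le One_nat_def q_def)
  moreover have "q > 0" by (simp add: q_def)
  ultimately show ?thesis by (simp add: binomial_ring)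
qed

lemma frob_add: "(x + y) ^ q ^ n = x ^ q ^ n + (y :: 'f poly fract alg_closure) ^ q ^ n"
proof (induction n)
  case (Suc n)
  have "(x + y) ^ q ^ Suc n = ((x + y) ^ q ^ n) ^ q" by (simp add: mult.commute flip: power_mult)
  also have "\<dots> = (x ^ q ^ n) ^ q + (y ^ q ^ n) ^ q" by (simp add: Suc frob_add_1)
  finally show ?case by (simp add: mult.commute flip: power_mult)
qed simp

lemma card_pow_pos: "q ^ n > 0" by (simp add: q_def)

lemma frob_diff: "(x - y) ^ q ^ n = x ^ q ^ n - (y :: 'f poly fract alg_closure) ^ q ^ n"
  using frob_add[of "x - y" y n] by simp

lemma frob_uminus: "(- x) ^ q ^ n = - ((x :: 'f poly fract alg_closure) ^ q ^ n)"
  using frob_diff[of 0 x n] card_pow_pos[of n] by (simp add: power_0_left)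

lemma frob_sum: "(\<Sum>i\<in>I. g i) ^ q ^ n = (\<Sum>i\<in>I. (g i :: 'f poly fract alg_closure) ^ q ^ n)"
  using card_pow_pos[of n] by (induction I rule: infinite_finite_induct) (auto simp: frob_add power_0_left)

lemma frob_inj: "x ^ q ^ n = y ^ q ^ n \<longleftrightarrow> x = (y :: 'f poly fract alg_closure)"
  using frob_diff[of x y n] card_pow_pos[of n] by (metis eq_iff_diff_eq_0 power_eq_0_iff)

lemma frob_frob: "(x ^ q ^ m) ^ q ^ n = (x :: 'a::monoid_mult) ^ q ^ (m + n)"
  by (simp add: power_add flip: power_mult)

lemma frob_const_ac: "const_ac (c::'f) ^ q ^ n = const_ac c"
proof (induction n)
  case (Suc n)
  then have "const_ac c ^ q ^ Suc n = const_ac c ^ q"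
    using frob_frob[of "const_ac c" n 1] by simp
  then show ?case by (simp add: q_def finite_field_power_card flip: const_ac_simps(9))
qed simp

lemma frob_poly_const_ac:
  "poly (map_poly const_ac f) (x ^ q ^ n) = poly (map_poly const_ac (f :: 'f poly)) x ^ q ^ n"
  by (simp add: poly_altdef frob_sum power_mult_distrib coeff_map_poly frob_const_ac mult.commute
      flip: power_mult)

end

lemma theta_power: "theta ^ k = to_ac (to_fract (monom (1::'f::field) k))"
proof -
  have *: "to_fract ([:0, 1::'f:] ^ k) = to_fract [:0, 1:] ^ k" for k
    by (induction k) (simp_all only: power_0 power_Suc to_fract_1 to_fract_mult)
  then have "to_ac (to_fract (monom (1::'f) k)) = to_ac (to_fract [:0, 1:] ^ k)" by (simp add: monom_altdef)
  then show ?thesis by (simp only: theta_def to_ac_power * )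
qed

lemma to_ac_to_fract_poly: "to_ac (to_fract p) = poly (map_poly const_ac p) theta"
proof -
  have add: "to_fract (a + b) = to_fract a + to_fract b" for a b :: "'a poly" by (simp add: to_fract_def)
  have mult: "to_fract (a * b) = to_fract a * to_fract b" for a b :: "'a poly" by (simp add: to_fract_def)
  show ?thesis
  proof (induction p)
    case 0 then show ?case by (simp add: to_fract_def flip: Zero_fract_def)
  next
    case (pCons a p)
    have "pCons a p = [:a:] + [:0, 1:] * p" by simp
    then have "to_ac (to_fract (pCons a p)) = const_ac a + theta * to_ac (to_fract p)"
      by (metis add mult const_ac_def theta_def to_ac_add to_ac_mult)
    then show ?case using pCons by (simp add: map_poly_pCons)
  qed
qed

lemma inj_theta_power: "inj (\<lambda>k. theta ^ k :: 'f::field poly fract alg_closure)"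
proof (rule injI)
  fix i j assume "theta ^ i = (theta ^ j :: 'f poly fract alg_closure)"
  then have "monom (1::'f) i = monom 1 j" by (simp add: theta_power to_fract_def eq_fract)
  then show "i = j" by (metis degree_monom_eq one_neq_zero)
qed

text \<open>All powers of x lie in the finite set \<open>V\<close> of combinations of 1, ...,
  x^(d-1) over \<open>S\<close>, which multiplication by x maps into itself.\<close>

lemma (in subfield_set) finite_powers:
  assumes "finite S" "p \<in> polys" "p \<noteq> 0" "poly p x = 0"
  shows "finite (range (\<lambda>k. x ^ k))"
proof -
  define d where "d = degree p"
  define V where "V = (\<lambda>f. \<Sum>i<d. f i * x ^ i) ` PiE {..<d} (\<lambda>_. S)"
  have memV: "(\<Sum>i<d. f i * x ^ i) \<in> V" if "\<And>i. i < d \<Longrightarrow> f i \<in> S" for f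
    unfolding V_def by (rule image_eqI[of _ _ "restrict f {..<d}"]) (use that in \<open>auto intro!: sum.cong\<close>)
  have d: "d > 0" using assms(3,4) unfolding d_def by (metis degree_eq_zeroE gr0I mult_zero_right poly_0 poly_pCons add.right_neutral pCons_0_0)
  have top: "x ^ d = (\<Sum>i<d. (- coeff p i / lead_coeff p) * x ^ i)"
  proof -
    have "0 = (\<Sum>i\<le>d. coeff p i * x ^ i)" using assms(4) by (simp add: poly_altdef d_def)
    also have "\<dots> = (\<Sum>i<d. coeff p i * x ^ i) + lead_coeff p * x ^ d"
      by (simp add: d_def flip: lessThan_Suc_atMost)
    finally have "lead_coeff p * x ^ d = - (\<Sum>i<d. coeff p i * x ^ i)" by (simp add: eq_neg_iff_add_eq_0 add.commute)
    then have "x ^ d = - (\<Sum>i<d. coeff p i * x ^ i) / lead_coeff p" using assms(3) by (simp add: field_simps)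
    then show ?thesis by (simp add: sum_divide_distrib sum_negf)
  qed
  have mult: "x * v \<in> V" if vV: "v \<in> V" for v
  proof -
    obtain f where f: "f \<in> PiE {..<d} (\<lambda>_. S)" "v = (\<Sum>i<d. f i * x ^ i)"
      using vV unfolding V_def by blast
    obtain e where e: "d = Suc e" using d by (cases d) auto
    have fS: "f i \<in> S" if "i < d" for i using f that by auto
    \<comment> \<open>Multiplication by x shifts the coefficients up by one; the power x^d produced
      at the top is rewritten with the equation of x.\<close>
    define g where "g i = (if i = 0 then 0 else f (i - 1)) + f e * (- coeff p i / lead_coeff p)" for i
    have "x * v = (\<Sum>i<d. f i * x ^ Suc i)" by (simp add: f sum_distrib_left mult_ac)
    also have "\<dots> = (\<Sum>i<e. f i * x ^ Suc i) + f e * x ^ d" by (simp add: e)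
    also have "(\<Sum>i<e. f i * x ^ Suc i) = (\<Sum>i<d. (if i = 0 then 0 else f (i - 1)) * x ^ i)"
      unfolding e by (subst sum.lessThan_Suc_shift) simp
    also have "f e * x ^ d = (\<Sum>i<d. f e * (- coeff p i / lead_coeff p) * x ^ i)"
      unfolding top sum_distrib_left by (simp add: mult.assoc)
    also have "(\<Sum>i<d. (if i = 0 then 0 else f (i - 1)) * x ^ i) + \<dots> = (\<Sum>i<d. g i * x ^ i)"
      by (simp only: g_def distrib_right sum.distrib)
    finally have eq: "x * v = (\<Sum>i<d. g i * x ^ i)" .
    have "g i \<in> S" if "i < d" for i
      unfolding g_def using fS[of e] fS[of "i - 1"] that e assms(2) by (auto simp: polys_def intro!: closed divide)
    then show ?thesis unfolding eq by (rule memV)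
  qed
  have "x ^ k \<in> V" for k
  proof (induction k)
    case 0
    have "(\<Sum>i<d. (if i = 0 then 1 else 0) * x ^ i) \<in> V" by (rule memV) (auto intro: closed)
    moreover have "(\<Sum>i<d. (if i = 0 then 1 else 0) * x ^ i) = (\<Sum>i\<in>{0}. x ^ i)"
      by (rule sum.mono_neutral_cong_right) (use d in auto)
    ultimately show ?case by simp
  next
    case (Suc k) then show ?case using mult by simp
  qed
  moreover have "finite V" unfolding V_def using assms(1) by (intro finite_imageI finite_PiE) auto
  ultimately show ?thesis by (auto intro: finite_subset)
qed

text \<open>If \<theta> were algebraic over a finite field, it would have only finitely many powers,
  against \<open>inj_theta_power\<close>.\<close>

lemma theta_transcendental:
  assumes "subfield_set S" "finite S" "p \<in> subring_set.polys S" "poly p theta = 0"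
  shows "p = 0"
proof (rule ccontr)
  assume "p \<noteq> 0"
  from subfield_set.finite_powers[OF assms(1-3) this assms(4)] inj_theta_power show False
    by (meson finite_imageD infinite_UNIV_nat)
qed

section \<open>The constant field extension\<close>

lemma map_poly_const_ac_mult: "map_poly const_ac (f * g) = map_poly const_ac f * map_poly const_ac g"
  by (rule poly_eqI) (simp add: coeff_map_poly coeff_mult const_ac_sum)

lemma map_poly_const_ac_add: "map_poly const_ac (f + g) = map_poly const_ac f + map_poly const_ac g"
  by (rule poly_eqI) (simp add: coeff_map_poly)

lemma power_commute_exp: "((x::'a::monoid_mult) ^ m) ^ n = (x ^ n) ^ m"
  by (simp add: mult.commute flip: power_mult)

text \<open>The fixed points are the roots of X^(q^d) - X, which bounds their number; additivity and
  multiplicativity of the power map make them a subfield.\<close>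

lemma frob_fixed:
  fixes d :: nat
  assumes "d > 0"
  defines "S \<equiv> {z :: 'f::{finite,field} poly fract alg_closure. z ^ CARD('f) ^ d = z}"
  shows "finite S" "card S \<le> CARD('f) ^ d" "subfield_set S"
proof -
  let ?p = "monom 1 (CARD('f) ^ d) - [:0, 1:] :: 'f poly fract alg_closure poly"
  have q: "CARD('f) ^ d \<ge> 2"
    using card_field_ge_2[where 'f='f] assms(1) self_le_power[of "CARD('f)" d] by linarith
  then have "coeff ?p (CARD('f) ^ d) = 1" using assms(1) by (auto simp: coeff_pCons split: nat.split)
  then have nz: "?p \<noteq> 0" by (metis coeff_0 zero_neq_one)
  have S: "S = {z. poly ?p z = 0}" by (auto simp: S_def poly_monom)
  show "finite S" unfolding S by (rule poly_roots_finite[OF nz])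
  have "degree ?p \<le> CARD('f) ^ d" using q by (intro degree_diff_le) (auto simp: degree_monom_eq)
  then show "card S \<le> CARD('f) ^ d" unfolding S using card_poly_roots_bound[OF nz] by linarith
  show "subfield_set S"
    by standard (auto simp: S_def frob_diff power_mult_distrib power_inverse)
qed

locale constant_extension =
  fixes \<rho> :: "'f::{finite,field} poly" and N :: nat and \<eta> :: "'f poly fract alg_closure"
  assumes lead_coeff_rho: "lead_coeff \<rho> = 1" and irreducible_rho: "irreducible \<rho>"
    and degree_rho: "degree \<rho> = N" and N_ge_2: "N \<ge> 2"
    and root_rho: "poly (map_poly const_ac \<rho>) \<eta> = 0"
begin

abbreviation conj_eta :: "nat \<Rightarrow> 'f poly fract alg_closure" where "conj_eta j \<equiv> \<eta> ^ CARD('f) ^ j"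

text \<open>The field with q^N elements inside the closure. As a fixed-point set it is a subfield
  with at most q^N elements at once; that it equals F_q(\<eta>) is \<open>consts_eq\<close>.\<close>

definition constants :: "'f poly fract alg_closure set" where "constants = {z. z ^ CARD('f) ^ N = z}"

sublocale C: subfield_set constants unfolding constants_def using frob_fixed(3)[of N] N_ge_2 by simp

lemma finite_consts: "finite constants" and card_consts: "card constants \<le> CARD('f) ^ N"
  unfolding constants_def using frob_fixed(1,2)[of N] N_ge_2 by simp_all

text \<open>Descent: \<rho> mod f is a smaller polynomial with root \<eta>, so it vanishes and f
  divides the irreducible \<rho>. Then f or its cofactor is a unit, and a nonzero constant f has no
  root while a constant cofactor contradicts the degrees.\<close>

lemma min_degree:
  assumes "poly (map_poly const_ac f) \<eta> = 0" "degree f < N"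
  shows "f = 0"
  using assms
proof (induction "degree f" arbitrary: f rule: less_induct)
  case less
  show ?case
  proof (rule ccontr)
    assume f: "f \<noteq> 0"
    have "map_poly const_ac \<rho> = map_poly const_ac f * map_poly const_ac (\<rho> div f) + map_poly const_ac (\<rho> mod f)"
      by (metis map_poly_const_ac_add map_poly_const_ac_mult mult_div_mod_eq)
    then have "poly (map_poly const_ac (\<rho> mod f)) \<eta> = 0" using less(2) root_rho by simp
    moreover have "\<rho> mod f = 0 \<or> degree (\<rho> mod f) < degree f" by (rule degree_mod_less[OF f])
    ultimately have "\<rho> mod f = 0" using less by (meson order_less_trans)
    then obtain g where g: "\<rho> = f * g" by (metis dvd_def mod_eq_0_iff_dvd)
    then have "is_unit f \<or> is_unit g" using irreducible_rho by (auto dest: irreducibleD)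
    then show False
    proof
      assume "is_unit f"
      then obtain c where "f = [:c:]" by (metis is_unit_polyE)
      then show False using less(2) f by (auto simp: map_poly_pCons)
    next
      assume "is_unit g"
      then have "degree g = 0" "g \<noteq> 0" by (auto elim: is_unit_polyE)
      then show False using g f less(3) degree_rho by (simp add: degree_mult_eq)
    qed
  qed
qed

definition eval_eta :: "(nat \<Rightarrow> 'f) \<Rightarrow> 'f poly fract alg_closure" where
  "eval_eta f = (\<Sum>i<N. const_ac (f i) * \<eta> ^ i)"

text \<open>Two coefficient families with equal values differ by a polynomial of degree below N
  vanishing at \<eta>; so \<open>min_degree\<close> keeps all q^N values apart.\<close>

lemma card_eval_eta: "card (range eval_eta) \<ge> CARD('f) ^ N"
proof -
  let ?F = "PiE {..<N} (\<lambda>_. UNIV :: 'f set)"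
  have "inj_on eval_eta ?F"
  proof (rule inj_onI)
    fix f g assume fg: "f \<in> ?F" "g \<in> ?F" "eval_eta f = eval_eta g"
    define p where "p = (\<Sum>i<N. monom (f i - g i) i)"
    have cp: "coeff p i = (if i < N then f i - g i else 0)" for i
      by (auto simp: p_def coeff_sum)
    have "degree p \<le> N - 1" by (rule degree_le) (auto simp: cp)
    then have dp: "degree p < N" using N_ge_2 by linarith
    have "map_poly const_ac p = (\<Sum>i<N. monom (const_ac (f i - g i)) i)"
      by (rule poly_eqI) (auto simp: coeff_map_poly coeff_sum cp)
    then have "poly (map_poly const_ac p) \<eta> = (\<Sum>i<N. (const_ac (f i) - const_ac (g i)) * \<eta> ^ i)"
      by (simp add: poly_sum poly_monom)
    also have "\<dots> = eval_eta f - eval_eta g"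
      by (simp add: eval_eta_def sum_subtractf left_diff_distrib)
    finally have "p = 0" using min_degree[of p] dp fg by simp
    then have "f i = g i" if "i < N" for i using cp[of i] that by simp
    then show "f = g" using fg(1,2) by (intro PiE_ext) auto
  qed
  then have "card (eval_eta ` ?F) = CARD('f) ^ N" by (simp add: card_image card_PiE)
  moreover have "range eval_eta = eval_eta ` ?F"
  proof
    show "range eval_eta \<subseteq> eval_eta ` ?F"
    proof (clarify)
      fix f show "eval_eta f \<in> eval_eta ` ?F"
        by (rule image_eqI[of _ _ "restrict f {..<N}"]) (auto simp: eval_eta_def)
    qed
  qed auto
  ultimately show ?thesis by simp
qed

lemma eval_eta_fixed: "\<eta> ^ CARD('f) ^ d = \<eta> \<Longrightarrow> eval_eta f ^ CARD('f) ^ d = eval_eta f"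
  unfolding eval_eta_def frob_sum power_mult_distrib frob_const_ac
  by (intro sum.cong refl arg_cong2[of _ _ _ _ "(*)"]) (metis power_commute_exp)

text \<open>If the q^d-power map fixed \<eta>, it would fix all q^N combinations of its powers, but
  it has at most q^d fixed points.\<close>

lemma conj_eta_neq:
  assumes "0 < d" "d < N"
  shows "conj_eta d \<noteq> \<eta>"
proof
  assume *: "conj_eta d = \<eta>"
  note f = frob_fixed[where 'f='f, OF assms(1)]
  have "range eval_eta \<subseteq> {z. z ^ CARD('f) ^ d = z}" using eval_eta_fixed[OF *] by auto
  from card_mono[OF f(1) this] have "CARD('f) ^ N \<le> CARD('f) ^ d" using card_eval_eta f(2) by linarith
  then show False using assms card_field_ge_2[where 'f='f] by (simp add: power_le_imp_le_exp leD)
qed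

text \<open>The q^i-power map is injective, so the first exponent may be taken to be 0. The endpoint
  j = N is kept as an exception because it is the coincidence that \<open>conj_eta_N\<close>
  extracts.\<close>

lemma conj_eta_inj:
  assumes "conj_eta i = conj_eta j" "i < N" "j \<le> N" "i \<le> j"
  shows "i = j \<or> (i = 0 \<and> j = N)"
proof (rule ccontr)
  assume *: "\<not> ?thesis"
  then have ij: "0 < j - i" "j - i < N" using assms by auto
  have "conj_eta (j - i) ^ CARD('f) ^ i = \<eta> ^ CARD('f) ^ i"
    using assms by (simp add: frob_frob)
  then show False using conj_eta_neq[OF ij] by (simp add: frob_inj)
qed

lemma conj_eta_eq_iff: "i < N \<Longrightarrow> j < N \<Longrightarrow> conj_eta i = conj_eta j \<longleftrightarrow> i = j"
  using conj_eta_inj[of i j] conj_eta_inj[of j i] by (metis nat_le_linear nat_less_le)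

lemma root_conj_eta: "poly (map_poly const_ac \<rho>) (conj_eta j) = 0"
  unfolding frob_poly_const_ac root_rho by (rule zero_power) simp

lemma map_rho: "map_poly const_ac \<rho> \<noteq> 0" "degree (map_poly const_ac \<rho>) = N"
proof -
  have "degree (map_poly const_ac \<rho>) = degree \<rho>" by (rule degree_map_poly) simp
  then show "degree (map_poly const_ac \<rho>) = N" using degree_rho by simp
  then show "map_poly const_ac \<rho> \<noteq> 0" using N_ge_2 by auto
qed

lemma conj_eta_roots: "{z. poly (map_poly const_ac \<rho>) z = 0} = conj_eta ` {..<N}"
proof -
  have "conj_eta ` {..<N} \<subseteq> {z. poly (map_poly const_ac \<rho>) z = 0}" using root_conj_eta by auto
  moreover have "card (conj_eta ` {..<N}) = N"
    by (subst card_image) (auto simp: inj_on_def conj_eta_eq_iff)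
  moreover have "card {z. poly (map_poly const_ac \<rho>) z = 0} \<le> N"
    using card_poly_roots_bound[OF map_rho(1)] map_rho(2) by simp
  ultimately show ?thesis
    using card_seteq[OF poly_roots_finite[OF map_rho(1)]] by metis
qed

text \<open>The N-th conjugate is a root of \<rho>, hence equal to one of index below N, and
  \<open>conj_eta_inj\<close> leaves only the index 0.\<close>

lemma conj_eta_N: "conj_eta N = \<eta>"
proof -
  obtain j where j: "j < N" "conj_eta N = conj_eta j"
    using root_conj_eta[of N] conj_eta_roots by blast
  then have "j = 0" using conj_eta_inj[of j N] by auto
  then show ?thesis using j by simp
qed

lemma eta_in_consts: "\<eta> \<in> constants" using conj_eta_N by (simp add: constants_def)

lemma conj_eta_in_consts: "conj_eta j \<in> constants" by (intro C.power eta_in_consts)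

lemma const_ac_in_consts: "const_ac c \<in> constants" by (simp add: constants_def frob_const_ac)

lemma consts_eq: "constants = range eval_eta"
proof -
  have "range eval_eta \<subseteq> constants"
    unfolding eval_eta_def by (auto intro!: C.closed const_ac_in_consts eta_in_consts)
  then show ?thesis
    using card_seteq[OF finite_consts] card_consts card_eval_eta by (metis order_trans)
qed

lemma eta_nonzero: "\<eta> \<noteq> 0"
proof
  assume "\<eta> = 0"
  then have "poly (map_poly const_ac [:0, 1:]) \<eta> = 0" by (simp add: map_poly_pCons)
  from min_degree[OF this] N_ge_2 show False by simp
qed

lemma consts_power: "c \<in> constants \<Longrightarrow> c \<noteq> 0 \<Longrightarrow> c ^ (CARD('f) ^ N - 1) = 1"
  by (simp add: constants_def power_diff)

lemma C_transcendental: "p \<in> C.polys \<Longrightarrow> poly p theta = 0 \<longleftrightarrow> p = 0"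
  using theta_transcendental[OF C.subfield_set_axioms finite_consts] by auto

section \<open>The field K(\<eta>) and its Frobenius automorphism\<close>

lemma hom_frob: "C.hom_on (\<lambda>c. c ^ CARD('f))"
  using frob_add[where 'f='f and n=1] by (auto simp: C.hom_on_def power_mult_distrib)

definition frob_poly :: "'f poly fract alg_closure poly \<Rightarrow> 'f poly fract alg_closure poly" where
  "frob_poly = map_poly (\<lambda>c. c ^ CARD('f))"

lemma frob_poly_polys: "p \<in> C.polys \<Longrightarrow> frob_poly p \<in> C.polys"
  by (auto simp: C.polys_def frob_poly_def coeff_map_poly C.power)

lemma frob_poly_eq_0: "frob_poly p = 0 \<longleftrightarrow> p = 0"
  by (auto simp: frob_poly_def poly_eq_iff coeff_map_poly)

lemmas frob_poly_mult = C.map_poly_mult_on[OF hom_frob, folded frob_poly_def]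
lemmas frob_poly_add = C.map_poly_add_on[OF hom_frob, folded frob_poly_def]

text \<open>K(\<eta>) in the form F_(q^N)(\<theta>): an explicit quotient of polynomials lets an
  automorphism be defined through the coefficients and orders be taken at \<theta> = \<eta>.\<close>

definition H :: "'f poly fract alg_closure set" where
  "H = {poly a theta / poly b theta | a b. a \<in> C.polys \<and> b \<in> C.polys \<and> b \<noteq> 0}"

lemma H_I: "a \<in> C.polys \<Longrightarrow> b \<in> C.polys \<Longrightarrow> b \<noteq> 0 \<Longrightarrow> poly a theta / poly b theta \<in> H"
  by (auto simp: H_def)

lemma H_E:
  assumes "x \<in> H"
  obtains a b where "a \<in> C.polys" "b \<in> C.polys" "b \<noteq> 0" "poly b theta \<noteq> 0" "x = poly a theta / poly b theta"
  using assms that by (auto simp: H_def C_transcendental)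

sublocale H: subfield_set H
proof
  show "1 \<in> H" using H_I[OF C.polys_one C.polys_one] by simp
  fix x y assume "x \<in> H" "y \<in> H"
  then obtain a b c d where *: "a \<in> C.polys" "b \<in> C.polys" "b \<noteq> 0" "poly b theta \<noteq> 0"
    "c \<in> C.polys" "d \<in> C.polys" "d \<noteq> 0" "poly d theta \<noteq> 0" and
    xy: "x = poly a theta / poly b theta" "y = poly c theta / poly d theta"
    by (metis H_E)
  have "x - y = poly (a * d - c * b) theta / poly (b * d) theta" using * by (simp add: xy field_simps)
  also have "\<dots> \<in> H" using * by (intro H_I C.polys_diff C.polys_mult) auto
  finally show "x - y \<in> H" .
  have "x * y = poly (a * c) theta / poly (b * d) theta" using * by (simp add: xy)
  also have "\<dots> \<in> H" using * by (intro H_I C.polys_diff C.polys_mult) auto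
  finally show "x * y \<in> H" .
next
  fix x assume "x \<in> H"
  then obtain a b where *: "a \<in> C.polys" "b \<in> C.polys" "b \<noteq> 0" "x = poly a theta / poly b theta"
    by (metis H_E)
  show "inverse x \<in> H"
  proof (cases "a = 0")
    case True
    then show ?thesis using H_I[OF C.polys_zero C.polys_one] * by simp
  next
    case False
    then show ?thesis using H_I[of b a] * by simp
  qed
qed

lemma poly_theta_in_H: "a \<in> C.polys \<Longrightarrow> poly a theta \<in> H"
  using H_I[OF _ C.polys_one] by fastforce

lemma consts_subset_H: "constants \<subseteq> H"
  using poly_theta_in_H[OF C.polys_const] by auto

lemma theta_in_H: "theta \<in> H"
  using poly_theta_in_H[OF C.polys_X] by simp

lemma map_const_ac_polys: "map_poly const_ac a \<in> C.polys"
  by (auto simp: C.polys_def coeff_map_poly const_ac_in_consts)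

lemma to_ac_eq:
  obtains a b where "to_ac x = poly (map_poly const_ac a) theta / poly (map_poly const_ac b) theta" "b \<noteq> 0"
proof -
  obtain a b where "x = Fract a b" "b \<noteq> 0" by (cases x)
  then have "to_ac x = poly (map_poly const_ac a) theta / poly (map_poly const_ac b) theta"
    by (simp add: Fract_conv_to_fract to_ac_to_fract_poly)
  then show ?thesis using \<open>b \<noteq> 0\<close> that by blast
qed

lemma map_poly_const_ac_eq_0: "map_poly const_ac b = 0 \<longleftrightarrow> b = 0"
  by (auto simp: poly_eq_iff coeff_map_poly)

lemma to_ac_in_H: "to_ac x \<in> H"
proof -
  obtain a b where "to_ac x = poly (map_poly const_ac a) theta / poly (map_poly const_ac b) theta" "b \<noteq> 0"
    by (rule to_ac_eq)
  then show ?thesis using H_I[of "map_poly const_ac a" "map_poly const_ac b"]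
    by (simp add: map_const_ac_polys map_poly_const_ac_eq_0)
qed

lemma range_to_ac_subset_H: "range to_ac \<subseteq> H" using to_ac_in_H by auto

lemma consts_subset:
  assumes "subring_set R" "\<eta> \<in> R" "\<And>c. const_ac c \<in> R"
  shows "constants \<subseteq> R"
proof -
  interpret R: subring_set R by fact
  show ?thesis unfolding consts_eq eval_eta_def using assms(2,3) by (auto intro!: R.closed)
qed

lemma H_subset:
  assumes "subring_set R" "\<eta> \<in> R" "range to_ac \<subseteq> R"
  shows "H \<subseteq> R"
proof -
  interpret R: subfield_set R by (rule subfield_set_alg_closure[OF assms(1,3)])
  have C: "constants \<subseteq> R" by (rule consts_subset) (use assms in \<open>auto simp: const_ac_def\<close>)
  have "theta \<in> R" using assms(3) by (auto simp: theta_def)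
  then have "poly a theta \<in> R" if "a \<in> C.polys" for a
    using that C by (auto simp: poly_altdef C.polys_def intro!: R.closed)
  then show "H \<subseteq> R" by (auto simp: H_def intro!: R.divide)
qed

lemma field_H_eq: "field_H \<eta> = H"
  unfolding field_H_def
proof (rule generate_field_eqI)
  show "subfield_set H" by (rule H.subfield_set_axioms)
  show "insert \<eta> (range to_ac) \<subseteq> H" using to_ac_in_H consts_subset_H eta_in_consts by auto
  fix R assume "subfield_set R" "insert \<eta> (range to_ac) \<subseteq> R"
  then show "H \<subseteq> R" by (intro H_subset) (auto simp: subfield_set_def)
qed

text \<open>The automorphism of \<open>H\<close> acting as Frobenius on the coefficients. The value does not depend on the chosen
  quotient because \<open>\<theta>\<close> is transcendental over the constants.\<close>
definition sig :: "'f poly fract alg_closure \<Rightarrow> 'f poly fract alg_closure" where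
  "sig x = (SOME y. \<exists>a\<in>C.polys. \<exists>b\<in>C.polys. b \<noteq> 0 \<and> x = poly a theta / poly b theta \<and>
     y = poly (frob_poly a) theta / poly (frob_poly b) theta)"

lemma sig_eq:
  assumes "a \<in> C.polys" "b \<in> C.polys" "b \<noteq> 0"
  shows "sig (poly a theta / poly b theta) = poly (frob_poly a) theta / poly (frob_poly b) theta"
  unfolding sig_def
proof (rule some_equality)
  fix y assume "\<exists>c\<in>C.polys. \<exists>d\<in>C.polys. d \<noteq> 0 \<and> poly a theta / poly b theta = poly c theta / poly d theta \<and>
     y = poly (frob_poly c) theta / poly (frob_poly d) theta"
  then obtain c d where *: "c \<in> C.polys" "d \<in> C.polys" "d \<noteq> 0"
    "poly a theta / poly b theta = poly c theta / poly d theta"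
    "y = poly (frob_poly c) theta / poly (frob_poly d) theta" by blast
  have nz: "poly b theta \<noteq> 0" "poly d theta \<noteq> 0" "poly (frob_poly b) theta \<noteq> 0" "poly (frob_poly d) theta \<noteq> 0"
    using assms * by (simp_all add: C_transcendental frob_poly_polys frob_poly_eq_0)
  then have "poly (a * d - c * b) theta = 0" using * by (simp add: field_simps)
  then have "a * d = c * b"
    using assms * by (subst (asm) C_transcendental) (auto intro!: C.polys_diff C.polys_mult)
  then have "frob_poly a * frob_poly d = frob_poly c * frob_poly b"
    using assms * by (metis frob_poly_mult)
  then have "poly (frob_poly a) theta * poly (frob_poly d) theta = poly (frob_poly c) theta * poly (frob_poly b) theta"
    by (metis poly_mult)
  then show "y = poly (frob_poly a) theta / poly (frob_poly b) theta"
    using nz unfolding *(5) by (simp add: field_simps)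
qed (use assms in auto)

lemma frob_poly_one: "frob_poly 1 = 1"
  by (auto simp: frob_poly_def)

lemma sig_poly: "a \<in> C.polys \<Longrightarrow> sig (poly a theta) = poly (frob_poly a) theta"
  using sig_eq[OF _ C.polys_one, of a] by (simp add: frob_poly_one)

lemma sig_const: "c \<in> constants \<Longrightarrow> sig c = c ^ CARD('f)"
  using sig_poly[OF C.polys_const[of c]] by (simp add: frob_poly_def map_poly_pCons)

lemma sig_to_ac: "sig (to_ac x) = to_ac x"
proof -
  obtain a b where ab: "to_ac x = poly (map_poly const_ac a) theta / poly (map_poly const_ac b) theta" "b \<noteq> 0"
    by (rule to_ac_eq)
  have "frob_poly (map_poly const_ac a) = map_poly const_ac a" for a :: "'f poly"
    using frob_const_ac[where 'f='f and n=1] by (simp add: frob_poly_def poly_eq_iff coeff_map_poly)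
  then show ?thesis using sig_eq[of "map_poly const_ac a" "map_poly const_ac b"] ab
    by (simp add: map_const_ac_polys map_poly_const_ac_eq_0)
qed

lemma sig_in_H: "x \<in> H \<Longrightarrow> sig x \<in> H"
  by (elim H_E) (auto simp: sig_eq frob_poly_eq_0 intro!: H_I frob_poly_polys)

lemma hom_sig: "H.hom_on sig"
  unfolding H.hom_on_def
proof (intro conjI ballI)
  show "sig 1 = 1" using sig_const[OF C.one] by simp
  fix x y assume "x \<in> H" "y \<in> H"
  then obtain a b c d where *: "a \<in> C.polys" "b \<in> C.polys" "b \<noteq> 0" "poly b theta \<noteq> 0"
    "c \<in> C.polys" "d \<in> C.polys" "d \<noteq> 0" "poly d theta \<noteq> 0" and
    xy: "x = poly a theta / poly b theta" "y = poly c theta / poly d theta"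
    by (metis H_E)
  have nz: "poly (frob_poly b) theta \<noteq> 0" "poly (frob_poly d) theta \<noteq> 0"
    using * by (simp_all add: C_transcendental frob_poly_polys frob_poly_eq_0)
  have "x + y = poly (a * d + c * b) theta / poly (b * d) theta"
    using *(4,8) by (simp add: xy add_frac_eq)
  then have "sig (x + y) = poly (frob_poly (a * d + c * b)) theta / poly (frob_poly (b * d)) theta"
    using sig_eq[of "a * d + c * b" "b * d"] * by (simp add: C.polys_add C.polys_mult del: poly_mult)
  also have "frob_poly (a * d + c * b) = frob_poly a * frob_poly d + frob_poly c * frob_poly b"
    using * by (simp only: frob_poly_add frob_poly_mult C.polys_mult)
  also have "frob_poly (b * d) = frob_poly b * frob_poly d" using * by (simp only: frob_poly_mult)
  also have "poly (frob_poly a * frob_poly d + frob_poly c * frob_poly b) theta / poly (frob_poly b * frob_poly d) theta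
      = poly (frob_poly a) theta / poly (frob_poly b) theta + poly (frob_poly c) theta / poly (frob_poly d) theta"
    using nz by (simp add: add_frac_eq)
  also have "\<dots> = sig x + sig y"
    by (simp only: xy sig_eq[OF *(1-3)] sig_eq[OF *(5-7)])
  finally show "sig (x + y) = sig x + sig y" .
  have "x * y = poly (a * c) theta / poly (b * d) theta" using * by (simp add: xy)
  then have "sig (x * y) = poly (frob_poly (a * c)) theta / poly (frob_poly (b * d)) theta"
    using sig_eq[of "a * c" "b * d"] * by (simp add: C.polys_mult del: poly_mult)
  then show "sig (x * y) = sig x * sig y"
    using * by (simp add: xy sig_eq frob_poly_mult)
qed

text \<open>Uniqueness: a candidate is known at \<eta>, hence on all constants, which are
  polynomials in \<eta> over F_q. It fixes \<theta>, an element of K, and so is known on all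
  quotients.\<close>

lemma sigma_H_eq: "sigma_H \<eta> = restrict sig H"
  unfolding sigma_H_def field_H_eq
proof (rule the_equality)
  show "restrict sig H \<in> carrier (galois_group H (range to_ac)) \<and> restrict sig H \<eta> = \<eta> ^ CARD('f)"
    using galois_group_memI[OF H.subring_set_axioms range_to_ac_subset_H hom_sig sig_to_ac] sig_in_H
      consts_subset_H eta_in_consts sig_const by auto
  fix s assume s: "s \<in> carrier (galois_group H (range to_ac)) \<and> s \<eta> = \<eta> ^ CARD('f)"
  then have s': "H.hom_on s" "\<And>x. x \<in> H \<Longrightarrow> s x \<in> H" "s \<in> extensional H" "\<And>x. s (to_ac x) = to_ac x" "s \<eta> = \<eta> ^ CARD('f)"
    using galois_groupD[OF H.subring_set_axioms, of s "range to_ac"] by auto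
  have sc: "s c = c ^ CARD('f)" if c: "c \<in> constants" for c
  proof -
    obtain f where c: "c = eval_eta f" using c by (auto simp: consts_eq)
    have m: "const_ac (f i) \<in> H" "\<eta> ^ i \<in> H" for i
      using consts_subset_H const_ac_in_consts eta_in_consts by (auto intro!: H.power)
    have "s (const_ac (f i)) = const_ac (f i)" for i using s'(4) by (simp add: const_ac_def)
    then have "s c = (\<Sum>i<N. const_ac (f i) * (\<eta> ^ CARD('f)) ^ i)"
      unfolding c eval_eta_def using m m(2)[of 1] s'(5)
      by (simp add: H.hom_on_sum[OF s'(1)] H.hom_on_mult[OF s'(1)] H.hom_on_power[OF s'(1)] H.mult)
    also have "\<dots> = c ^ CARD('f) ^ 1"
      unfolding c eval_eta_def frob_sum by (simp add: power_mult_distrib frob_const_ac[where 'f='f and n=1, simplified] mult.commute flip: power_mult)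
    finally show ?thesis by simp
  qed
  have st: "s theta = theta" using s'(4) by (simp add: theta_def)
  have sp: "s (poly a theta) = poly (frob_poly a) theta" if "a \<in> C.polys" for a
  proof -
    have m: "coeff a i \<in> constants" "coeff a i \<in> H" for i using that consts_subset_H by (auto simp: C.polys_def)
    have "s (poly a theta) = (\<Sum>i\<le>degree a. coeff a i ^ CARD('f) * theta ^ i)"
      unfolding poly_altdef using m theta_in_H
      by (simp add: H.hom_on_sum[OF s'(1)] H.hom_on_mult[OF s'(1)] H.hom_on_power[OF s'(1)] H.mult H.power sc st)
    also have "degree a = degree (frob_poly a)" unfolding frob_poly_def by (rule degree_map_poly[symmetric]) simp
    finally show ?thesis by (simp add: poly_altdef frob_poly_def coeff_map_poly)
  qed
  show "s = restrict sig H"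
  proof
    fix x show "s x = restrict sig H x"
    proof (cases "x \<in> H")
      case True
      then obtain a b where *: "a \<in> C.polys" "b \<in> C.polys" "b \<noteq> 0" "poly b theta \<noteq> 0" "x = poly a theta / poly b theta"
        by (rule H_E)
      then have "s x = poly (frob_poly a) theta / poly (frob_poly b) theta"
        using poly_theta_in_H[OF *(1)] poly_theta_in_H[OF *(2)] H.inverse[OF poly_theta_in_H[OF *(2)]]
        by (simp add: divide_inverse H.hom_on_mult[OF s'(1)] H.hom_on_inverse[OF s'(1)] sp)
      then show ?thesis using True * by (simp add: sig_eq)
    next
      case False then show ?thesis using s'(3) by (simp add: extensional_def)
    qed
  qed
qed

lemma sig_Theta: "sig (1 / (theta - conj_eta j)) = 1 / (theta - conj_eta (Suc j))"
proof -
  let ?b = "[:- conj_eta j, 1:]"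
  have b: "?b \<in> C.polys" using conj_eta_in_consts[of j]
    by (auto simp: C.polys_def coeff_pCons C.closed split: nat.split)
  have "frob_poly ?b = [:- conj_eta (Suc j), 1:]"
    using frob_uminus[of "conj_eta j" 1] by (simp add: frob_poly_def map_poly_pCons mult.commute flip: power_mult)
  then show ?thesis using sig_eq[OF C.polys_one b] by (simp add: frob_poly_one)
qed

lemma theta_minus_in_H: "theta - conj_eta j \<in> H"
  using theta_in_H conj_eta_in_consts consts_subset_H by (auto intro: H.diff)

lemma theta_minus_nonzero: "c \<in> constants \<Longrightarrow> theta - c \<noteq> 0"
  using C_transcendental[of "[:-c, 1:]"]
  by (force simp: C.polys_def coeff_pCons C.closed split: nat.split)

lemma sigma_H_Theta: "(sigma_H \<eta> ^^ j) (Theta \<eta>) = 1 / (theta - conj_eta j)"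
proof (induction j)
  case (Suc j)
  have "1 / (theta - conj_eta j) \<in> H" by (intro H.divide H.one theta_minus_in_H)
  then show ?case using Suc by (simp add: sigma_H_eq sig_Theta)
qed (simp add: Theta_def)

end

section \<open>The Kummer extension\<close>

lemma W_num_mult:
  assumes "q \<ge> 2"
  shows "W_num q N * (q - 1) = q ^ N - 1"
proof -
  have "(q - 1) dvd q ^ N - 1"
    using diff_power_eq_sum[of "int q" "N - 1" 1] assms
    by (cases N) (auto simp: of_nat_diff int_dvd_int_iff[symmetric])
  then show ?thesis by (simp add: W_num_def)
qed

text \<open>W divides q^N - 1, which is prime to q. Coprimality serves twice: for the degree of u
  over H and for Euler's theorem modulo a multiple of W.\<close>

lemma coprime_W_num:
  assumes "q \<ge> 2" "N \<ge> 1"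
  shows "coprime (W_num q N) q" "W_num q N > 0"
proof -
  have *: "W_num q N * (q - 1) = q ^ N - 1" by (rule W_num_mult[OF assms(1)])
  have "q ^ N \<ge> 2" using assms self_le_power[of q N] by linarith
  then have "q ^ N - 1 \<noteq> 0" by simp
  then show "W_num q N > 0" using * by (metis gr0I mult_0)
  have "coprime (q ^ N - 1) q"
  proof (rule coprimeI)
    fix d assume d: "d dvd q ^ N - 1" "d dvd q"
    then have "d dvd q ^ N" using assms(2) by (meson dvd_power dvd_trans less_le_trans zero_less_one)
    then have "d dvd q ^ N - (q ^ N - 1)" using d(1) by (rule dvd_diff_nat)
    then show "is_unit d" using \<open>q ^ N \<ge> 2\<close> by simp
  qed
  then show "coprime (W_num q N) q" unfolding *[symmetric] by simp
qed

lemma coeff_gamma_exp: "N \<ge> 1 \<Longrightarrow> coeff (gamma_exp q N) k = (if k < N then q ^ (N - 1 - k) else 0)"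
proof -
  assume N: "N \<ge> 1"
  have "coeff (gamma_exp q N) k = (\<Sum>i\<in>{0..N-1}. if N - 1 - i = k then q ^ i else 0)"
    by (auto simp: gamma_exp_def coeff_sum intro!: sum.cong)
  also have "\<dots> = (\<Sum>i\<in>{0..N-1}. if i = N - 1 - k \<and> k < N then q ^ i else 0)"
    using N by (intro sum.cong) auto
  also have "\<dots> = (if k < N then q ^ (N - 1 - k) else 0)" by (auto simp: diff_le_mono2)
  finally show ?thesis .
qed

lemma degree_gamma_exp: "N \<ge> 1 \<Longrightarrow> degree (gamma_exp q N) = N - 1"
  by (intro antisym degree_le le_degree) (auto simp: coeff_gamma_exp)

lemma order_power:
  fixes p :: "'a::field poly"
  assumes "p \<noteq> 0"
  shows "order a (p ^ n) = n * order a p"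
proof (induction n)
  case (Suc n)
  have "p * p ^ n \<noteq> 0" using assms by simp
  then have "order a (p ^ Suc n) = order a p + order a (p ^ n)" unfolding power_Suc by (rule order_mult)
  then show ?case using Suc by simp
qed (simp add: order_0I)

context constant_extension
begin

lemma card_ge_2: "CARD('f) \<ge> 2" by (rule card_field_ge_2)

lemma twisted_power_eq:
  "twisted_power (sigma_H \<eta>) (Theta \<eta>) (gamma_exp CARD('f) N) =
     (\<Prod>j<N. (1 / (theta - conj_eta j)) ^ CARD('f) ^ (N - 1 - j))"
proof -
  have "{..N - 1} = {..<N}" using N_ge_2 by auto
  then show ?thesis using N_ge_2
    by (simp add: twisted_power_def degree_gamma_exp coeff_gamma_exp sigma_H_Theta)
qed

end

locale kummer_extension = constant_extension \<rho> N \<eta> for \<rho> :: "'f::{finite,field} poly" and N \<eta> +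
  fixes u :: "'f poly fract alg_closure" and W :: nat
  assumes W_def: "W = W_num CARD('f) N"
    and u_power: "u ^ W = (-1) ^ W * (\<Prod>j<N. (1 / (theta - conj_eta j)) ^ CARD('f) ^ (N - 1 - j))"
begin

lemma W_mult: "W * (CARD('f) - 1) = CARD('f) ^ N - 1" unfolding W_def by (rule W_num_mult[OF card_ge_2])
lemma coprime_W: "coprime W CARD('f)" and W_pos: "W > 0"
  unfolding W_def using coprime_W_num[OF card_ge_2, of N] N_ge_2 by auto

text \<open>The Kummer radicand, named separately from u so that automorphisms of H can be applied
  to it.\<close>

definition rad :: "'f poly fract alg_closure" where
  "rad = (-1) ^ W * (\<Prod>j<N. (1 / (theta - conj_eta j)) ^ CARD('f) ^ (N - 1 - j))"

lemma u_power_rad: "u ^ W = rad" using u_power by (simp add: rad_def)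

lemma rad_in_H: "rad \<in> H"
  unfolding rad_def by (intro H.mult H.prod H.power H.uminus H.one H.divide theta_minus_in_H)

lemma rad_nonzero: "rad \<noteq> 0"
  using theta_minus_nonzero[OF conj_eta_in_consts] by (simp add: rad_def)

lemma u_nonzero: "u \<noteq> 0" using u_power_rad rad_nonzero W_pos by (metis power_eq_0_iff)

text \<open>With f_j = 1/(\<theta> - \<eta>_j), taking q-th powers and applying \<sigma> both shift
  the exponents by one step; because f_N = f_0, they differ only by f_0^(q^N - 1). The factor
  (\<theta> - \<eta>)^((q-1)W) removes precisely this.\<close>

lemma sig_rad: "((theta - \<eta>) ^ (CARD('f) - 1) * u ^ CARD('f)) ^ W = sig rad"
proof -
  define f where "f j = 1 / (theta - conj_eta j)" for j
  obtain M where M: "N = Suc M" using N_ge_2 by (cases N) auto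
  have fH: "f j \<in> H" for j unfolding f_def by (intro H.divide H.one theta_minus_in_H)
  have f0: "f 0 \<noteq> 0" "(theta - \<eta>) * f 0 = 1" using theta_minus_nonzero[OF eta_in_consts] by (auto simp: f_def)
  have fN: "f N = f 0" by (simp add: f_def conj_eta_N)
  \<comment> \<open>Valid in every characteristic; in characteristic 2 the two sides are both
    1.\<close>
  have m1: "(- 1) ^ CARD('f) = (- 1 :: 'f poly fract alg_closure)"
    using frob_uminus[of "1 :: 'f poly fract alg_closure" 1] by simp
  have "rad ^ CARD('f) = (-1) ^ W * (\<Prod>j<N. f j ^ CARD('f) ^ (N - j))"
  proof -
    have "rad ^ CARD('f) = ((-1) ^ CARD('f)) ^ W * (\<Prod>j<N. (f j ^ CARD('f) ^ (N - 1 - j)) ^ CARD('f))"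
      by (simp add: rad_def f_def power_mult_distrib prod_power_distrib power_commute_exp[of "-1" W])
    also have "(\<Prod>j<N. (f j ^ CARD('f) ^ (N - 1 - j)) ^ CARD('f)) = (\<Prod>j<N. f j ^ CARD('f) ^ (N - j))"
    proof (intro prod.cong refl)
      fix j assume "j \<in> {..<N}"
      then have "N - j = Suc (N - 1 - j)" by auto
      then show "(f j ^ CARD('f) ^ (N - 1 - j)) ^ CARD('f) = f j ^ CARD('f) ^ (N - j)"
        by (simp add: mult.commute flip: power_mult)
    qed
    finally show ?thesis by (simp only: m1)
  qed
  also have "(\<Prod>j<N. f j ^ CARD('f) ^ (N - j)) = f 0 ^ CARD('f) ^ N * (\<Prod>j<M. f (Suc j) ^ CARD('f) ^ (M - j))"
    unfolding M by (subst prod.lessThan_Suc_shift) simp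
  finally have 1: "rad ^ CARD('f) = (-1) ^ W * (f 0 ^ CARD('f) ^ N * (\<Prod>j<M. f (Suc j) ^ CARD('f) ^ (M - j)))" .
  have "sig rad = (-1) ^ W * (\<Prod>j<N. f (Suc j) ^ CARD('f) ^ (N - 1 - j))"
  proof -
    have "sig (-1) = -1" using H.hom_on_uminus[OF hom_sig H.one] H.hom_on_one[OF hom_sig] by simp
    moreover have "sig (f j) = f (Suc j)" for j unfolding f_def by (rule sig_Theta)
    ultimately show ?thesis unfolding rad_def f_def[symmetric]
      by (simp add: H.hom_on_mult[OF hom_sig] H.hom_on_prod[OF hom_sig] H.hom_on_power[OF hom_sig] fH H.closed)
  qed
  also have "\<dots> = (-1) ^ W * ((\<Prod>j<M. f (Suc j) ^ CARD('f) ^ (M - j)) * f 0)"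
    unfolding M using fN by (simp add: M)
  finally have 2: "sig rad = (-1) ^ W * ((\<Prod>j<M. f (Suc j) ^ CARD('f) ^ (M - j)) * f 0)" .
  have qN: "CARD('f) ^ N = Suc (CARD('f) ^ N - 1)" by simp
  have f0q: "f 0 ^ CARD('f) ^ N = f 0 * f 0 ^ (CARD('f) ^ N - 1)" by (metis qN power_Suc)
  have "((theta - \<eta>) ^ (CARD('f) - 1) * u ^ CARD('f)) ^ W = (theta - \<eta>) ^ (CARD('f) ^ N - 1) * rad ^ CARD('f)"
  proof -
    have "((theta - \<eta>) ^ (CARD('f) - 1)) ^ W = (theta - \<eta>) ^ (CARD('f) ^ N - 1)"
      unfolding W_mult[symmetric] by (simp only: power_mult[symmetric] mult.commute)
    moreover have "(u ^ CARD('f)) ^ W = rad ^ CARD('f)" by (metis power_commute_exp u_power_rad)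
    ultimately show ?thesis by (simp add: power_mult_distrib)
  qed
  also have "\<dots> = sig rad * ((theta - \<eta>) ^ (CARD('f) ^ N - 1) * f 0 ^ (CARD('f) ^ N - 1))"
    unfolding 1 2 f0q by (simp add: mult_ac)
  also have "(theta - \<eta>) ^ (CARD('f) ^ N - 1) * f 0 ^ (CARD('f) ^ N - 1) = 1"
    using f0 by (simp flip: power_mult_distrib)
  finally show ?thesis by simp
qed

text \<open>Comparing orders of vanishing at \<open>\<theta> = \<eta>\<close> shows that the minimal polynomial of \<open>u\<close> over \<open>H\<close> has degree \<open>W\<close>:
  up to a root of unity its constant term is \<open>u\<^sup>d\<close>, whose \<open>W\<close>-th power has a pole of order \<open>d q\<^sup>N\<^sup>-\<^sup>1\<close>.\<close>
lemma min_poly_u: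
  assumes "p \<in> H.polys" "degree p < W" "poly p u = 0"
  shows "p = 0"
proof (rule ccontr)
  assume "p \<noteq> 0"
  define Q where "Q d \<longleftrightarrow> (\<exists>p\<in>H.polys. p \<noteq> 0 \<and> degree p = d \<and> poly p u = 0)" for d
  define d where "d = (LEAST d. Q d)"
  have Qp: "Q (degree p)" using assms \<open>p \<noteq> 0\<close> by (auto simp: Q_def)
  have Qd: "Q d" unfolding d_def by (rule LeastI[of Q, OF Qp])
  have dW: "d < W" using Least_le[of Q, OF Qp] assms(2) by (simp add: d_def)
  obtain m0 where m0: "m0 \<in> H.polys" "m0 \<noteq> 0" "degree m0 = d" "poly m0 u = 0" using Qd by (auto simp: Q_def)
  define m where "m = smult (inverse (lead_coeff m0)) m0"
  have m: "m \<in> H.polys" "lead_coeff m = 1" "degree m = d" "poly m u = 0"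
    using m0 H.lead_coeff_in[OF m0(1)] by (auto simp: m_def intro!: H.polys_smult H.inverse)
  have min: "r = 0" if "r \<in> H.polys" "degree r < degree m" "poly r u = 0" for r
    using not_less_Least[of "degree r" Q] that m(3) by (auto simp: d_def Q_def)
  have d0: "d > 0"
  proof (rule ccontr)
    assume "\<not> d > 0"
    then obtain c where "m = [:c:]" using m(3) by (metis degree_eq_zeroE neq0_conv)
    then show False using m by auto
  qed
  have "monom 1 W - [:rad:] \<in> H.polys" by (intro H.polys_diff H.polys_monom H.polys_const H.one rad_in_H)
  moreover have "poly (monom 1 W - [:rad:]) u = 0" using u_power_rad by (simp add: poly_monom)
  ultimately obtain g where g: "monom 1 W - [:rad:] = m * g" using H.monic_dvd[OF m(1,2) min m(4)] by blast
  obtain A where A: "size A = degree m" "m = (\<Prod>x\<in>#A. [:- x, 1:])"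
    using alg_closed_imp_factorization[of m] m(2) by (metis leading_coeff_0_iff smult_1_left zero_neq_one)
  \<comment> \<open>As m divides X^W - rad, each of its d roots has W-th power rad. Up to sign their
    product is m(0), an element of H.\<close>
  have "x ^ W = rad" if "x \<in># A" for x
  proof -
    have "poly m x = 0" using that unfolding A(2) by (auto simp: poly_prod_mset)
    then have "poly (monom 1 W - [:rad:]) x = 0" unfolding g by simp
    then show ?thesis by (simp add: poly_monom)
  qed
  then have "(\<Prod>x\<in>#A. (- x) ^ W) = (\<Prod>x\<in>#A. (- 1) ^ W * rad)"
    by (intro arg_cong[of _ _ prod_mset] image_mset_cong) (metis mult_minus1 power_mult_distrib)
  moreover have "poly m 0 ^ W = (\<Prod>x\<in>#A. (- x) ^ W)"
  proof -
    have "poly m 0 = (\<Prod>x\<in>#A. - x)" unfolding A(2) by (simp add: poly_prod_mset image_mset.compositionality comp_def)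
    moreover have "(\<Prod>x\<in>#A. - x) ^ W = (\<Prod>x\<in>#A. (- x) ^ W)" for A :: "'f poly fract alg_closure multiset"
      by (induction A) (auto simp: power_mult_distrib simp del: mult_minus_left)
    ultimately show ?thesis by simp
  qed
  ultimately have c0W: "poly m 0 ^ W = ((- 1) ^ W * rad) ^ d" using A(1) m(3) by simp
  \<comment> \<open>D(\<theta>) is the denominator of the radicand; its factor vanishing at \<eta>
    has exponent q^(N-1), and E collects the others.\<close>
  define D where "D = (\<Prod>j<N. [:- conj_eta j, 1:] ^ CARD('f) ^ (N - 1 - j))"
  define E where "E = (\<Prod>j\<in>{1..<N}. [:- conj_eta j, 1:] ^ CARD('f) ^ (N - 1 - j))"
  have lin: "[:- conj_eta j, 1:] \<in> C.polys" for j
    using conj_eta_in_consts[of j] by (auto simp: C.polys_def coeff_pCons C.closed split: nat.split)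
  have DC: "D \<in> C.polys" unfolding D_def by (intro C.polys_prod C.polys_power lin)
  have Dth: "(- 1) ^ W * rad = 1 / poly D theta"
    using prod_inversef[of "\<lambda>j. (theta - conj_eta j) ^ CARD('f) ^ (N - 1 - j)" "{..<N}"]
    by (simp add: rad_def D_def poly_prod divide_inverse power_inverse comp_def
        power_mult_distrib[symmetric] mult.assoc[symmetric] flip: prod_dividef)
  have D0: "D \<noteq> 0" by (simp add: D_def)
  have "{..<N} = insert 0 {1..<N}" using N_ge_2 by auto
  then have DE: "D = [:- \<eta>, 1:] ^ CARD('f) ^ (N - 1) * E" by (simp add: D_def E_def)
  have "poly E \<eta> \<noteq> 0"
  proof -
    have "\<eta> \<noteq> conj_eta j" if "j \<in> {1..<N}" for j
      using that conj_eta_neq[of j] by (metis One_nat_def Suc_le_eq atLeastLessThan_iff)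
    then show ?thesis by (simp add: E_def poly_prod)
  qed
  then have "order \<eta> E = 0" by (rule order_0I)
  then have oD: "order \<eta> D = CARD('f) ^ (N - 1)"
    unfolding DE using D0 DE by (subst order_mult) (auto simp: order_power_n_n)
  have "poly m 0 \<in> H" using m(1) by (simp add: poly_0_coeff_0 H.polys_def)
  then obtain a b where ab: "a \<in> C.polys" "b \<in> C.polys" "b \<noteq> 0" "poly b theta \<noteq> 0" "poly m 0 = poly a theta / poly b theta"
    by (rule H_E)
  have Dn: "poly D theta \<noteq> 0" using C_transcendental[OF DC] D0 by simp
  have "(poly a theta / poly b theta) ^ W = (1 / poly D theta) ^ d" using c0W ab(5) Dth by simp
  then have "poly (a ^ W * D ^ d - b ^ W) theta = 0"
    using ab(4) Dn by (simp add: power_divide field_simps)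
  then have eq: "a ^ W * D ^ d = b ^ W"
    using ab DC by (subst (asm) C_transcendental) (auto intro!: C.polys_diff C.polys_mult C.polys_power)
  then have a0: "a \<noteq> 0" using ab(3) W_pos by (metis mult_eq_0_iff power_eq_0_iff)
  \<comment> \<open>Orders at \<eta> in a^W D^d = b^W: all terms except d q^(N-1) are multiples of
    W, and W is prime to q, so W divides d although 0 < d < W.\<close>
  have "W * order \<eta> a + d * CARD('f) ^ (N - 1) = W * order \<eta> b"
    using arg_cong[OF eq, of "order \<eta>"] a0 D0 ab(3) oD by (simp add: order_mult order_power)
  then have "W dvd d * CARD('f) ^ (N - 1)" by (metis dvd_add_right_iff dvd_triv_left)
  then have "W dvd d" using coprime_W by (metis coprime_dvd_mult_left_iff coprime_power_right_iff)
  then show False using d0 dW by (simp add: nat_dvd_not_less)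
qed

text \<open>The ring generated by u over H suffices: it is algebraic over K and therefore already a
  field.\<close>

definition L :: "'f poly fract alg_closure set" where "L = H.adjoin u"

sublocale L: subfield_set L
  unfolding L_def
  by (rule subfield_set_alg_closure[OF H.subring_adjoin])
    (use H.base_adjoin range_to_ac_subset_H in blast)

lemma H_subset_L: "H \<subseteq> L" unfolding L_def by (rule H.base_adjoin)
lemma u_in_L: "u \<in> L" unfolding L_def by (rule H.gen_adjoin)
lemma range_to_ac_subset_L: "range to_ac \<subseteq> L" using H_subset_L range_to_ac_subset_H by simp
lemma consts_subset_L: "constants \<subseteq> L" using consts_subset_H H_subset_L by simp
lemma eta_in_L: "\<eta> \<in> L" using eta_in_consts consts_subset_L by blast
lemma theta_in_L: "theta \<in> L" using theta_in_H H_subset_L by blast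

lemma L_least:
  assumes "subring_set R" "\<eta> \<in> R" "u \<in> R" "range to_ac \<subseteq> R"
  shows "L \<subseteq> R"
  unfolding L_def by (rule H.adjoin_subset) (use assms H_subset in auto)

lemma field_Hplus_eq: "field_Hplus \<eta> u = L"
  unfolding field_Hplus_def
proof (rule generate_field_eqI)
  show "{\<eta>, u} \<union> range to_ac \<subseteq> L" using eta_in_L u_in_L range_to_ac_subset_L by auto
  fix R assume "subfield_set R" "{\<eta>, u} \<union> range to_ac \<subseteq> R"
  then show "L \<subseteq> R" by (intro L_least) (auto simp: subfield_set_def)
qed (rule L.subfield_set_axioms)

section \<open>The Galois group of H^+ over K\<close>

abbreviation "Gal \<equiv> galois_group L (range to_ac)"

sublocale Gal: group Gal
  by (rule group_galois_group[OF L.subring_set_axioms range_to_ac_subset_L])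

lemmas GalD = galois_groupD[OF L.subring_set_axioms, of _ "range to_ac"]

lemma Gal_to_ac: "s \<in> carrier Gal \<Longrightarrow> s (to_ac x) = to_ac x" using GalD(4) by blast

lemma Gal_mult: "s \<in> carrier Gal \<Longrightarrow> t \<in> carrier Gal \<Longrightarrow> x \<in> L \<Longrightarrow> (s \<otimes>\<^bsub>Gal\<^esub> t) x = s (t x)"
  by (simp add: galois_group_mult compose_def)

lemma Gal_one: "x \<in> L \<Longrightarrow> \<one>\<^bsub>Gal\<^esub> x = x"
  by (simp add: galois_group_one)

text \<open>The elements on which two automorphisms agree form a subring containing K, \<eta> and u,
  hence everything.\<close>

lemma Gal_ext:
  assumes "s \<in> carrier Gal" "t \<in> carrier Gal" "s \<eta> = t \<eta>" "s u = t u"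
  shows "s = t"
proof -
  note hs = GalD(1)[OF assms(1)] and ht = GalD(1)[OF assms(2)]
  have "subring_set {x \<in> L. s x = t x}"
    by standard (auto simp: L.closed L.hom_on_one[OF hs] L.hom_on_one[OF ht] L.hom_on_diff[OF hs] L.hom_on_diff[OF ht]
        L.hom_on_mult[OF hs] L.hom_on_mult[OF ht])
  then have "L \<subseteq> {x \<in> L. s x = t x}"
    by (rule L_least) (use assms eta_in_L u_in_L range_to_ac_subset_L Gal_to_ac[OF assms(1)] Gal_to_ac[OF assms(2)] in auto)
  then show ?thesis using GalD(3)[OF assms(1)] GalD(3)[OF assms(2)] by (intro extensionalityI[of _ L]) auto
qed

text \<open>The elements on which s acts as the q^j-power map form a subring; it contains F_q and
  \<eta>.\<close>

lemma Gal_consts: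
  assumes s: "s \<in> carrier Gal" "s \<eta> = \<eta> ^ CARD('f) ^ j" and c: "c \<in> constants"
  shows "s c = c ^ CARD('f) ^ j"
proof -
  note h = GalD(1)[OF s(1)]
  have "subring_set {x \<in> L. s x = x ^ CARD('f) ^ j}"
    by standard (auto simp: L.closed L.hom_on_one[OF h] L.hom_on_diff[OF h] L.hom_on_mult[OF h] frob_diff power_mult_distrib)
  then have "constants \<subseteq> {x \<in> L. s x = x ^ CARD('f) ^ j}"
    by (rule consts_subset)
      (use s eta_in_L range_to_ac_subset_L Gal_to_ac[OF s(1)] frob_const_ac[where 'f='f, unfolded const_ac_def]
        in \<open>auto simp: const_ac_def\<close>)
  then show ?thesis using c by auto
qed

lemma Gal_theta: "s \<in> carrier Gal \<Longrightarrow> s theta = theta" by (simp add: theta_def Gal_to_ac)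

lemma Gal_eta_ex:
  assumes "s \<in> carrier Gal"
  shows "\<exists>j<N. s \<eta> = conj_eta j"
proof -
  note h = GalD(1)[OF assms]
  have c: "const_ac c \<in> L" "s (const_ac c) = const_ac c" for c
    using range_to_ac_subset_L Gal_to_ac[OF assms] by (auto simp: const_ac_def)
  have "s (poly (map_poly const_ac \<rho>) \<eta>) = poly (map_poly const_ac \<rho>) (s \<eta>)"
    using c eta_in_L
    by (simp add: poly_altdef coeff_map_poly L.hom_on_sum[OF h] L.hom_on_mult[OF h] L.hom_on_power[OF h] L.mult L.power)
  then have "poly (map_poly const_ac \<rho>) (s \<eta>) = 0" using root_rho L.hom_on_zero[OF h] by simp
  then show ?thesis using conj_eta_roots by blast
qed

text \<open>By \<open>min_poly_u\<close>, X^W - rad is the minimal polynomial of u over H, so any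
  W-th root of \<open>t rad\<close> in \<open>L\<close> is an admissible image of u.\<close>

lemma extend_aut:
  assumes t: "H.hom_on t" "\<And>z. z \<in> H \<Longrightarrow> t z \<in> H" "\<And>x. t (to_ac x) = to_ac x"
    and v: "v \<in> L" "v ^ W = t rad"
  obtains s where "s \<in> carrier Gal" "\<And>z. z \<in> H \<Longrightarrow> s z = t z" "s u = v"
proof -
  define m where "m = monom 1 W - [:rad:]"
  have mc: "coeff m i = (if i = W then 1 else if i = 0 then - rad else 0)" for i
    using W_pos by (auto simp: m_def coeff_pCons split: nat.split)
  have "degree m \<le> W" by (rule degree_le) (auto simp: mc)
  then have dm: "degree m = W" using le_degree[of m W] by (simp add: mc)
  have m: "m \<in> H.polys" unfolding m_def by (intro H.polys_diff H.polys_monom H.polys_const H.one rad_in_H)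
  have "map_poly t m = map_poly t (monom 1 W) - map_poly t [:rad:]"
    unfolding m_def by (intro H.map_poly_diff_on[OF t(1)] H.polys_monom H.polys_const H.one rad_in_H)
  then have mv: "poly (map_poly t m) v = 0"
    using v H.hom_on_zero[OF t(1)] H.hom_on_one[OF t(1)] by (simp add: map_poly_monom map_poly_pCons poly_monom)
  have "\<exists>g. subring_set.hom_on (H.adjoin u) g \<and> (\<forall>z\<in>H. g z = t z) \<and> g u = v"
  proof (rule H.extend_hom[OF t(1) m])
    show "lead_coeff m = 1" by (simp add: dm mc)
    show "poly m u = 0" using u_power_rad by (simp add: m_def poly_monom)
  qed (use min_poly_u dm mv in auto)
  then obtain g where g: "L.hom_on g" "\<And>z. z \<in> H \<Longrightarrow> g z = t z" "g u = v" by (auto simp: L_def)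
  have "g z \<in> L" if zL: "z \<in> L" for z
  proof -
    obtain p where p: "p \<in> H.polys" "z = poly p u" using zL by (auto simp: L_def H.adjoin_def)
    have pc: "coeff p i \<in> H" "coeff p i \<in> L" for i using p(1) H_subset_L by (auto simp: H.polys_def)
    have "g z = (\<Sum>i\<le>degree p. t (coeff p i) * v ^ i)"
      unfolding p(2) poly_altdef using pc u_in_L g
      by (simp add: L.hom_on_sum[OF g(1)] L.hom_on_mult[OF g(1)] L.hom_on_power[OF g(1)] L.mult L.power)
    also have "\<dots> \<in> L" using pc t(2) H_subset_L v(1) by (intro L.sum L.mult L.power) auto
    finally show ?thesis .
  qed
  then have "restrict g L \<in> carrier Gal"
    using g t(3) to_ac_in_H by (intro galois_group_memI L.subring_set_axioms range_to_ac_subset_L) auto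
  then show ?thesis
  proof (rule that)
    show "restrict g L z = t z" if "z \<in> H" for z using that g(2) H_subset_L by auto
    show "restrict g L u = v" using g(3) u_in_L by simp
  qed
qed

text \<open>\<open>sig_rad\<close> is the compatibility that \<open>extend_aut\<close> demands; the
  values at \<eta> and u then determine the automorphism, so the definite description is
  met.\<close>

lemma sigma_inf:
  "sigma_inf \<eta> u \<in> carrier Gal" "sigma_inf \<eta> u u = (theta - \<eta>) ^ (CARD('f) - 1) * u ^ CARD('f)"
  "sigma_inf \<eta> u \<eta> = \<eta> ^ CARD('f)"
proof -
  have v: "(theta - \<eta>) ^ (CARD('f) - 1) * u ^ CARD('f) \<in> L"
    using theta_in_L eta_in_L u_in_L by (intro L.closed)
  obtain s where s: "s \<in> carrier Gal" "\<And>z. z \<in> H \<Longrightarrow> s z = sig z" "s u = (theta - \<eta>) ^ (CARD('f) - 1) * u ^ CARD('f)"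
    using extend_aut[OF hom_sig sig_in_H sig_to_ac v sig_rad] by blast
  have se: "s \<eta> = \<eta> ^ CARD('f)" using s(2)[of \<eta>] consts_subset_H eta_in_consts sig_const by auto
  have "sigma_inf \<eta> u = s"
    unfolding sigma_inf_def field_Hplus_eq field_H_eq sigma_H_eq
  proof (rule the_equality)
    show "s \<in> carrier Gal \<and> s u = (theta - \<eta>) ^ (CARD('f) - 1) * u ^ CARD('f) \<and> restrict s H = restrict sig H"
      using s by (auto simp: restrict_def)
    fix s' assume s': "s' \<in> carrier Gal \<and> s' u = (theta - \<eta>) ^ (CARD('f) - 1) * u ^ CARD('f) \<and> restrict s' H = restrict sig H"
    then have "restrict s' H \<eta> = restrict sig H \<eta>" by simp
    then have "s' \<eta> = sig \<eta>" using consts_subset_H eta_in_consts by auto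
    then show "s' = s" using s' s se sig_const[OF eta_in_consts] by (intro Gal_ext) auto
  qed
  then show "sigma_inf \<eta> u \<in> carrier Gal" "sigma_inf \<eta> u u = (theta - \<eta>) ^ (CARD('f) - 1) * u ^ CARD('f)"
  "sigma_inf \<eta> u \<eta> = \<eta> ^ CARD('f)" using s se by auto
qed

text \<open>W divides q^N - 1, so \<mu> is fixed by the q^N-power map.\<close>

lemma root_of_unity_const: "\<mu> ^ W = 1 \<Longrightarrow> \<mu> \<in> constants"
proof -
  assume "\<mu> ^ W = 1"
  then have "\<mu> ^ (CARD('f) ^ N - 1) = 1" unfolding W_mult[symmetric] by (simp add: power_mult)
  moreover have "CARD('f) ^ N = Suc (CARD('f) ^ N - 1)" by simp
  ultimately have "\<mu> ^ CARD('f) ^ N = \<mu>" by (metis mult.right_neutral power_Suc)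
  then show ?thesis by (simp add: constants_def)
qed

lemma M_aut:
  assumes "\<mu> ^ W = 1"
  shows "M_aut \<eta> u \<mu> \<in> carrier Gal" "M_aut \<eta> u \<mu> u = \<mu> * u" "M_aut \<eta> u \<mu> \<eta> = \<eta>"
proof -
  have "\<mu> \<in> L" using root_of_unity_const[OF assms] consts_subset_L by blast
  then have v: "\<mu> * u \<in> L" "(\<mu> * u) ^ W = rad" using u_in_L assms u_power_rad by (auto intro: L.mult simp: power_mult_distrib)
  have "H.hom_on (\<lambda>x. x)" by (simp add: H.hom_on_def)
  then obtain s where s: "s \<in> carrier Gal" "\<And>z. z \<in> H \<Longrightarrow> s z = z" "s u = \<mu> * u"
    using extend_aut[of "\<lambda>x. x", OF _ _ _ v] by blast
  have eH: "\<eta> \<in> H" using consts_subset_H eta_in_consts by auto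
  have "M_aut \<eta> u \<mu> = s"
    unfolding M_aut_def field_Hplus_eq field_H_eq
  proof (rule the_equality)
    show "s \<in> carrier Gal \<and> s u = \<mu> * u \<and> restrict s H = (\<lambda>x\<in>H. x)"
      using s by (auto simp: restrict_def)
    fix s' assume s': "s' \<in> carrier Gal \<and> s' u = \<mu> * u \<and> restrict s' H = (\<lambda>x\<in>H. x)"
    then have "restrict s' H \<eta> = (\<lambda>x\<in>H. x) \<eta>" by simp
    then have "s' \<eta> = \<eta>" using eH by auto
    then show "s' = s" using s' s eH by (intro Gal_ext) auto
  qed
  then show "M_aut \<eta> u \<mu> \<in> carrier Gal" "M_aut \<eta> u \<mu> u = \<mu> * u" "M_aut \<eta> u \<mu> \<eta> = \<eta>" using s eH by auto
qed

lemma Gal_H_fixed: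
  assumes m: "m \<in> carrier Gal" "m \<eta> = \<eta>" and z: "z \<in> H"
  shows "m z = z"
proof -
  note h = GalD(1)[OF m(1)]
  have "subring_set {x \<in> L. m x = x}"
    by standard (auto simp: L.closed L.hom_on_one[OF h] L.hom_on_diff[OF h] L.hom_on_mult[OF h])
  then have "H \<subseteq> {x \<in> L. m x = x}"
    by (rule H_subset) (use m eta_in_L range_to_ac_subset_L Gal_to_ac[OF m(1)] in auto)
  then show ?thesis using z by auto
qed

text \<open>An automorphism fixing \<eta> fixes H and with it the radicand; it moves u to another
  W-th root of the same element.\<close>

lemma Gal_fix_eta:
  assumes "m \<in> carrier Gal" "m \<eta> = \<eta>"
  obtains \<mu> where "\<mu> ^ W = 1" "\<mu> \<in> constants" "m u = \<mu> * u"
proof -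
  note h = GalD(1)[OF assms(1)]
  have "m u ^ W = m rad" using L.hom_on_power[OF h u_in_L, of W] u_power_rad by simp
  then have "(m u / u) ^ W = 1" using Gal_H_fixed[OF assms rad_in_H] rad_nonzero u_power_rad by (simp add: power_divide)
  moreover have "m u = (m u / u) * u" using u_nonzero by simp
  ultimately show ?thesis using that root_of_unity_const by blast
qed

abbreviation "\<sigma> \<equiv> sigma_inf \<eta> u"

lemma sigma_const: "c \<in> constants \<Longrightarrow> \<sigma> c = c ^ CARD('f)"
  using Gal_consts[OF sigma_inf(1), of 1] sigma_inf(3) by simp

lemma sigma_pow_const: "c \<in> constants \<Longrightarrow> (\<sigma> [^]\<^bsub>Gal\<^esub> (k::nat)) c = c ^ CARD('f) ^ k"
proof (induction k arbitrary: c)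
  case 0 then show ?case using consts_subset_L by (auto simp: Gal_one)
next
  case (Suc k)
  have "(\<sigma> [^]\<^bsub>Gal\<^esub> Suc k) c = (\<sigma> [^]\<^bsub>Gal\<^esub> k) (\<sigma> c)"
    using Suc consts_subset_L sigma_inf(1) by (auto simp: Gal_mult)
  then show ?case using Suc C.power[of c "CARD('f)"] by (simp add: sigma_const flip: power_mult)
qed

text \<open>Both orders give \<mu>^q on u: \<sigma> raises the constant \<mu> to the q-th power,
  while m sees u^q inside \<sigma>(u).\<close>

lemma commute_sigma:
  assumes m: "m \<in> carrier Gal" "m \<eta> = \<eta>"
  shows "\<sigma> \<otimes>\<^bsub>Gal\<^esub> m = m \<otimes>\<^bsub>Gal\<^esub> \<sigma>"
proof -
  obtain \<mu> where mu: "\<mu> \<in> constants" "m u = \<mu> * u" by (rule Gal_fix_eta[OF m])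
  note h = GalD(1)[OF m(1)] and hs = GalD(1)[OF sigma_inf(1)]
  have mL: "\<mu> \<in> L" using mu consts_subset_L by auto
  have "theta - \<eta> \<in> H" using theta_minus_in_H[of 0] by simp
  then have *: "m ((theta - \<eta>) ^ (CARD('f) - 1)) = (theta - \<eta>) ^ (CARD('f) - 1)" "(theta - \<eta>) ^ (CARD('f) - 1) \<in> L"
    using Gal_H_fixed[OF m H.power] H.power H_subset_L by auto
  show ?thesis
  proof (rule Gal_ext)
    show "(\<sigma> \<otimes>\<^bsub>Gal\<^esub> m) \<eta> = (m \<otimes>\<^bsub>Gal\<^esub> \<sigma>) \<eta>"
      using m sigma_inf eta_in_L by (simp add: Gal_mult L.hom_on_power[OF h])
    show "(\<sigma> \<otimes>\<^bsub>Gal\<^esub> m) u = (m \<otimes>\<^bsub>Gal\<^esub> \<sigma>) u"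
      using m sigma_inf u_in_L mu mL *
      by (simp add: Gal_mult L.hom_on_power[OF h] L.hom_on_mult[OF hs] L.hom_on_mult[OF h] sigma_const L.power power_mult_distrib)
  qed (use m sigma_inf in auto)
qed

lemma commute_fix_eta:
  assumes m: "m \<in> carrier Gal" "m \<eta> = \<eta>" and n: "n \<in> carrier Gal" "n \<eta> = \<eta>"
  shows "n \<otimes>\<^bsub>Gal\<^esub> m = m \<otimes>\<^bsub>Gal\<^esub> n"
proof -
  obtain \<mu> where mu: "\<mu> \<in> constants" "m u = \<mu> * u" by (rule Gal_fix_eta[OF m])
  obtain \<nu> where nu: "\<nu> \<in> constants" "n u = \<nu> * u" by (rule Gal_fix_eta[OF n])
  have L: "\<mu> \<in> L" "\<nu> \<in> L" "\<mu> \<in> H" "\<nu> \<in> H" using mu nu consts_subset_L consts_subset_H by auto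
  note h = GalD(1)[OF m(1)] and hn = GalD(1)[OF n(1)]
  show ?thesis
  proof (rule Gal_ext)
    show "(n \<otimes>\<^bsub>Gal\<^esub> m) \<eta> = (m \<otimes>\<^bsub>Gal\<^esub> n) \<eta>" using m n eta_in_L by (simp add: Gal_mult)
    show "(n \<otimes>\<^bsub>Gal\<^esub> m) u = (m \<otimes>\<^bsub>Gal\<^esub> n) u"
      using m n u_in_L mu nu L Gal_H_fixed[OF m L(4)] Gal_H_fixed[OF n L(3)]
      by (simp add: Gal_mult L.hom_on_mult[OF h] L.hom_on_mult[OF hn])
  qed (use m n in auto)
qed

text \<open>Each automorphism sends \<eta> to some conjugate, as does a power of \<sigma>; dividing
  by that power leaves one fixing \<eta>.\<close>

lemma Gal_decompose:
  assumes s: "s \<in> carrier Gal"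
  obtains j m where "m \<in> carrier Gal" "m \<eta> = \<eta>" "s = \<sigma> [^]\<^bsub>Gal\<^esub> (j::nat) \<otimes>\<^bsub>Gal\<^esub> m"
proof -
  obtain j where j: "s \<eta> = conj_eta j" using Gal_eta_ex[OF s] by auto
  let ?t = "\<sigma> [^]\<^bsub>Gal\<^esub> j"
  have t: "?t \<in> carrier Gal" using sigma_inf by simp
  define m where "m = inv\<^bsub>Gal\<^esub> ?t \<otimes>\<^bsub>Gal\<^esub> s"
  have m: "m \<in> carrier Gal" using s t by (simp add: m_def)
  have "?t \<eta> = conj_eta j" using sigma_pow_const[OF eta_in_consts] .
  then have "(inv\<^bsub>Gal\<^esub> ?t \<otimes>\<^bsub>Gal\<^esub> ?t) \<eta> = m \<eta>"
    unfolding m_def Gal_mult[OF Gal.inv_closed[OF t] t eta_in_L] Gal_mult[OF Gal.inv_closed[OF t] s eta_in_L] j by simp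
  then have "m \<eta> = \<eta>" using t eta_in_L by (simp add: Gal_one)
  moreover have "s = ?t \<otimes>\<^bsub>Gal\<^esub> m" using s t by (simp add: m_def Gal.m_assoc[symmetric])
  ultimately show ?thesis using that m by blast
qed

text \<open>The finite product in \<open>artin_symbol\<close> calls for an abelian group. Through
  \<open>Gal_decompose\<close> commutation is reduced to powers of \<sigma> and automorphisms fixing
  \<eta>.\<close>

sublocale Gal: comm_group Gal
proof (rule Gal.group_comm_groupI)
  fix s t assume s: "s \<in> carrier Gal" and t: "t \<in> carrier Gal"
  obtain j m where m: "m \<in> carrier Gal" "m \<eta> = \<eta>" "s = \<sigma> [^]\<^bsub>Gal\<^esub> (j::nat) \<otimes>\<^bsub>Gal\<^esub> m" by (rule Gal_decompose[OF s])
  obtain k n where n: "n \<in> carrier Gal" "n \<eta> = \<eta>" "t = \<sigma> [^]\<^bsub>Gal\<^esub> (k::nat) \<otimes>\<^bsub>Gal\<^esub> n" by (rule Gal_decompose[OF t])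
  have sg: "\<sigma> [^]\<^bsub>Gal\<^esub> i \<in> carrier Gal" for i :: nat using sigma_inf by simp
  have c: "\<sigma> [^]\<^bsub>Gal\<^esub> i \<otimes>\<^bsub>Gal\<^esub> l = l \<otimes>\<^bsub>Gal\<^esub> \<sigma> [^]\<^bsub>Gal\<^esub> i" if "l \<in> carrier Gal" "l \<eta> = \<eta>" for i :: nat and l
    by (rule Gal.group_commutes_pow[OF commute_sigma[OF that] sigma_inf(1) that(1)])
  have cs: "\<sigma> [^]\<^bsub>Gal\<^esub> j \<otimes>\<^bsub>Gal\<^esub> \<sigma> [^]\<^bsub>Gal\<^esub> k = \<sigma> [^]\<^bsub>Gal\<^esub> k \<otimes>\<^bsub>Gal\<^esub> \<sigma> [^]\<^bsub>Gal\<^esub> j"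
    using sigma_inf by (simp add: Gal.nat_pow_mult add.commute)
  have "s \<otimes>\<^bsub>Gal\<^esub> t = \<sigma> [^]\<^bsub>Gal\<^esub> j \<otimes>\<^bsub>Gal\<^esub> (m \<otimes>\<^bsub>Gal\<^esub> \<sigma> [^]\<^bsub>Gal\<^esub> k) \<otimes>\<^bsub>Gal\<^esub> n"
    using m n sg by (simp add: Gal.m_assoc)
  also have "\<dots> = \<sigma> [^]\<^bsub>Gal\<^esub> j \<otimes>\<^bsub>Gal\<^esub> \<sigma> [^]\<^bsub>Gal\<^esub> k \<otimes>\<^bsub>Gal\<^esub> (m \<otimes>\<^bsub>Gal\<^esub> n)"
    unfolding c[OF m(1,2), symmetric] using m n sg by (simp add: Gal.m_assoc)
  also have "\<dots> = \<sigma> [^]\<^bsub>Gal\<^esub> k \<otimes>\<^bsub>Gal\<^esub> (\<sigma> [^]\<^bsub>Gal\<^esub> j \<otimes>\<^bsub>Gal\<^esub> n) \<otimes>\<^bsub>Gal\<^esub> m"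
    unfolding cs commute_fix_eta[OF n(1,2) m(1,2)] using m n sg by (simp add: Gal.m_assoc)
  also have "\<dots> = t \<otimes>\<^bsub>Gal\<^esub> s"
    unfolding c[OF n(1,2)] using m n sg by (simp add: Gal.m_assoc)
  finally show "s \<otimes>\<^bsub>Gal\<^esub> t = t \<otimes>\<^bsub>Gal\<^esub> s" .
qed

text \<open>Applying \<sigma>^k to \<sigma>(u) turns \<theta> - \<eta> into \<theta> - \<eta>_k and
  raises \<sigma>^k(u) to the q-th power, so the factor of index i has been raised k - 1 - i
  times.\<close>

lemma sigma_pow_u:
  "(\<sigma> [^]\<^bsub>Gal\<^esub> (k::nat)) u = (\<Prod>i<k. (theta - conj_eta i) ^ ((CARD('f) - 1) * CARD('f) ^ (k - 1 - i))) * u ^ CARD('f) ^ k"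
proof (induction k)
  case 0 then show ?case using u_in_L by (simp add: Gal_one)
next
  case (Suc k)
  let ?t = "\<sigma> [^]\<^bsub>Gal\<^esub> k"
  have t: "?t \<in> carrier Gal" using sigma_inf by simp
  note h = GalD(1)[OF t]
  have th: "theta - \<eta> \<in> L" "(theta - \<eta>) ^ (CARD('f) - 1) \<in> L" "u ^ CARD('f) \<in> L"
    using theta_in_L eta_in_L u_in_L by (auto intro: L.closed)
  have "?t (theta - \<eta>) = theta - conj_eta k"
    using L.hom_on_diff[OF h theta_in_L eta_in_L] Gal_theta[OF t] sigma_pow_const[OF eta_in_consts] by simp
  then have "(\<sigma> [^]\<^bsub>Gal\<^esub> Suc k) u = (theta - conj_eta k) ^ (CARD('f) - 1) * (?t u) ^ CARD('f)"
    using sigma_inf t u_in_L th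
    by (simp add: Gal_mult L.hom_on_mult[OF h] L.hom_on_power[OF h])
  also have "(?t u) ^ CARD('f) = (\<Prod>i<k. (theta - conj_eta i) ^ ((CARD('f) - 1) * CARD('f) ^ (k - i))) * u ^ CARD('f) ^ Suc k"
  proof -
    have "((theta - conj_eta i) ^ ((CARD('f) - 1) * CARD('f) ^ (k - 1 - i))) ^ CARD('f)
        = (theta - conj_eta i) ^ ((CARD('f) - 1) * CARD('f) ^ (k - i))" if "i < k" for i
    proof -
      have "k - i = Suc (k - 1 - i)" using that by auto
      then show ?thesis by (simp add: mult_ac flip: power_mult)
    qed
    then show ?thesis unfolding Suc
      by (simp add: power_mult_distrib prod_power_distrib mult.commute[of "CARD('f) ^ k"] flip: power_mult)
  qed
  finally show ?case by (simp add: mult_ac)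
qed

text \<open>As q^N = 1 + W(q-1), u^(q^N) is u times rad^(q-1), whose denominator is the product in
  \<open>sigma_pow_u\<close>. The sign is 1 because -1 is a nonzero constant.\<close>

lemma sigma_pow_N: "\<sigma> [^]\<^bsub>Gal\<^esub> N = \<one>\<^bsub>Gal\<^esub>"
proof (rule Gal_ext)
  show "(\<sigma> [^]\<^bsub>Gal\<^esub> N) \<eta> = \<one>\<^bsub>Gal\<^esub> \<eta>"
    using sigma_pow_const[OF eta_in_consts] conj_eta_N eta_in_L by (simp add: Gal_one)
  have "u ^ CARD('f) ^ N = u ^ Suc (W * (CARD('f) - 1))" unfolding W_mult by simp
  also have "\<dots> = rad ^ (CARD('f) - 1) * u" by (simp add: power_mult u_power_rad)
  also have "rad ^ (CARD('f) - 1) =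
      ((-1) ^ (CARD('f) ^ N - 1)) * (\<Prod>j<N. (1 / (theta - conj_eta j)) ^ ((CARD('f) - 1) * CARD('f) ^ (N - 1 - j)))"
    by (simp only: rad_def power_mult_distrib prod_power_distrib power_mult[symmetric] W_mult mult.commute[of "CARD('f) - 1"])
  also have "(-1) ^ (CARD('f) ^ N - 1) = (1 :: 'f poly fract alg_closure)"
    using consts_power[of "-1"] C.uminus[OF C.one] by simp
  finally have "(\<sigma> [^]\<^bsub>Gal\<^esub> N) u = (\<Prod>i<N. (theta - conj_eta i) ^ ((CARD('f) - 1) * CARD('f) ^ (N - 1 - i)) *
      (1 / (theta - conj_eta i)) ^ ((CARD('f) - 1) * CARD('f) ^ (N - 1 - i))) * u"
    by (simp add: sigma_pow_u prod.distrib)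
  also have "\<dots> = (\<Prod>i<N. 1) * u"
    using theta_minus_nonzero[OF conj_eta_in_consts]
    by (intro arg_cong2[of _ _ _ _ "(*)"] prod.cong) (auto simp flip: power_mult_distrib)
  finally show "(\<sigma> [^]\<^bsub>Gal\<^esub> N) u = \<one>\<^bsub>Gal\<^esub> u" using u_in_L by (simp add: Gal_one)
qed (use sigma_inf in auto)

lemma eta_star_eq: "eta_star \<eta> N = inverse (conj_eta (N - 1)) ^ (CARD('f) - 1)"
proof -
  have "1 - int CARD('f) = - int (CARD('f) - 1)" using card_ge_2 by simp
  then show ?thesis unfolding eta_star_def by (simp only: power_int_minus power_int_of_nat power_inverse)
qed

lemma eta_star_pow_W: "eta_star \<eta> N ^ W = 1"
proof -
  have "eta_star \<eta> N ^ W = inverse (conj_eta (N - 1)) ^ (CARD('f) ^ N - 1)"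
    unfolding eta_star_eq W_mult[symmetric] by (simp add: mult.commute flip: power_mult)
  also have "\<dots> = 1"
    by (rule consts_power) (use eta_nonzero conj_eta_in_consts in \<open>auto intro: C.inverse\<close>)
  finally show ?thesis .
qed

abbreviation "\<sigma>\<^sub>0 \<equiv> sigma_zero \<eta> u N"

text \<open>\<open>eta_star\<close> involves the conjugate of index N - 1 because \<sigma> raises it
  to the q-th power and conj_eta N = \<eta>; the resulting factor on u is \<eta>^(1-q).\<close>

lemma sigma_zero:
  "\<sigma>\<^sub>0 \<in> carrier Gal" "\<sigma>\<^sub>0 \<eta> = \<eta> ^ CARD('f)"
  "\<sigma>\<^sub>0 u = inverse \<eta> ^ (CARD('f) - 1) * (theta - \<eta>) ^ (CARD('f) - 1) * u ^ CARD('f)"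
  "\<sigma>\<^sub>0 = \<sigma> \<otimes>\<^bsub>Gal\<^esub> M_aut \<eta> u (eta_star \<eta> N)"
proof -
  note M = M_aut[OF eta_star_pow_W]
  show 0: "\<sigma>\<^sub>0 = \<sigma> \<otimes>\<^bsub>Gal\<^esub> M_aut \<eta> u (eta_star \<eta> N)"
    by (simp add: sigma_zero_def field_Hplus_eq)
  show "\<sigma>\<^sub>0 \<in> carrier Gal" using M sigma_inf by (simp add: 0)
  show "\<sigma>\<^sub>0 \<eta> = \<eta> ^ CARD('f)" using M sigma_inf eta_in_L by (simp add: 0 Gal_mult)
  have c: "eta_star \<eta> N \<in> constants" by (rule root_of_unity_const[OF eta_star_pow_W])
  have "conj_eta (N - 1) ^ CARD('f) = conj_eta N"
    using N_ge_2 by (cases N) (auto simp: mult.commute simp flip: power_mult)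
  then have "eta_star \<eta> N ^ CARD('f) = inverse \<eta> ^ (CARD('f) - 1)"
    unfolding eta_star_eq power_commute_exp[of _ "CARD('f) - 1"] by (simp add: power_inverse conj_eta_N)
  then show "\<sigma>\<^sub>0 u = inverse \<eta> ^ (CARD('f) - 1) * (theta - \<eta>) ^ (CARD('f) - 1) * u ^ CARD('f)"
    using M sigma_inf u_in_L c consts_subset_L L.hom_on_mult[OF GalD(1)[OF sigma_inf(1)], of "eta_star \<eta> N" u]
    by (simp add: 0 Gal_mult sigma_const subset_iff mult_ac)
qed

lemma M_aut_power:
  "M_aut \<eta> u (eta_star \<eta> N) [^]\<^bsub>Gal\<^esub> i = M_aut \<eta> u (eta_star \<eta> N ^ i)"
proof (rule Gal_ext)
  note M = M_aut[OF eta_star_pow_W]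
  have Wi: "(eta_star \<eta> N ^ i) ^ W = 1" using eta_star_pow_W by (simp add: power_commute_exp[of _ i])
  have c: "eta_star \<eta> N \<in> H" using root_of_unity_const[OF eta_star_pow_W] consts_subset_H by auto
  have *: "(M_aut \<eta> u (eta_star \<eta> N) [^]\<^bsub>Gal\<^esub> i) \<eta> = \<eta> \<and> (M_aut \<eta> u (eta_star \<eta> N) [^]\<^bsub>Gal\<^esub> i) u = eta_star \<eta> N ^ i * u"
  proof (induction i)
    case 0 then show ?case using eta_in_L u_in_L by (simp add: Gal_one)
  next
    case (Suc i)
    let ?t = "M_aut \<eta> u (eta_star \<eta> N) [^]\<^bsub>Gal\<^esub> i"
    have t: "?t \<in> carrier Gal" using M by simp
    then have "?t (eta_star \<eta> N * u) = eta_star \<eta> N * ?t u"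
      using L.hom_on_mult[OF GalD(1)[OF t], of "eta_star \<eta> N" u] c u_in_L H_subset_L Gal_H_fixed[OF t _ c] Suc by auto
    then show ?case using Suc M t eta_in_L u_in_L by (simp add: Gal_mult mult_ac)
  qed
  show "(M_aut \<eta> u (eta_star \<eta> N) [^]\<^bsub>Gal\<^esub> i) \<eta> = M_aut \<eta> u (eta_star \<eta> N ^ i) \<eta>"
    "(M_aut \<eta> u (eta_star \<eta> N) [^]\<^bsub>Gal\<^esub> i) u = M_aut \<eta> u (eta_star \<eta> N ^ i) u"
    using * M_aut[OF Wi] by auto
qed (use M_aut[OF eta_star_pow_W] M_aut[of "eta_star \<eta> N ^ i"] eta_star_pow_W in \<open>auto simp: power_commute_exp[of _ i]\<close>)

lemma sigma_combination:
  assumes "i \<le> N"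
  shows "\<sigma> [^]\<^bsub>Gal\<^esub> (N - i) \<otimes>\<^bsub>Gal\<^esub> \<sigma>\<^sub>0 [^]\<^bsub>Gal\<^esub> i = M_aut \<eta> u (eta_star \<eta> N ^ i)"
proof -
  note M = M_aut[OF eta_star_pow_W]
  have "\<sigma>\<^sub>0 [^]\<^bsub>Gal\<^esub> i = \<sigma> [^]\<^bsub>Gal\<^esub> i \<otimes>\<^bsub>Gal\<^esub> M_aut \<eta> u (eta_star \<eta> N) [^]\<^bsub>Gal\<^esub> i"
    unfolding sigma_zero(4) using M sigma_inf by (simp add: Gal.nat_pow_distrib)
  then have "\<sigma> [^]\<^bsub>Gal\<^esub> (N - i) \<otimes>\<^bsub>Gal\<^esub> \<sigma>\<^sub>0 [^]\<^bsub>Gal\<^esub> i =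
      (\<sigma> [^]\<^bsub>Gal\<^esub> (N - i) \<otimes>\<^bsub>Gal\<^esub> \<sigma> [^]\<^bsub>Gal\<^esub> i) \<otimes>\<^bsub>Gal\<^esub> M_aut \<eta> u (eta_star \<eta> N) [^]\<^bsub>Gal\<^esub> i"
    using M sigma_inf by (simp add: Gal.m_assoc)
  also have "\<sigma> [^]\<^bsub>Gal\<^esub> (N - i) \<otimes>\<^bsub>Gal\<^esub> \<sigma> [^]\<^bsub>Gal\<^esub> i = \<one>\<^bsub>Gal\<^esub>"
    using assms sigma_inf sigma_pow_N by (simp add: Gal.nat_pow_mult)
  finally show ?thesis using M by (simp flip: M_aut_power)
qed

end

section \<open>Valuation rings of the rational function field\<close>

text \<open>The same facts are used for rings in F_q(t) and in H^+, so the ambient field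
  \<open>F\<close> is a parameter. That a place is proper enters through
  \<open>valuation_ringsD\<close>.\<close>

locale valuation_set = subring_set V for V :: "'a::field set" +
  fixes F :: "'a set"
  assumes subfield: "subfield_set F" and subset: "V \<subseteq> F"
    and val: "z \<in> F \<Longrightarrow> z \<in> V \<or> inverse z \<in> V"
begin

abbreviation "\<mm> \<equiv> place_ideal V"

lemma mm_subset: "x \<in> \<mm> \<Longrightarrow> x \<in> V" by (simp add: place_ideal_def)
lemma mm_zero: "0 \<in> \<mm>" by (simp add: place_ideal_def zero)
lemma mm_one: "1 \<notin> \<mm>" by (simp add: place_ideal_def one)
lemma mm_unit: "x \<in> V \<Longrightarrow> x \<notin> \<mm> \<Longrightarrow> inverse x \<in> V" by (auto simp: place_ideal_def)
lemma mm_not_unit: "x \<in> \<mm> \<Longrightarrow> x \<noteq> 0 \<Longrightarrow> inverse x \<notin> V" by (auto simp: place_ideal_def)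

lemma mm_mult:
  assumes "x \<in> \<mm>" "v \<in> V"
  shows "v * x \<in> \<mm>"
proof (cases "v * x = 0")
  case False
  have "inverse (v * x) \<notin> V"
  proof
    assume "inverse (v * x) \<in> V"
    then have "v * inverse (v * x) \<in> V" by (rule mult[OF assms(2)])
    moreover have "v * inverse (v * x) = inverse x" using False by simp
    ultimately show False using mm_not_unit[OF assms(1)] False by (metis mult_zero_right)
  qed
  then show ?thesis using mult[OF assms(2) mm_subset[OF assms(1)]] by (simp add: place_ideal_def)
qed (auto simp: mm_zero)

text \<open>One of x/y and y/x lies in V, so the sum is a multiple of x or of y by an element of
  V.\<close>

lemma mm_add:
  assumes "x \<in> \<mm>" "y \<in> \<mm>"
  shows "x + y \<in> \<mm>"
proof (cases "x = 0 \<or> y = 0")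
  case False
  have "x / y \<in> F" using assms mm_subset subset subfield_set.divide[OF subfield] by blast
  then have "x / y \<in> V \<or> y / x \<in> V" using val[of "x / y"] by simp
  then show ?thesis
  proof
    assume "x / y \<in> V"
    then have "(x / y + 1) * y \<in> \<mm>" using assms by (intro mm_mult add one)
    then show ?thesis using False by (simp add: distrib_right)
  next
    assume "y / x \<in> V"
    then have "(1 + y / x) * x \<in> \<mm>" using assms by (intro mm_mult add one)
    then show ?thesis using False by (simp add: distrib_right)
  qed
qed (use assms in auto)

lemma mm_uminus: "x \<in> \<mm> \<Longrightarrow> - x \<in> \<mm>" using mm_mult[of x "-1"] by (simp add: uminus one)
lemma mm_diff: "x \<in> \<mm> \<Longrightarrow> y \<in> \<mm> \<Longrightarrow> x - y \<in> \<mm>" using mm_add[of x "-y"] by (simp add: mm_uminus)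
lemma mm_sum: "(\<And>i. i \<in> I \<Longrightarrow> g i \<in> \<mm>) \<Longrightarrow> sum g I \<in> \<mm>"
  by (induction I rule: infinite_finite_induct) (auto intro: mm_zero mm_add)

lemma mm_prime: "x * y \<in> \<mm> \<Longrightarrow> x \<in> V \<Longrightarrow> y \<in> V \<Longrightarrow> x \<in> \<mm> \<or> y \<in> \<mm>"
proof (rule ccontr)
  assume *: "x * y \<in> \<mm>" "x \<in> V" "y \<in> V" "\<not> (x \<in> \<mm> \<or> y \<in> \<mm>)"
  then have "inverse (x * y) \<in> V" "x * y \<noteq> 0" using mm_unit mm_zero by (auto intro: mult)
  then show False using * mm_not_unit by blast
qed

lemma mm_power: "x ^ n \<in> \<mm> \<Longrightarrow> x \<in> V \<Longrightarrow> x \<in> \<mm>"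
  by (induction n) (use mm_one mm_prime power in \<open>auto\<close>)

lemma one_minus_unit: "x \<in> \<mm> \<Longrightarrow> inverse (1 - x) \<in> V"
proof (rule mm_unit)
  assume x: "x \<in> \<mm>"
  then show "1 - x \<in> V" by (intro diff one mm_subset)
  show "1 - x \<notin> \<mm>" using mm_add[OF x, of "1 - x"] mm_one by auto
qed

text \<open>Integral closedness for pure powers: if 1/r were in V, then r = r^n (1/r)^(n-1) would be
  as well.\<close>

lemma root_in:
  assumes "r \<in> F" "r ^ n \<in> V" "n > 0"
  shows "r \<in> V"
proof (rule ccontr)
  assume r: "r \<notin> V"
  then have i: "inverse r \<in> V" using val assms(1) by blast
  obtain m where m: "n = Suc m" using assms(3) by (cases n) auto
  have "r \<noteq> 0" using r zero by auto
  then have "r = r ^ n * inverse r ^ m" by (simp add: m power_inverse)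
  then show False using r mult[OF assms(2) power[OF i]] by metis
qed

end

lemma valuation_ringsD:
  assumes "V \<in> valuation_rings k F" "subfield_set F"
  shows "valuation_set V F" "k \<subseteq> V" "V \<noteq> F"
  using assms by (auto simp: valuation_rings_def subring_iff valuation_set_def valuation_set_axioms_def)

lemma subfield_set_UNIV: "subfield_set (UNIV :: 'a::field set)"
  by standard auto

text \<open>Bezout's identity is proved directly: the polynomial ring over a type of sort
  \<open>{finite, field}\<close> is not an instance of the library's gcd classes.\<close>
lemma bezout_poly:
  fixes p b :: "'f::field poly"
  assumes "irreducible p" "\<not> p dvd b"
  obtains x y where "x * p + y * b = 1"
proof -
  define S where "S = {x * p + y * b | x y. True}"
  have S_diff: "s - r * d \<in> S" if sd: "s \<in> S" "d \<in> S" for s r d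
  proof -
    obtain x y x' y' where "s = x * p + y * b" "d = x' * p + y' * b" using sd unfolding S_def by blast
    then have "s - r * d = (x - r * x') * p + (y - r * y') * b" by (simp add: algebra_simps)
    then show ?thesis unfolding S_def by blast
  qed
  have pb: "p \<in> S" "b \<in> S" unfolding S_def by (rule CollectI, rule exI[of _ 1], rule exI[of _ 0], simp)
    (rule CollectI, rule exI[of _ 0], rule exI[of _ 1], simp)
  define Q where "Q n \<longleftrightarrow> (\<exists>d\<in>S. d \<noteq> 0 \<and> degree d = n)" for n
  have "p \<noteq> 0" using assms(1) by auto
  then have Qp: "Q (degree p)" using pb by (auto simp: Q_def)
  obtain d where d: "d \<in> S" "d \<noteq> 0" "degree d = (LEAST n. Q n)" using LeastI[of Q, OF Qp] by (auto simp: Q_def)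
  have dvd: "d dvd s" if "s \<in> S" for s
  proof (rule ccontr)
    assume "\<not> d dvd s"
    then have "s mod d \<noteq> 0" by (simp add: mod_eq_0_iff_dvd)
    moreover have "s mod d \<in> S" using S_diff[OF that d(1), of "s div d"] by (simp add: minus_div_mult_eq_mod)
    moreover have "degree (s mod d) < degree d" using degree_mod_less[OF d(2), of s] calculation(1) by simp
    ultimately show False using not_less_Least[of "degree (s mod d)" Q] d(3) by (auto simp: Q_def)
  qed
  obtain e where e: "p = d * e" using dvd[OF pb(1)] by (auto elim: dvdE)
  have "is_unit d"
  proof (rule ccontr)
    assume "\<not> is_unit d"
    then have "is_unit e" using irreducibleD[OF assms(1) e] by simp
    then have "p dvd d" unfolding e by (simp add: dvd_mult_unit_iff mult_unit_dvd_iff)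
    then show False using dvd[OF pb(2)] assms(2) dvd_trans by blast
  qed
  then obtain c where c: "1 = d * c" by (auto elim: dvdE)
  obtain x y where "d = x * p + y * b" using d(1) unfolding S_def by blast
  then have "(c * x) * p + (c * y) * b = 1" using c by (simp add: algebra_simps)
  then show ?thesis by (rule that)
qed

lemma irreducible_dvd_mult:
  fixes p :: "'f::field poly"
  assumes "irreducible p" "p dvd a * b"
  shows "p dvd a \<or> p dvd b"
proof (rule ccontr)
  assume *: "\<not> ?thesis"
  then obtain x y where xy: "x * p + y * b = 1" using bezout_poly[OF assms(1), of b] by blast
  have "a = a * (x * p + y * b)" using xy by simp
  also have "\<dots> = (a * x) * p + y * (a * b)" by (simp add: algebra_simps)
  finally have "p dvd a" using assms(2) by (metis dvd_add dvd_mult dvd_triv_right)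
  then show False using * by simp
qed

lemma irreducible_factor:
  fixes b :: "'f::field poly"
  assumes "degree b > 0"
  obtains p where "irreducible p" "p dvd b"
proof -
  define Q where "Q n \<longleftrightarrow> (\<exists>d. d dvd b \<and> degree d = n \<and> n > 0)" for n
  have Qb: "Q (degree b)" unfolding Q_def using assms by (intro exI[of _ b]) simp
  obtain p where p: "p dvd b" "degree p = (LEAST n. Q n)" "degree p > 0" using LeastI[of Q, OF Qb] by (auto simp: Q_def)
  have "irreducible p"
  proof (rule irreducibleI)
    show "p \<noteq> 0" using p(3) by auto
    then show "\<not> is_unit p" using p(3) by (simp add: is_unit_iff_degree)
    fix c d assume cd: "p = c * d"
    show "is_unit c \<or> is_unit d"
    proof (rule ccontr)
      assume *: "\<not> ?thesis"
      have nz: "c \<noteq> 0" "d \<noteq> 0" using cd p(3) by auto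
      then have "degree c > 0" "degree d > 0" using * by (auto simp: is_unit_iff_degree)
      moreover have "degree p = degree c + degree d" using cd nz by (simp add: degree_mult_eq)
      moreover have "c dvd b" using p(1) cd by (metis dvd_mult_left)
      ultimately show False using not_less_Least[of "degree c" Q] p(2) by (auto simp: Q_def)
    qed
  qed
  then show ?thesis using that p(1) by blast
qed

text \<open>A denominator of least degree: a common irreducible factor could be cancelled and would
  lower it.\<close>

lemma fract_min_repr:
  fixes x :: "'f::field poly fract"
  obtains a b where "b \<noteq> 0" "x = to_fract a / to_fract b" "\<And>p. irreducible p \<Longrightarrow> p dvd a \<Longrightarrow> \<not> p dvd b"
proof -
  define Q where "Q n \<longleftrightarrow> (\<exists>a b. b \<noteq> 0 \<and> x = to_fract a / to_fract b \<and> degree b = n)" for n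
  obtain a0 b0 where "x = Fract a0 b0" "b0 \<noteq> 0" by (cases x)
  then have Qn: "Q (degree b0)" by (auto simp: Q_def Fract_conv_to_fract)
  obtain a b where ab: "b \<noteq> 0" "x = to_fract a / to_fract b" "degree b = (LEAST n. Q n)"
    using LeastI[of Q, OF Qn] by (auto simp: Q_def)
  have "\<not> p dvd b" if p: "irreducible p" "p dvd a" for p
  proof
    assume "p dvd b"
    then obtain a' b' where *: "a = p * a'" "b = p * b'" using p(2) by (auto elim!: dvdE)
    have nz: "p \<noteq> 0" "b' \<noteq> 0" using * ab(1) by auto
    have "degree p > 0" using p(1) nz by (auto simp: irreducible_def is_unit_iff_degree)
    then have "degree b' < degree b" using nz * by (simp add: degree_mult_eq)
    moreover have "x = to_fract a' / to_fract b'" using ab(2) nz by (simp add: *)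
    ultimately show False using not_less_Least[of "degree b'" Q] ab(3) nz by (auto simp: Q_def)
  qed
  then show ?thesis using that ab by blast
qed

lemma const_field_eq: "const_field = range (\<lambda>c. to_fract [:c:])" by (simp add: const_field_def)

abbreviation tF :: "'f::field poly fract" where "tF \<equiv> to_fract [:0, 1:]"

lemma to_fract_power: "to_fract (p ^ n) = to_fract p ^ n"
  by (induction n) auto

lemma to_fract_monom: "to_fract (monom c n) = to_fract [:c:] * tF ^ n"
proof -
  have "monom c n = [:c:] * [:0, 1:] ^ n" by (simp add: monom_altdef)
  then show ?thesis by (simp only: to_fract_mult to_fract_power)
qed

lemma to_fract_expand: "to_fract a = (\<Sum>i\<le>degree a. to_fract [:coeff a i:] * tF ^ i)"
proof -
  have "a = (\<Sum>i\<le>degree a. monom (coeff a i) i)" by (simp add: poly_as_sum_of_monoms)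
  then have "to_fract a = to_fract (\<Sum>i\<le>degree a. monom (coeff a i) i)" by simp
  then show ?thesis by (simp only: to_fract_sum to_fract_monom)
qed

lemma val_ring_at_iff: "x \<in> val_ring_at p \<longleftrightarrow> (\<exists>a b. x = to_fract a / to_fract b \<and> \<not> p dvd b)"
  by (auto simp: val_ring_at_def Fract_conv_to_fract)

lemma inverse_not_in_val_ring_at:
  assumes "irreducible p"
  shows "inverse (to_fract p) \<notin> val_ring_at p"
proof
  assume "inverse (to_fract p) \<in> val_ring_at p"
  then obtain a b where *: "inverse (to_fract p) = to_fract a / to_fract b" "\<not> p dvd b" by (auto simp: val_ring_at_iff)
  moreover have "p \<noteq> 0" "b \<noteq> 0" using assms * by auto
  ultimately have "to_fract b = to_fract (a * p)" by (simp add: field_simps)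
  then have "b = a * p" by (simp only: to_fract_eq_iff)
  then show False using * by simp
qed

lemma val_ring_at:
  fixes p :: "'f::field poly"
  assumes p: "irreducible p"
  shows "val_ring_at p \<in> valuation_rings const_field UNIV"
proof -
  have u: "\<not> p dvd 1" using p by (auto simp: irreducible_def)
  have int: "to_fract a \<in> val_ring_at p" for a
    unfolding val_ring_at_iff by (intro exI[of _ a] exI[of _ 1]) (use u in auto)
  have "subring_set (val_ring_at p)"
  proof
    show "1 \<in> val_ring_at p" using int[of 1] by simp
    fix x y assume "x \<in> val_ring_at p" "y \<in> val_ring_at p"
    then obtain a b c d where *: "x = to_fract a / to_fract b" "\<not> p dvd b" "y = to_fract c / to_fract d" "\<not> p dvd d"
      by (auto simp: val_ring_at_iff)
    then have bd: "\<not> p dvd b * d" "b \<noteq> 0" "d \<noteq> 0" using irreducible_dvd_mult[OF p] by auto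
    then have "x - y = to_fract (a * d - c * b) / to_fract (b * d)" by (simp add: * diff_frac_eq)
    then show "x - y \<in> val_ring_at p" using bd unfolding val_ring_at_iff by blast
    have "x * y = to_fract (a * c) / to_fract (b * d)" by (simp add: *)
    then show "x * y \<in> val_ring_at p" using bd unfolding val_ring_at_iff by blast
  qed
  moreover have "z \<in> val_ring_at p \<or> inverse z \<in> val_ring_at p" for z
  proof -
    obtain a b where ab: "b \<noteq> 0" "z = to_fract a / to_fract b" "\<And>p. irreducible p \<Longrightarrow> p dvd a \<Longrightarrow> \<not> p dvd b"
      using fract_min_repr[of z] by blast
    have "inverse z = to_fract b / to_fract a" using ab by simp
    then show ?thesis using ab(2) ab(3)[OF p] unfolding val_ring_at_iff by blast
  qed
  moreover have "const_field \<noteq> val_ring_at p"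
  proof
    assume "const_field = val_ring_at p"
    then have "tF \<in> (const_field :: 'f poly fract set)" using int[of "[:0, 1:]"] by simp
    then show False by (auto simp: const_field_eq)
  qed
  moreover have "const_field \<subseteq> val_ring_at p" using int by (auto simp: const_field_eq)
  moreover have "val_ring_at p \<noteq> UNIV" using inverse_not_in_val_ring_at[OF p] by auto
  ultimately show ?thesis by (auto simp: valuation_rings_def subring_iff)
qed

text \<open>The valuation ring of t = infinity. A zero numerator counts as degree 0, which the bound
  admits for every denominator.\<close>

definition val_ring_inf :: "'f::field poly fract set" where
  "val_ring_inf = {to_fract a / to_fract b | a b. b \<noteq> 0 \<and> degree a \<le> degree b}"

lemma val_ring_inf_iff: "b \<noteq> 0 \<Longrightarrow> to_fract a / to_fract b \<in> val_ring_inf \<longleftrightarrow> degree a \<le> degree b"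
proof
  assume b: "b \<noteq> 0" and "to_fract a / to_fract b \<in> val_ring_inf"
  then obtain c d where *: "to_fract a / to_fract b = to_fract c / to_fract d" "d \<noteq> 0" "degree c \<le> degree d"
    by (auto simp: val_ring_inf_def)
  then have "to_fract (a * d) = to_fract (c * b)" using b by (simp add: frac_eq_eq)
  then have eq: "a * d = c * b" by (simp only: to_fract_eq_iff)
  show "degree a \<le> degree b"
  proof (cases "a = 0")
    case False
    then have "c \<noteq> 0" using eq * by auto
    then have "degree a + degree d = degree c + degree b"
      using arg_cong[OF eq, of degree] False b * by (simp add: degree_mult_eq)
    then show ?thesis using * by simp
  qed simp
qed (auto simp: val_ring_inf_def)

lemma tF_not_in_val_ring_inf: "tF \<notin> val_ring_inf"
  using val_ring_inf_iff[of 1 "[:0, 1:]"] by simp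

lemma val_ring_inf: "(val_ring_inf :: 'f::field poly fract set) \<in> valuation_rings const_field UNIV"
proof -
  let ?V = "val_ring_inf :: 'f poly fract set"
  have "subring_set ?V"
  proof
    show "1 \<in> ?V" using val_ring_inf_iff[of 1 1] by simp
    fix x y assume "x \<in> ?V" "y \<in> ?V"
    then obtain a b c d where *: "x = to_fract a / to_fract b" "b \<noteq> 0" "degree a \<le> degree b"
      "y = to_fract c / to_fract d" "d \<noteq> 0" "degree c \<le> degree d"
      by (auto simp: val_ring_inf_def)
    have deg: "degree (b * d) = degree b + degree d" using * by (simp add: degree_mult_eq)
    have "degree (a * d - c * b) \<le> degree b + degree d"
      using * by (intro degree_diff_le order_trans[OF degree_mult_le]) auto
    moreover have "x - y = to_fract (a * d - c * b) / to_fract (b * d)" using * by (simp add: diff_frac_eq)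
    ultimately show "x - y \<in> ?V" using val_ring_inf_iff[of "b * d" "a * d - c * b"] deg * by simp
    have "degree (a * c) \<le> degree b + degree d" using * by (intro order_trans[OF degree_mult_le]) auto
    moreover have "x * y = to_fract (a * c) / to_fract (b * d)" using * by simp
    ultimately show "x * y \<in> ?V" using val_ring_inf_iff[of "b * d" "a * c"] deg * by simp
  qed
  moreover have "z \<in> ?V \<or> inverse z \<in> ?V" for z
  proof -
    obtain a b where ab: "b \<noteq> 0" "z = to_fract a / to_fract b"
      by (cases z) (auto simp: Fract_conv_to_fract)
    show ?thesis
    proof (cases "a = 0")
      case True then show ?thesis using ab val_ring_inf_iff[of b a] by simp
    next
      case False
      then show ?thesis using ab val_ring_inf_iff[of b a] val_ring_inf_iff[of a b] by auto
    qed
  qed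
  moreover have "const_field \<noteq> ?V"
  proof
    assume "const_field = ?V"
    moreover have "(1 :: 'f poly fract) / tF \<in> ?V" using val_ring_inf_iff[of "[:0, 1 :: 'f:]" 1] by simp
    ultimately have "(1 :: 'f poly fract) / tF \<in> (const_field :: 'f poly fract set)" by simp
    then obtain c where "(1 :: 'f poly fract) / tF = to_fract [:c:]" by (auto simp: const_field_eq)
    then have "to_fract ([:c:] * [:0, 1:]) = 1" by (simp only: to_fract_mult) (simp add: field_simps)
    then have "[:c:] * [:0, 1:] = 1" by (simp only: to_fract_1[symmetric] to_fract_eq_iff)
    then have "degree ([:c:] * [:0, 1:]) = 0" "c \<noteq> 0" by auto
    then show False by simp
  qed
  moreover have "const_field \<subseteq> ?V" using val_ring_inf_iff[of "1 :: 'f poly"] by (auto simp: const_field_eq)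
  moreover have "?V \<noteq> UNIV" using tF_not_in_val_ring_inf by auto
  ultimately show ?thesis by (auto simp: valuation_rings_def subring_iff)
qed

section \<open>The ring of functions regular away from one place\<close>

locale regular_functions =
  fixes \<rho> :: "'f::field poly" and N :: nat
  assumes lead_coeff_rho: "lead_coeff \<rho> = 1" and irreducible_rho: "irreducible \<rho>"
    and degree_rho: "degree \<rho> = N" and N_ge_2: "N \<ge> 2"
begin

abbreviation "rF \<equiv> to_fract \<rho>"

lemma rho_nonzero: "\<rho> \<noteq> 0" using irreducible_rho by auto
lemma rF_nonzero: "rF \<noteq> 0" using rho_nonzero by simp

lemma rho_0: "poly \<rho> 0 \<noteq> 0"
proof
  assume "poly \<rho> 0 = 0"
  then obtain g where g: "\<rho> = [:0, 1:] * g" by (auto simp: poly_eq_0_iff_dvd elim: dvdE)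
  then have "is_unit [:0, 1::'f:] \<or> is_unit g" using irreducibleD[OF irreducible_rho g] by simp
  moreover have "g \<noteq> 0" using g rho_nonzero by auto
  moreover have "degree \<rho> = 1 + degree g" using g \<open>g \<noteq> 0\<close> by (simp add: degree_mult_eq)
  ultimately show False using degree_rho N_ge_2 by (auto simp: is_unit_iff_degree)
qed

text \<open>An explicit model of \<open>ring_A\<close>: only powers of \<rho> may occur as
  denominators, and the degree bound expresses regularity at infinity.\<close>

definition A :: "'f poly fract set" where "A = {to_fract a / rF ^ k | a k. degree a \<le> k * N}"

lemma A_I: "degree a \<le> k * N \<Longrightarrow> to_fract a / rF ^ k \<in> A" by (auto simp: A_def)

lemma degree_rho_power: "degree (\<rho> ^ k) = k * N"
  by (simp add: degree_power_eq rho_nonzero degree_rho)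

sublocale A: subring_set A
proof
  show "1 \<in> A" using A_I[of 1 0] by simp
  fix x y assume "x \<in> A" "y \<in> A"
  then obtain a k b l where *: "x = to_fract a / rF ^ k" "degree a \<le> k * N" "y = to_fract b / rF ^ l" "degree b \<le> l * N"
    by (auto simp: A_def)
  have "x - y = to_fract (a * \<rho> ^ l - b * \<rho> ^ k) / rF ^ (k + l)"
    using rF_nonzero by (simp add: * diff_frac_eq power_add to_fract_power)
  also have "\<dots> \<in> A"
    using * by (intro A_I degree_diff_le order_trans[OF degree_mult_le]) (auto simp: degree_rho_power algebra_simps)
  finally show "x - y \<in> A" .
  have "x * y = to_fract (a * b) / rF ^ (k + l)"
    by (simp add: * power_add)
  also have "\<dots> \<in> A"
    using * by (intro A_I degree_diff_le order_trans[OF degree_mult_le]) (auto simp: algebra_simps)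
  finally show "x * y \<in> A" .
qed

lemma const_in_A: "to_fract [:c:] \<in> A" using A_I[of "[:c:]" 0] by simp

lemma T_eq: "T_fun \<rho> i = tF ^ i / rF"
  by (simp add: T_fun_def Fract_conv_to_fract to_fract_monom flip: one_pCons)

lemma T_in_A: "i \<le> N \<Longrightarrow> T_fun \<rho> i \<in> A"
  using A_I[of "monom 1 i" 1] by (simp add: T_eq to_fract_monom degree_monom_eq flip: one_pCons)

text \<open>Splitting off the factor \<open>T_fun\<close> of index min i N lowers k by one and
  leaves i - N or 0 as the remaining exponent of t.\<close>

lemma T_monomial:
  assumes "subring_set R" "\<And>i. i \<le> N \<Longrightarrow> T_fun \<rho> i \<in> R"
  shows "i \<le> k * N \<Longrightarrow> tF ^ i / rF ^ k \<in> R"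
proof (induction k arbitrary: i)
  interpret R: subring_set R by fact
  case 0 then show ?case by (simp add: R.one)
next
  interpret R: subring_set R by fact
  case (Suc k)
  define j where "j = min i N"
  have "tF ^ i / rF ^ Suc k = T_fun \<rho> j * (tF ^ (i - j) / rF ^ k)"
    by (simp add: T_eq j_def flip: power_add)
  moreover have "T_fun \<rho> j \<in> R" using assms(2) by (simp add: j_def)
  moreover have "tF ^ (i - j) / rF ^ k \<in> R" using Suc by (auto simp: j_def)
  ultimately show ?case by (simp only: R.mult)
qed

text \<open>If t lies in V, all polynomials do, and 1/\<rho> can be missing only at the place of
  \<rho>. Otherwise 1/t is in the maximal ideal and T_i is a power of 1/t times a unit.\<close>

lemma T_in_valuation_ring:
  assumes V: "V \<in> valuation_rings const_field UNIV" "V \<noteq> val_ring_at \<rho>" and i: "i \<le> N"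
  shows "T_fun \<rho> i \<in> V"
proof -
  interpret V: valuation_set V UNIV by (rule valuation_ringsD(1)[OF V(1) subfield_set_UNIV])
  have c: "to_fract [:c:] \<in> V" for c using valuation_ringsD(2)[OF V(1) subfield_set_UNIV] by (auto simp: const_field_eq)
  have Vne: "V \<noteq> UNIV" by (rule valuation_ringsD(3)[OF V(1) subfield_set_UNIV])
  show ?thesis
  proof (cases "tF \<in> V")
    case True
    have int: "to_fract a \<in> V" for a by (subst to_fract_expand) (intro V.closed c True)
    have "inverse rF \<in> V"
    proof (rule ccontr)
      assume ninv: "inverse rF \<notin> V"
      then have rm: "rF \<in> V.\<mm>" using int by (auto simp: place_ideal_def)
      \<comment> \<open>Modulo the maximal ideal \<rho> vanishes, so Bezout makes every denominator
        prime to \<rho> a unit of V.\<close>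
      have sub: "val_ring_at \<rho> \<subseteq> V"
      proof
        fix x assume "x \<in> val_ring_at \<rho>"
        then obtain a b where ab: "x = to_fract a / to_fract b" "\<not> \<rho> dvd b" by (auto simp: val_ring_at_iff)
        obtain r s where rs: "r * \<rho> + s * b = 1" by (rule bezout_poly[OF irreducible_rho ab(2)])
        have "to_fract r * rF + to_fract s * to_fract b = 1"
          using arg_cong[OF rs, of to_fract] by simp
        then have "inverse (to_fract b) \<in> V"
          using V.mm_unit[OF int, of b] V.mm_mult[OF rm int, of r] V.mm_mult[OF _ int, of "to_fract b" s] V.mm_add V.mm_one
          by metis
        then show "x \<in> V" unfolding ab(1) divide_inverse by (intro V.mult int)
      qed
      \<comment> \<open>A reduced fraction a/(\<rho> b') in V, multiplied by b'/a, would be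
        1/\<rho>; the factor b'/a is in V because \<rho> does not divide a.\<close>
      have "V \<subseteq> val_ring_at \<rho>"
      proof (rule ccontr)
        assume "\<not> V \<subseteq> val_ring_at \<rho>"
        then obtain x where x: "x \<in> V" "x \<notin> val_ring_at \<rho>" by blast
        obtain a b where ab: "b \<noteq> 0" "x = to_fract a / to_fract b" "\<And>p. irreducible p \<Longrightarrow> p dvd a \<Longrightarrow> \<not> p dvd b"
          using fract_min_repr[of x] by blast
        have "\<rho> dvd b" using x ab by (auto simp: val_ring_at_iff)
        then obtain b' where b': "b = \<rho> * b'" by (auto elim: dvdE)
        have "\<not> \<rho> dvd a" using ab(3)[OF irreducible_rho] \<open>\<rho> dvd b\<close> by blast
        then have "to_fract b' / to_fract a \<in> V" using sub val_ring_at_iff by blast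
        then have "x * (to_fract b' / to_fract a) \<in> V" by (intro V.mult x)
        moreover have "a \<noteq> 0" "b' \<noteq> 0" using \<open>\<not> \<rho> dvd a\<close> ab(1) b' by auto
        then have "x * (to_fract b' / to_fract a) = inverse rF" using rF_nonzero by (simp add: ab(2) b' field_simps)
        ultimately show False using ninv by simp
      qed
      with sub V(2) show False by blast
    qed
    then show ?thesis unfolding T_eq divide_inverse by (intro V.mult V.power True)
  next
    case False
    define y :: "'f poly fract" where "y = inverse tF"
    have t0: "(tF :: 'f poly fract) \<noteq> 0" by simp
    have yV: "y \<in> V" using V.val[of tF] False by (simp add: y_def)
    have ym: "y \<in> V.\<mm>" using yV False by (auto simp: y_def place_ideal_def)
    \<comment> \<open>Here \<rho> = t^N (1 + m). One factor y of y^(N-j) is split off to show each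
      term in the maximal ideal.\<close>
    define m where "m = (\<Sum>j<N. to_fract [:coeff \<rho> j:] * y ^ (N - 1 - j) * y)"
    have mm: "m \<in> V.\<mm>" unfolding m_def by (intro V.mm_sum V.mm_mult ym V.closed c yV)
    have "rF = (\<Sum>j<N. to_fract [:coeff \<rho> j:] * tF ^ j) + tF ^ N"
      using lead_coeff_rho degree_rho by (subst to_fract_expand) (simp add: degree_rho flip: lessThan_Suc_atMost one_pCons)
    also have "(\<Sum>j<N. to_fract [:coeff \<rho> j:] * tF ^ j) = tF ^ N * m"
      unfolding m_def sum_distrib_left
    proof (intro sum.cong refl)
      fix j assume "j \<in> {..<N}"
      then have e1: "tF ^ N = (tF ^ j * tF ^ Suc (N - 1 - j) :: 'f poly fract)" by (simp flip: power_add power_Suc)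
      have e2: "y ^ (N - 1 - j) * y * tF ^ Suc (N - 1 - j) = 1"
        using t0 by (simp add: y_def power_inverse field_simps)
      have "tF ^ N * (to_fract [:coeff \<rho> j:] * y ^ (N - 1 - j) * y)
          = to_fract [:coeff \<rho> j:] * tF ^ j * (y ^ (N - 1 - j) * y * tF ^ Suc (N - 1 - j))"
        unfolding e1 by (simp only: mult_ac)
      then show "to_fract [:coeff \<rho> j:] * tF ^ j = tF ^ N * (to_fract [:coeff \<rho> j:] * y ^ (N - 1 - j) * y)"
        unfolding e2 mult_1_right by (rule sym)
    qed
    finally have r: "rF = tF ^ N * (1 - (- m))" by (simp add: algebra_simps)
    have "inverse (1 - (- m)) \<in> V" by (intro V.one_minus_unit V.mm_uminus mm)
    moreover have "T_fun \<rho> i = y ^ (N - i) * inverse (1 - (- m))"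
    proof -
      have "tF ^ N = (tF ^ i * tF ^ (N - i) :: 'f poly fract)" using i by (simp flip: power_add)
      then have "(tF ^ i :: 'f poly fract) / tF ^ N = y ^ (N - i)" using t0 by (simp add: y_def power_inverse field_simps)
      then show ?thesis unfolding T_eq r by (simp add: divide_inverse)
    qed
    ultimately show ?thesis using yV by (simp add: V.closed)
  qed
qed

lemma val_ring_at_neq: "irreducible p \<Longrightarrow> \<not> p dvd \<rho> \<Longrightarrow> val_ring_at p \<noteq> val_ring_at \<rho>"
proof
  assume "\<not> p dvd \<rho>" "val_ring_at p = val_ring_at \<rho>"
  moreover have "inverse rF = to_fract 1 / rF" by (simp add: divide_inverse)
  ultimately show False using inverse_not_in_val_ring_at[OF irreducible_rho] val_ring_at_iff by metis
qed

lemma val_ring_inf_neq: "val_ring_inf \<noteq> val_ring_at \<rho>"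
proof -
  have "tF \<in> val_ring_at \<rho>"
    unfolding val_ring_at_iff using irreducible_rho
    by (intro exI[of _ "[:0, 1:]"] exI[of _ 1]) (auto simp: irreducible_def)
  then show ?thesis using tF_not_in_val_ring_inf by auto
qed

text \<open>One inclusion expands numerators into monomials t^i/\<rho>^k. For the other, regularity
  at every irreducible p not dividing \<rho> restricts the reduced denominator, and regularity at
  infinity bounds the numerator.\<close>

lemma ring_A_eq: "ring_A \<rho> = A"
proof
  show "A \<subseteq> ring_A \<rho>"
  proof
    fix x assume "x \<in> A"
    then obtain a k where x: "x = to_fract a / rF ^ k" "degree a \<le> k * N" by (auto simp: A_def)
    show "x \<in> ring_A \<rho>" unfolding ring_A_def
    proof (intro CollectI ballI impI)
      fix V assume V: "V \<in> valuation_rings const_field UNIV" "V \<noteq> val_ring_at \<rho>"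
      interpret V: valuation_set V UNIV by (rule valuation_ringsD(1)[OF V(1) subfield_set_UNIV])
      have c: "to_fract [:c:] \<in> V" for c
        using valuation_ringsD(2)[OF V(1) subfield_set_UNIV] by (auto simp: const_field_eq)
      have m: "tF ^ i / rF ^ k \<in> V" if "i \<le> degree a" for i
        using T_monomial[OF V.subring_set_axioms T_in_valuation_ring[OF V]] that x(2) by simp
      have "x = (\<Sum>i\<le>degree a. to_fract [:coeff a i:] * (tF ^ i / rF ^ k))"
        unfolding x(1) by (subst to_fract_expand) (simp add: sum_divide_distrib)
      also have "\<dots> \<in> V" using m by (intro V.sum V.mult c) auto
      finally show "x \<in> V" .
    qed
  qed
next
  show "ring_A \<rho> \<subseteq> A"
  proof
    fix x assume x: "x \<in> ring_A \<rho>"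
    obtain a b where ab: "b \<noteq> 0" "x = to_fract a / to_fract b" "\<And>p. irreducible p \<Longrightarrow> p dvd a \<Longrightarrow> \<not> p dvd b"
      using fract_min_repr[of x] by blast
    have assoc: "p dvd \<rho>" if p: "irreducible p" "p dvd b" for p
    proof (rule ccontr)
      assume "\<not> p dvd \<rho>"
      then have "x \<in> val_ring_at p" using x val_ring_at[OF p(1)] val_ring_at_neq[OF p(1)] by (auto simp: ring_A_def)
      then obtain c d where cd: "x = to_fract c / to_fract d" "\<not> p dvd d" by (auto simp: val_ring_at_iff)
      then have "d \<noteq> 0" by auto
      then have "to_fract (a * d) = to_fract (c * b)" using ab cd by (simp add: frac_eq_eq)
      then have "a * d = c * b" by (simp only: to_fract_eq_iff)
      then have "p dvd a" using p cd irreducible_dvd_mult[OF p(1), of a d] by auto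
      then show False using ab(3) p by blast
    qed
    \<comment> \<open>Each irreducible factor of b is an associate of \<rho>, so dividing by \<rho>
      repeatedly ends at a constant.\<close>
    have pow: "\<exists>c k. c \<noteq> 0 \<and> b = smult c (\<rho> ^ k)" if "b \<noteq> 0" "\<And>p. irreducible p \<Longrightarrow> p dvd b \<Longrightarrow> p dvd \<rho>" for b
      using that
    proof (induction "degree b" arbitrary: b rule: less_induct)
      case less
      show ?case
      proof (cases "degree b = 0")
        case True
        then obtain c where "b = [:c:]" by (rule degree_eq_zeroE)
        then show ?thesis using less(2) by (intro exI[of _ c] exI[of _ 0]) auto
      next
        case False
        then obtain p where p: "irreducible p" "p dvd b" using irreducible_factor by blast
        then have "p dvd \<rho>" using less by blast
        then obtain e where e: "\<rho> = p * e" by (auto elim: dvdE)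
        then have "is_unit e" using irreducibleD[OF irreducible_rho e] p(1) by (auto simp: irreducible_def)
        then have "\<rho> dvd p" unfolding e by (simp add: mult_unit_dvd_iff)
        then have "\<rho> dvd b" using p(2) dvd_trans by blast
        then obtain b' where b': "b = \<rho> * b'" by (auto elim: dvdE)
        have "b' \<noteq> 0" using less(2) b' by auto
        then have "degree b' < degree b" using b' rho_nonzero degree_rho N_ge_2 by (simp add: degree_mult_eq)
        then have "\<exists>c k. c \<noteq> 0 \<and> b' = smult c (\<rho> ^ k)"
        proof (rule less(1))
          show "p dvd \<rho>" if "irreducible p" "p dvd b'" for p
            using less(3)[OF that(1)] dvd_mult[OF that(2), of \<rho>] by (simp add: b')
        qed fact
        then obtain c k where "c \<noteq> 0" "b' = smult c (\<rho> ^ k)" by blast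
        then show ?thesis by (intro exI[of _ c] exI[of _ "Suc k"]) (simp add: b')
      qed
    qed
    obtain c k where ck: "c \<noteq> 0" "b = smult c (\<rho> ^ k)" using pow[OF ab(1) assoc] by blast
    have "x \<in> val_ring_inf" using x val_ring_inf val_ring_inf_neq by (auto simp: ring_A_def)
    then have "degree a \<le> degree b" using ab(2) val_ring_inf_iff[OF ab(1)] by simp
    also have "\<dots> = k * N" using ck by (simp add: degree_rho_power)
    finally have "to_fract (smult (inverse c) a) / rF ^ k \<in> A" by (intro A_I) (use ck in simp)
    moreover have "to_fract (smult (inverse c) a) / rF ^ k = x"
    proof -
      have "to_fract (smult (inverse c) a) * to_fract b = to_fract a * rF ^ k"
        unfolding to_fract_mult[symmetric] to_fract_power[symmetric] using ck by simp
      then show ?thesis using ab(1,2) rF_nonzero by (simp add: frac_eq_eq)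
    qed
    ultimately show "x \<in> A" by simp
  qed
qed

end

section \<open>Fractional ideals at a place of degree one\<close>

context subring_set
begin

lemma cring_as_ring: "cring (as_ring S)"
proof -
  interpret R: cring "type_ring :: 'a ring" by (rule cring_from_type_algebra)
  have "subring S (type_ring :: 'a ring)" using subring_iff subring_set_axioms by blast
  then show ?thesis using R.subcringI' R.subcring_iff by simp
qed

lemma as_ring_simps [simp]:
  "carrier (as_ring S) = S" "x \<oplus>\<^bsub>as_ring S\<^esub> y = x + y" "x \<otimes>\<^bsub>as_ring S\<^esub> y = x * y"
  "\<one>\<^bsub>as_ring S\<^esub> = 1" "\<zero>\<^bsub>as_ring S\<^esub> = 0"
  by (simp_all add: ring_of_type_algebra_def)

lemma ideal_iff:
  "ideal I (as_ring S) \<longleftrightarrow>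
     I \<subseteq> S \<and> 0 \<in> I \<and> (\<forall>x\<in>I. \<forall>y\<in>I. x - y \<in> I) \<and> (\<forall>a\<in>S. \<forall>x\<in>I. a * x \<in> I)"
proof
  interpret R: cring "as_ring S" by (rule cring_as_ring)
  { assume "ideal I (as_ring S)"
    then interpret I: ideal I "as_ring S" .
    have IS: "I \<subseteq> S" using I.a_subset by simp
    have m: "a * x \<in> I" if "a \<in> S" "x \<in> I" for a x using I.I_l_closed[of x a] that by simp
    have "x - y \<in> I" if "x \<in> I" "y \<in> I" for x y
      using I.a_closed[OF that(1) m[OF _ that(2), of "-1"]] uminus[OF one] by simp
    then show "I \<subseteq> S \<and> 0 \<in> I \<and> (\<forall>x\<in>I. \<forall>y\<in>I. x - y \<in> I) \<and> (\<forall>a\<in>S. \<forall>x\<in>I. a * x \<in> I)"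
      using IS m I.zero_closed by auto }
  { assume *: "I \<subseteq> S \<and> 0 \<in> I \<and> (\<forall>x\<in>I. \<forall>y\<in>I. x - y \<in> I) \<and> (\<forall>a\<in>S. \<forall>x\<in>I. a * x \<in> I)"
    have neg: "- y \<in> I" if "y \<in> I" for y using * that by (metis diff_0)
    have add: "x + y \<in> I" if "x \<in> I" "y \<in> I" for x y using * neg[OF that(2)] that(1) by (metis diff_minus_eq_add)
    have inv: "inv\<^bsub>add_monoid (as_ring S)\<^esub> x = - x" if "x \<in> I" for x
      using R.minus_equality[of "-x" x] that * uminus unfolding a_inv_def by auto
    show "ideal I (as_ring S)"
    proof (rule idealI)
      show "ring (as_ring S)" by (rule R.ring_axioms)
      show "subgroup I (add_monoid (as_ring S))"
        by (rule subgroup.intro) (use * neg add inv in auto)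
    qed (use * in \<open>auto, metis mult.commute\<close>) }
qed

lemma primeideal_iff:
  "primeideal P (as_ring S) \<longleftrightarrow>
     ideal P (as_ring S) \<and> P \<noteq> S \<and> (\<forall>a\<in>S. \<forall>b\<in>S. a * b \<in> P \<longrightarrow> a \<in> P \<or> b \<in> P)"
  using cring_as_ring by (auto simp: primeideal_def primeideal_axioms_def)

lemma prime_one: "primeideal P (as_ring S) \<Longrightarrow> 1 \<notin> P"
  unfolding primeideal_iff ideal_iff by (metis mult.right_neutral subsetI subset_antisym)

lemma prime_power_mem:
  "primeideal P (as_ring S) \<Longrightarrow> x \<in> S \<Longrightarrow> x \<notin> P \<Longrightarrow> x ^ n \<notin> P"
  by (induction n) (auto simp: prime_one primeideal_iff power)

lemma ideal_group_carrier:
  assumes "ideal I (as_ring S)" "I \<noteq> {0}"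
  shows "I \<in> carrier (ideal_group S)"
proof -
  interpret R: ring "type_ring :: 'a ring" by (rule ring_from_type_algebra)
  note i = assms(1)[unfolded ideal_iff]
  have neg: "- y \<in> I" if "y \<in> I" for y using i that by (metis diff_0)
  have add: "x + y \<in> I" if "x \<in> I" "y \<in> I" for x y using i neg[OF that(2)] that(1) by (metis diff_minus_eq_add)
  have "inv\<^bsub>add_monoid (type_ring :: 'a ring)\<^esub> x = - x" for x
    using type_ring_a_inv[of x] by (simp add: a_inv_def)
  then have "subgroup I (add_monoid type_ring)"
    by (intro subgroup.intro) (use i neg add in auto)
  moreover have "\<exists>d\<in>S. d \<noteq> 0 \<and> (\<forall>x\<in>I. d * x \<in> S)"
    by (rule bexI[of _ 1]) (use i one in auto)
  ultimately show ?thesis using i assms(2) by (simp add: ideal_group_def)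
qed

end

section \<open>Products of fractional ideals and vanishing exponents\<close>

lemma ideal_group_mult: "I \<otimes>\<^bsub>ideal_group A\<^esub> J = ideal_prod type_ring I J"
  by (simp add: ideal_group_def)

lemma ideal_group_one: "\<one>\<^bsub>ideal_group A\<^esub> = A"
  by (simp add: ideal_group_def)

lemma ideal_prod_subset:
  fixes I J R :: "'a::field set"
  assumes "\<And>i j. i \<in> I \<Longrightarrow> j \<in> J \<Longrightarrow> i * j \<in> R" "\<And>x y. x \<in> R \<Longrightarrow> y \<in> R \<Longrightarrow> x + y \<in> R"
  shows "ideal_prod type_ring I J \<subseteq> R"
proof
  fix x assume "x \<in> ideal_prod type_ring I J"
  then show "x \<in> R" by induction (use assms in auto)
qed

lemma ideal_prod_memI: "i \<in> I \<Longrightarrow> j \<in> J \<Longrightarrow> i * j \<in> ideal_prod (type_ring :: 'a::field ring) I J"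
  using ideal_prod.prod[of i I j J type_ring] by simp

context subring_set
begin

text \<open>No unique factorization is needed: \<open>P\<^sup>n\<close> generates a proper ideal of the localization for every \<open>n > 0\<close>.\<close>
lemma ideal_ord_eq_0:
  assumes P: "primeideal P (as_ring S)" and I: "ideal I (as_ring S)" and IP: "\<not> I \<subseteq> P"
  shows "ideal_ord S P I = 0"
proof -
  note p = P[unfolded primeideal_iff ideal_iff] and i = I[unfolded ideal_iff]
  let ?L = "localization S P"
  note one_P = prime_one[OF P]
  have addP: "x + y \<in> P" if "x \<in> P" "y \<in> P" for x y
    using p that by (metis (no_types, opaque_lifting) diff_0 diff_minus_eq_add)
  have L_I: "x / y \<in> ?L" if "x \<in> S" "y \<in> S" "y \<notin> P" for x y using that by (auto simp: localization_def)
  have L_E: "\<exists>x y. x \<in> S \<and> y \<in> S \<and> y \<notin> P \<and> y \<noteq> 0 \<and> z = x / y" if "z \<in> ?L" for z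
    using that p unfolding localization_def by blast
  have yy: "y * y' \<in> S \<and> y * y' \<notin> P" if "y \<in> S" "y \<notin> P" "y' \<in> S" "y' \<notin> P" for y y'
    using that p mult by blast
  have L_one: "1 \<in> ?L" using L_I[OF one one one_P] by simp
  have L_add: "z + w \<in> ?L" if zw: "z \<in> ?L" "w \<in> ?L" for z w
  proof -
    obtain x y x' y' where *: "x \<in> S" "y \<in> S" "y \<notin> P" "y \<noteq> 0" "z = x / y" "x' \<in> S" "y' \<in> S" "y' \<notin> P" "y' \<noteq> 0" "w = x' / y'"
      using L_E[OF zw(1)] L_E[OF zw(2)] by blast
    then have "z + w = (x * y' + x' * y) / (y * y')" by (simp add: add_frac_eq)
    then show ?thesis using * yy[of y y'] by (auto intro!: L_I closed)
  qed
  have L_mult: "a * z \<in> ?L" if az: "a \<in> S" "z \<in> ?L" for a z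
  proof -
    obtain x y where *: "x \<in> S" "y \<in> S" "y \<notin> P" "z = x / y" using L_E[OF az(2)] by blast
    then have "a * z = (a * x) / y" by simp
    then show ?thesis using * az(1) by (auto intro!: L_I closed)
  qed
  \<comment> \<open>An element of J outside P is a unit of the localization, so J generates all of
    it.\<close>
  have whole: "ideal_prod type_ring J ?L = ?L" if J: "J \<subseteq> S" "s \<in> J" "s \<notin> P" for J s
  proof
    show "ideal_prod type_ring J ?L \<subseteq> ?L" by (rule ideal_prod_subset) (use J L_mult L_add in auto)
    show "?L \<subseteq> ideal_prod type_ring J ?L"
    proof
      fix z assume "z \<in> ?L"
      then obtain x y where *: "x \<in> S" "y \<in> S" "y \<notin> P" "z = x / y" using L_E by blast
      have "s \<noteq> 0" using J p by auto
      then have "z = s * (x / (s * y))" using * by simp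
      moreover have "x / (s * y) \<in> ?L" using * J yy[of s y] by (intro L_I) auto
      ultimately show "z \<in> ideal_prod type_ring J ?L" using ideal_prod_memI J by metis
    qed
  qed
  \<comment> \<open>Products with J contained in P have numerators in P, and 1 is no such fraction.
    Hence a positive n makes only the right side of the defining equation proper, and a negative n
    only the left side.\<close>
  have proper: "1 \<notin> ideal_prod type_ring J ?L" if "J \<subseteq> P" for J
  proof -
    have "ideal_prod type_ring J ?L \<subseteq> {x / y | x y. x \<in> P \<and> y \<in> S \<and> y \<notin> P}" (is "_ \<subseteq> ?M")
    proof (rule ideal_prod_subset)
      fix a z assume a: "a \<in> J" "z \<in> ?L"
      then obtain x y where *: "x \<in> S" "y \<in> S" "y \<notin> P" "z = x / y" using L_E by blast
      then have "a * z = (x * a) / y" by simp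
      moreover have "x * a \<in> P" using * a p \<open>J \<subseteq> P\<close> by auto
      ultimately show "a * z \<in> ?M" using * by blast
    next
      fix z w assume "z \<in> ?M" "w \<in> ?M"
      then obtain x y x' y' where *: "x \<in> P" "y \<in> S" "y \<notin> P" "z = x / y" "x' \<in> P" "y' \<in> S" "y' \<notin> P" "w = x' / y'"
        by blast
      then have "y \<noteq> 0" "y' \<noteq> 0" using p by auto
      then have "z + w = (y' * x + y * x') / (y * y')" using * by (simp add: add_frac_eq mult.commute)
      moreover have "y' * x + y * x' \<in> P" using * p by (intro addP) auto
      ultimately show "z + w \<in> ?M" using yy[of y y'] * by blast
    qed
    moreover have "1 \<notin> ?M"
    proof
      assume "1 \<in> ?M"
      then obtain x y where "1 = x / y" "x \<in> P" "y \<notin> P" by blast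
      then show False by (metis div_by_0 divide_eq_1_iff zero_neq_one)
    qed
    ultimately show ?thesis by blast
  qed
  have pow0: "P [^]\<^bsub>ideal_group S\<^esub> (0::nat) = S" by (simp add: ideal_group_one)
  have powS: "P [^]\<^bsub>ideal_group S\<^esub> (n::nat) \<subseteq> S" for n
  proof (induction n)
    case (Suc n)
    show ?case unfolding nat_pow_Suc ideal_group_mult by (rule ideal_prod_subset) (use Suc p in \<open>auto intro: mult add\<close>)
  qed (simp add: ideal_group_one)
  have powP: "P [^]\<^bsub>ideal_group S\<^esub> (n::nat) \<subseteq> P" if n: "n > 0" for n
  proof -
    obtain m where m: "n = Suc m" using n by (cases n) auto
    show ?thesis unfolding m nat_pow_Suc ideal_group_mult
      by (rule ideal_prod_subset) (use powS[of m] p addP in auto)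
  qed
  have SS: "ideal_prod type_ring S ?L = ?L" by (rule whole[OF _ one one_P]) simp
  obtain s where s: "s \<in> I" "s \<notin> P" using IP by blast
  have IS: "ideal_prod type_ring I S \<subseteq> S" by (rule ideal_prod_subset) (use i in \<open>auto intro: mult add\<close>)
  have sIS: "s \<in> ideal_prod type_ring I S" using ideal_prod_memI[OF s(1) one] by simp
  show ?thesis unfolding ideal_ord_def ideal_group_mult
  proof (rule the_equality)
    show "ideal_prod type_ring (ideal_prod type_ring I (P [^]\<^bsub>ideal_group S\<^esub> nat (- 0))) ?L =
       ideal_prod type_ring (P [^]\<^bsub>ideal_group S\<^esub> nat 0) ?L"
      using whole[OF IS sIS s(2)] SS by (simp add: ideal_group_one)
    fix n :: int
    assume *: "ideal_prod type_ring (ideal_prod type_ring I (P [^]\<^bsub>ideal_group S\<^esub> nat (- n))) ?L =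
       ideal_prod type_ring (P [^]\<^bsub>ideal_group S\<^esub> nat n) ?L"
    consider "n > 0" | "n = 0" | "n < 0" by linarith
    then show "n = 0"
    proof cases
      case 1
      then have "1 \<in> ideal_prod type_ring (P [^]\<^bsub>ideal_group S\<^esub> nat n) ?L"
        using * whole[OF IS sIS s(2)] L_one by (simp add: ideal_group_one)
      then show ?thesis using proper[OF powP[of "nat n"]] 1 by simp
    next
      case 3
      have one_mem: "1 \<in> ideal_prod type_ring (ideal_prod type_ring I (P [^]\<^bsub>ideal_group S\<^esub> nat (- n))) ?L"
        using * 3 SS L_one by (simp add: ideal_group_one)
      define m where "m = nat (- n)"
      have m: "m > 0" using 3 by (simp add: m_def)
      have "ideal_prod type_ring I (P [^]\<^bsub>ideal_group S\<^esub> m) \<subseteq> P"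
      proof (rule ideal_prod_subset)
        fix a b assume ab: "a \<in> I" "b \<in> P [^]\<^bsub>ideal_group S\<^esub> m"
        then have "a \<in> S" "b \<in> P" using i powP[OF m] by auto
        then show "a * b \<in> P" using p by simp
      qed (rule addP)
      then show ?thesis using one_mem proper unfolding m_def by blast
    qed
  qed
qed

end

text \<open>What the primes at infinity and at zero share: \<pi> generates the maximal ideal
  (\<open>unif\<close>), the residue field consists of constants (\<open>residue\<close>), V is the
  local ring of A (\<open>loc\<close>), and inverting \<pi> yields the whole field
  (\<open>pole\<close>).\<close>

locale degree_one_place = A: subring_set A + V: valuation_set V UNIV
  for A V :: "'f::field poly fract set" +
  fixes \<pi> :: "'f poly fract"
  assumes A_subset: "A \<subseteq> V" and const_in_A: "to_fract [:c:] \<in> A"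
    and pi_mem: "\<pi> \<in> place_ideal V" and pi_nonzero: "\<pi> \<noteq> 0"
    and unif: "x \<in> place_ideal V \<Longrightarrow> x / \<pi> \<in> V"
    and residue: "x \<in> V \<Longrightarrow> \<exists>c. x - to_fract [:c:] \<in> place_ideal V"
    and loc: "x \<in> V \<Longrightarrow> \<exists>a\<in>A. \<exists>b\<in>A. b \<notin> place_ideal V \<and> x = a / b"
    and pole: "\<exists>n. \<pi> ^ n * x \<in> V"
begin

definition I :: "'f poly fract set" where "I = A \<inter> V.\<mm>"

lemma ideal_I: "ideal I (as_ring A)"
  unfolding A.ideal_iff I_def using A_subset
  by (auto intro: V.mm_zero A.closed V.mm_diff V.mm_mult)

lemma pi_frac: obtains a b where "a \<in> I" "b \<in> A" "b \<notin> V.\<mm>" "\<pi> = a / b"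
proof -
  obtain a b where ab: "a \<in> A" "b \<in> A" "b \<notin> V.\<mm>" "\<pi> = a / b" using loc[OF V.mm_subset[OF pi_mem]] by blast
  then have "b \<noteq> 0" using V.mm_zero by auto
  then have "a = b * \<pi>" using ab by simp
  then have "a \<in> V.\<mm>" using V.mm_mult[OF pi_mem, of b] ab A_subset by auto
  then show ?thesis using that ab by (auto simp: I_def)
qed

lemma I_nonzero: "I \<noteq> {0}"
proof
  assume "I = {0}"
  then show False using pi_frac pi_nonzero by (metis div_0 singletonD)
qed

text \<open>An element of A outside I is a nonzero constant modulo I, so a larger ideal contains a
  unit.\<close>

lemma maximal_I:
  assumes "ideal J (as_ring A)" "I \<subseteq> J" "J \<noteq> A"
  shows "J = I"
proof (rule ccontr)
  note j = assms(1)[unfolded A.ideal_iff]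
  assume "J \<noteq> I"
  then obtain x where x: "x \<in> J" "x \<notin> I" using assms(2) by auto
  have xA: "x \<in> A" using x(1) j by auto
  then obtain c where c: "x - to_fract [:c:] \<in> V.\<mm>" using residue A_subset by blast
  then have "x - to_fract [:c:] \<in> I" using xA const_in_A by (simp add: I_def A.diff)
  then have "x - (x - to_fract [:c:]) \<in> J" using assms(2) x(1) j by blast
  then have cJ: "to_fract [:c:] \<in> J" by simp
  have "c \<noteq> 0"
  proof
    assume "c = 0"
    then show False using c x(2) xA by (simp add: I_def)
  qed
  then have "to_fract [:inverse c:] * to_fract [:c:] = 1" by (simp flip: to_fract_mult one_pCons)
  moreover have "to_fract [:inverse c:] * to_fract [:c:] \<in> J" using cJ j const_in_A by blast
  ultimately have one_J: "1 \<in> J" by simp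
  have "A \<subseteq> J"
  proof
    fix a assume "a \<in> A"
    then have "a * 1 \<in> J" using one_J j by blast
    then show "a \<in> J" by simp
  qed
  then show False using assms(3) j by auto
qed

lemma primeideal_I: "primeideal I (as_ring A)"
  unfolding A.primeideal_iff
proof (intro conjI ballI impI ideal_I)
  show "I \<noteq> A" using A.one V.mm_one by (auto simp: I_def)
  show "a \<in> I \<or> b \<in> I" if "a \<in> A" "b \<in> A" "a * b \<in> I" for a b
    using that V.mm_prime[of a b] A_subset by (auto simp: I_def)
qed

lemma prime_eq_I: "primeideal P (as_ring A) \<Longrightarrow> I \<subseteq> P \<Longrightarrow> P = I"
  using maximal_I by (auto simp: A.primeideal_iff)

lemma localization_I: "localization A I = V"
proof
  show "localization A I \<subseteq> V"
    using A_subset V.mm_unit by (auto simp: localization_def I_def divide_inverse intro!: V.mult)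
  show "V \<subseteq> localization A I"
  proof
    fix x assume "x \<in> V"
    then obtain a b where "a \<in> A" "b \<in> A" "b \<notin> V.\<mm>" "x = a / b" using loc by blast
    then show "x \<in> localization A I" unfolding localization_def I_def by blast
  qed
qed

text \<open>The constants map onto the residue field, whose dimension over itself is 1.\<close>

lemma prime_degree_I: "prime_degree A I = 1"
proof -
  interpret R: cring "as_ring A" by (rule A.cring_as_ring)
  interpret I: ideal I "as_ring A" by (rule ideal_I)
  let ?Q = "as_ring A Quot I"
  have "maximalideal I (as_ring A)"
  proof (rule maximalidealI[OF ideal_I])
    show "carrier (as_ring A) \<noteq> I" using primeideal_I by (auto simp: A.primeideal_iff)
  qed (use maximal_I in auto)
  then interpret Q: field ?Q using maximalideal.quotient_is_field R.cring_axioms by blast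
  have "(\<lambda>c. I +>\<^bsub>as_ring A\<^esub> c) ` const_field = carrier ?Q"
  proof
    show "(\<lambda>c. I +>\<^bsub>as_ring A\<^esub> c) ` const_field \<subseteq> carrier ?Q"
      using const_in_A by (auto simp: FactRing_def A_RCOSETS_def' const_field_eq)
    show "carrier ?Q \<subseteq> (\<lambda>c. I +>\<^bsub>as_ring A\<^esub> c) ` const_field"
    proof
      fix Y assume "Y \<in> carrier ?Q"
      then obtain x where x: "x \<in> A" "Y = I +>\<^bsub>as_ring A\<^esub> x" by (auto simp: FactRing_def A_RCOSETS_def')
      obtain c where c: "x - to_fract [:c:] \<in> V.\<mm>" using residue x A_subset by blast
      then have d: "x - to_fract [:c:] \<in> I" using x const_in_A by (auto simp: I_def intro!: A.diff)
      have "x \<in> I +>\<^bsub>as_ring A\<^esub> to_fract [:c:]"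
        unfolding a_r_coset_def' using d by (auto intro!: bexI[of _ "x - to_fract [:c:]"])
      then have "I +>\<^bsub>as_ring A\<^esub> to_fract [:c:] = Y"
        unfolding x(2) using I.a_repr_independence'[of x "to_fract [:c:]"] const_in_A by simp
      then show "Y \<in> (\<lambda>c. I +>\<^bsub>as_ring A\<^esub> c) ` const_field" by (auto simp: const_field_eq)
    qed
  qed
  moreover have "ring.dim ?Q (carrier ?Q) (carrier ?Q) = 1"
  proof -
    have "subfield (carrier ?Q) ?Q" by (rule Q.carrier_is_subfield)
    then show ?thesis
      using Q.dimension_one[of "carrier ?Q"] Q.dimI[of "carrier ?Q" 1 "carrier ?Q"] by (simp add: over_def)
  qed
  ultimately show ?thesis by (simp add: prime_degree_def)
qed

text \<open>The minimum of the valuation on S is attained and equals k. Natural k suffice since only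
  integral ideals are measured.\<close>

definition has_ord :: "'f poly fract set \<Rightarrow> nat \<Rightarrow> bool" where
  "has_ord S k \<longleftrightarrow> (\<forall>x\<in>S. x / \<pi> ^ k \<in> V) \<and> (\<exists>s\<in>S. s / \<pi> ^ k \<in> V \<and> s / \<pi> ^ k \<notin> V.\<mm>)"

lemma has_ord_localization:
  assumes "has_ord S k"
  shows "ideal_prod type_ring S V = {x. x / \<pi> ^ k \<in> V}"
proof
  show "ideal_prod type_ring S V \<subseteq> {x. x / \<pi> ^ k \<in> V}"
  proof (rule ideal_prod_subset)
    fix i j assume ij: "i \<in> S" "j \<in> V"
    then have "i / \<pi> ^ k * j \<in> V" using assms by (intro V.mult) (auto simp: has_ord_def)
    then show "i * j \<in> {x. x / \<pi> ^ k \<in> V}" by simp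
  next
    fix x y assume "x \<in> {x. x / \<pi> ^ k \<in> V}" "y \<in> {x. x / \<pi> ^ k \<in> V}"
    then show "x + y \<in> {x. x / \<pi> ^ k \<in> V}" by (auto simp: add_divide_distrib intro: V.add)
  qed
  show "{x. x / \<pi> ^ k \<in> V} \<subseteq> ideal_prod type_ring S V"
  proof
    fix x assume "x \<in> {x. x / \<pi> ^ k \<in> V}"
    then have x: "x / \<pi> ^ k \<in> V" by simp
    obtain s where s: "s \<in> S" "s / \<pi> ^ k \<in> V" "s / \<pi> ^ k \<notin> V.\<mm>" using assms by (auto simp: has_ord_def)
    have "x / \<pi> ^ k * inverse (s / \<pi> ^ k) \<in> V" by (rule V.mult[OF x V.mm_unit[OF s(2,3)]])
    then have "s * (x / \<pi> ^ k * inverse (s / \<pi> ^ k)) \<in> ideal_prod type_ring S V" by (rule ideal_prod_memI[OF s(1)])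
    moreover have "s \<noteq> 0" using s(3) V.mm_zero by auto
    then have "s * (x / \<pi> ^ k * inverse (s / \<pi> ^ k)) = x" using pi_nonzero by (simp add: field_simps)
    ultimately show "x \<in> ideal_prod type_ring S V" by simp
  qed
qed

text \<open>A product of elements attaining the two minima attains the sum, because the maximal
  ideal is prime.\<close>

lemma has_ord_prod:
  assumes "has_ord S k" "has_ord T l"
  shows "has_ord (ideal_prod type_ring S T) (k + l)"
  unfolding has_ord_def
proof (intro conjI ballI)
  have "ideal_prod type_ring S T \<subseteq> {x. x / \<pi> ^ (k + l) \<in> V}"
  proof (rule ideal_prod_subset)
    fix i j assume ij: "i \<in> S" "j \<in> T"
    then have "i / \<pi> ^ k * (j / \<pi> ^ l) \<in> V" using assms by (auto simp: has_ord_def simp del: times_divide_eq_right times_divide_eq_left intro!: V.mult)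
    then show "i * j \<in> {x. x / \<pi> ^ (k + l) \<in> V}" by (simp add: power_add)
  next
    fix x y assume "x \<in> {x. x / \<pi> ^ (k + l) \<in> V}" "y \<in> {x. x / \<pi> ^ (k + l) \<in> V}"
    then show "x + y \<in> {x. x / \<pi> ^ (k + l) \<in> V}" by (auto simp: add_divide_distrib intro: V.add)
  qed
  then show "x / \<pi> ^ (k + l) \<in> V" if "x \<in> ideal_prod type_ring S T" for x using that by auto
  obtain s where s: "s \<in> S" "s / \<pi> ^ k \<in> V" "s / \<pi> ^ k \<notin> V.\<mm>" using assms by (auto simp: has_ord_def)
  obtain t where t: "t \<in> T" "t / \<pi> ^ l \<in> V" "t / \<pi> ^ l \<notin> V.\<mm>" using assms by (auto simp: has_ord_def)
  have eq: "(s * t) / \<pi> ^ (k + l) = (s / \<pi> ^ k) * (t / \<pi> ^ l)" by (simp add: power_add)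
  have "(s * t) / \<pi> ^ (k + l) \<in> V" "(s * t) / \<pi> ^ (k + l) \<notin> V.\<mm>"
    unfolding eq using s t V.mm_prime[of "s / \<pi> ^ k" "t / \<pi> ^ l"] V.mult by blast+
  then show "\<exists>s\<in>ideal_prod type_ring S T. s / \<pi> ^ (k + l) \<in> V \<and> s / \<pi> ^ (k + l) \<notin> V.\<mm>"
    using ideal_prod_memI[OF s(1) t(1)] by blast
qed

lemma has_ord_A: "has_ord A 0"
  unfolding has_ord_def using A_subset A.one V.one V.mm_one by auto

lemma has_ord_I: "has_ord I 1"
  unfolding has_ord_def
proof (intro conjI ballI)
  show "x / \<pi> ^ 1 \<in> V" if "x \<in> I" for x using that unif by (auto simp: I_def)
  obtain a b where ab: "a \<in> I" "b \<in> A" "b \<notin> V.\<mm>" "\<pi> = a / b" by (rule pi_frac)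
  then have "b \<noteq> 0" "a \<noteq> 0" using V.mm_zero pi_nonzero by auto
  then have eq: "a / \<pi> ^ 1 = b" using ab by simp
  show "\<exists>s\<in>I. s / \<pi> ^ 1 \<in> V \<and> s / \<pi> ^ 1 \<notin> V.\<mm>"
    by (rule bexI[OF _ ab(1)]) (unfold eq, use ab A_subset in auto)
qed

lemma has_ord_I_power: "has_ord (I [^]\<^bsub>ideal_group A\<^esub> (n::nat)) n"
proof (induction n)
  case (Suc n)
  then show ?case using has_ord_prod[OF Suc has_ord_I] by (simp add: ideal_group_mult)
qed (simp add: ideal_group_one has_ord_A)

text \<open>Equality for k < l would place \<pi>^k / \<pi>^l in V and thus 1 in the maximal ideal.
  This is the uniqueness behind \<open>ideal_ord\<close>.\<close>

lemma pi_power_ideal_inj: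
  assumes "{x. x / \<pi> ^ k \<in> V} = {x. x / \<pi> ^ l \<in> V}"
  shows "k = l"
proof -
  have *: False if kl: "k < l" "{x. x / \<pi> ^ k \<in> V} = {x. x / \<pi> ^ l \<in> V}" for k l
  proof -
    have "\<pi> ^ k / \<pi> ^ k \<in> V" using pi_nonzero V.one by simp
    then have v: "\<pi> ^ k / \<pi> ^ l \<in> V" using kl(2) by blast
    obtain d where d: "l = k + Suc d" using less_imp_Suc_add[OF kl(1)] by auto
    have mem: "\<pi> ^ k / \<pi> ^ l * \<pi> ^ d * \<pi> \<in> V.\<mm>" by (intro V.mm_mult pi_mem V.mult v V.power V.mm_subset)
    have eq: "\<pi> ^ k / \<pi> ^ l * \<pi> ^ d * \<pi> = 1" using pi_nonzero by (simp add: d power_add)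
    show False using mem V.mm_one unfolding eq by blast
  qed
  show ?thesis using *[of k l] *[of l k] assms by (metis linorder_neqE_nat)
qed

text \<open>After localization both sides are ideals generated by powers of \<pi>, so the defining
  equation reads k + max(-n, 0) = max(n, 0).\<close>

lemma ideal_ord_eq:
  assumes "has_ord S k"
  shows "ideal_ord A I S = int k"
proof -
  have l: "ideal_prod type_ring (ideal_prod type_ring S (I [^]\<^bsub>ideal_group A\<^esub> m)) V = {x. x / \<pi> ^ (k + m) \<in> V}" for m :: nat
    by (rule has_ord_localization[OF has_ord_prod[OF assms has_ord_I_power]])
  have r: "ideal_prod type_ring (I [^]\<^bsub>ideal_group A\<^esub> m) V = {x. x / \<pi> ^ m \<in> V}" for m :: nat
    by (rule has_ord_localization[OF has_ord_I_power])
  show ?thesis unfolding ideal_ord_def ideal_group_mult localization_I l r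
  proof (rule the_equality)
    fix n :: int assume "{x. x / \<pi> ^ (k + nat (- n)) \<in> V} = {x. x / \<pi> ^ nat n \<in> V}"
    then have "k + nat (- n) = nat n" by (rule pi_power_ideal_inj)
    then show "n = int k" by linarith
  qed simp
qed

end

section \<open>The places at infinity and at zero\<close>

context regular_functions
begin

abbreviation "val_ring_0 \<equiv> val_ring_at [:0, 1 :: 'f:]"

lemma irreducible_X: "irreducible [:0, 1 :: 'f:]"
  by (rule irreducible_linear_field_poly) simp

sublocale Vinf: valuation_set "val_ring_inf :: 'f poly fract set" UNIV
  by (rule valuation_ringsD(1)[OF val_ring_inf subfield_set_UNIV])

sublocale V0: valuation_set val_ring_0 UNIV
  by (rule valuation_ringsD(1)[OF val_ring_at[OF irreducible_X] subfield_set_UNIV])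

lemma mm_inf_iff:
  assumes "b \<noteq> 0"
  shows "to_fract a / to_fract b \<in> Vinf.\<mm> \<longleftrightarrow> a = 0 \<or> degree a < degree b"
proof (cases "a = 0")
  case False
  have "inverse (to_fract a / to_fract b) = to_fract b / to_fract a" by simp
  then show ?thesis using val_ring_inf_iff[OF assms, of a] val_ring_inf_iff[OF False, of b] False assms
    by (auto simp: place_ideal_def)
qed (simp add: Vinf.mm_zero)

lemma X_dvd_iff: "[:0, 1:] dvd b \<longleftrightarrow> poly (b :: 'f poly) 0 = 0"
  using poly_eq_0_iff_dvd[of b 0] by simp

lemma val_ring_0_I: "poly b 0 \<noteq> 0 \<Longrightarrow> to_fract a / to_fract b \<in> val_ring_0"
  unfolding val_ring_at_iff X_dvd_iff by blast

lemma val_ring_0_E: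
  assumes "x \<in> val_ring_0"
  obtains a b where "x = to_fract a / to_fract b" "poly b 0 \<noteq> 0"
  using assms unfolding val_ring_at_iff X_dvd_iff by blast

lemma mm_0_iff:
  assumes "poly b 0 \<noteq> 0"
  shows "to_fract a / to_fract b \<in> V0.\<mm> \<longleftrightarrow> poly a 0 = 0"
proof (cases "a = 0")
  case False
  have b: "b \<noteq> 0" using assms by auto
  have "inverse (to_fract a / to_fract b) \<in> val_ring_0 \<longleftrightarrow> poly a 0 \<noteq> 0"
  proof
    assume "inverse (to_fract a / to_fract b) \<in> val_ring_0"
    then obtain c d where cd: "inverse (to_fract a / to_fract b) = to_fract c / to_fract d" "poly d 0 \<noteq> 0"
      by (rule val_ring_0_E)
    then have "d \<noteq> 0" by auto
    then have "to_fract (b * d) = to_fract (c * a)" using cd(1) False b by (simp add: field_simps)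
    then have "b * d = c * a" by (simp only: to_fract_eq_iff)
    then show "poly a 0 \<noteq> 0" using assms cd(2) by (metis mult_eq_0_iff poly_mult)
  next
    assume "poly a 0 \<noteq> 0"
    then show "inverse (to_fract a / to_fract b) \<in> val_ring_0" using val_ring_0_I[of a b] by simp
  qed
  then show ?thesis using val_ring_0_I[OF assms, of a] False b by (auto simp: place_ideal_def)
qed (simp add: V0.mm_zero)

lemma A_E:
  assumes "x \<in> A"
  obtains a k where "x = to_fract a / rF ^ k" "degree a \<le> k * N"
  using assms by (auto simp: A_def)

lemma A_subset_inf: "A \<subseteq> val_ring_inf"
proof
  fix x assume "x \<in> A"
  then obtain a k where "x = to_fract a / rF ^ k" "degree a \<le> k * N" by (auto simp: A_def)
  then show "x \<in> val_ring_inf" using val_ring_inf_iff[of "\<rho> ^ k" a]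
    by (simp add: to_fract_power rho_nonzero degree_rho_power)
qed

lemma A_subset_0: "A \<subseteq> val_ring_0"
proof
  fix x assume "x \<in> A"
  then obtain a k where "x = to_fract a / rF ^ k" by (auto simp: A_def)
  then show "x \<in> val_ring_0" using val_ring_0_I[of "\<rho> ^ k" a] rho_0
    by (simp add: to_fract_power)
qed

sublocale inf: degree_one_place A val_ring_inf "inverse tF"
proof
  show "A \<subseteq> val_ring_inf" by (rule A_subset_inf)
  show "to_fract [:c:] \<in> A" for c by (rule const_in_A)
  show "inverse tF \<in> Vinf.\<mm>" using mm_inf_iff[of "[:0,1:]" 1] by (simp add: divide_inverse)
  show "inverse tF \<noteq> (0 :: 'f poly fract)" by simp
  show "x / inverse tF \<in> val_ring_inf" if x: "x \<in> Vinf.\<mm>" for x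
  proof -
    obtain a b where ab: "x = to_fract a / to_fract b" "b \<noteq> 0"
      using Vinf.mm_subset[OF x] by (auto simp: val_ring_inf_def)
    have "x / inverse tF = to_fract (a * [:0, 1:]) / to_fract b"
      by (simp add: ab divide_inverse mult_ac del: mult_pCons_right)
    moreover have "a = 0 \<or> degree (a * [:0, 1:]) = degree a + 1"
      using degree_mult_eq[of a "[:0, 1:]"] by (auto simp del: mult_pCons_right)
    ultimately show ?thesis using mm_inf_iff[OF ab(2), of a] x ab val_ring_inf_iff[OF ab(2), of "a * [:0, 1:]"] by auto
  qed
  show "\<exists>c. x - to_fract [:c:] \<in> Vinf.\<mm>" if x: "x \<in> val_ring_inf" for x
  proof -
    obtain a b where ab: "x = to_fract a / to_fract b" "b \<noteq> 0" "degree a \<le> degree b"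
      using x by (auto simp: val_ring_inf_def)
    \<comment> \<open>The value at infinity. Reading the numerator at the degree of the denominator
      gives 0 when the fraction vanishes there.\<close>
    define c where "c = coeff a (degree b) / lead_coeff b"
    have "x - to_fract [:c:] = to_fract (a - [:c:] * b) / to_fract b"
      using ab by (simp only: to_fract_diff to_fract_mult) (simp add: diff_divide_distrib)
    moreover have "degree (a - [:c:] * b) \<le> degree b" using ab by (intro degree_diff_le) auto
    moreover have "coeff (a - [:c:] * b) (degree b) = 0" using ab by (simp add: c_def)
    ultimately have "x - to_fract [:c:] \<in> Vinf.\<mm>" using mm_inf_iff[OF ab(2)] eq_zero_or_degree_less by metis
    then show ?thesis ..
  qed
  show "\<exists>a\<in>A. \<exists>b\<in>A. b \<notin> Vinf.\<mm> \<and> x = a / b" if x: "x \<in> val_ring_inf" for x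
  proof -
    obtain a b where ab: "x = to_fract a / to_fract b" "b \<noteq> 0" "degree a \<le> degree b"
      using x by (auto simp: val_ring_inf_def)
    define k where "k = degree b"
    \<comment> \<open>Filling the denominator up to degree exactly kN makes it, divided by \<rho>^k,
      a unit at infinity.\<close>
    define c where "c = monom (1::'f) (k * N - degree b)"
    have kN: "degree b \<le> k * N" using N_ge_2 by (simp add: k_def)
    have c: "c \<noteq> 0" "degree c = k * N - degree b" by (auto simp: c_def degree_monom_eq)
    have "degree (a * c) \<le> k * N" using ab kN c by (intro order_trans[OF degree_mult_le]) simp
    moreover have d: "degree (b * c) = k * N" using ab c kN by (simp add: degree_mult_eq)
    moreover have "to_fract (b * c) / rF ^ k \<notin> Vinf.\<mm>"
      using mm_inf_iff[of "\<rho> ^ k" "b * c"] ab c d rho_nonzero by (simp add: degree_rho_power to_fract_power)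
    moreover have "x = (to_fract (a * c) / rF ^ k) / (to_fract (b * c) / rF ^ k)" using c rF_nonzero ab by simp
    ultimately show ?thesis using A_I by (metis order_refl)
  qed
  show "\<exists>n. inverse tF ^ n * x \<in> val_ring_inf" for x :: "'f poly fract"
  proof -
    obtain a b where ab: "x = to_fract a / to_fract b" "b \<noteq> 0" by (cases x) (auto simp: Fract_conv_to_fract)
    have "inverse tF ^ degree a * x = to_fract a / to_fract (b * [:0, 1:] ^ degree a)"
      by (simp add: ab to_fract_power power_inverse divide_inverse mult_ac del: mult_pCons_right)
    moreover have "degree (b * [:0, 1:] ^ degree a) = degree b + degree a"
      using ab by (simp add: degree_mult_eq degree_power_eq)
    ultimately have "inverse tF ^ degree a * x \<in> val_ring_inf"
      using val_ring_inf_iff[of "b * [:0, 1:] ^ degree a" a] ab by simp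
    then show ?thesis ..
  qed
qed

sublocale zero: degree_one_place A val_ring_0 tF
proof
  show "A \<subseteq> val_ring_0" by (rule A_subset_0)
  show "to_fract [:c:] \<in> A" for c by (rule const_in_A)
  show "tF \<in> V0.\<mm>" using mm_0_iff[of 1 "[:0,1:]"] by simp
  show "tF \<noteq> (0 :: 'f poly fract)" by simp
  show "x / tF \<in> val_ring_0" if x: "x \<in> V0.\<mm>" for x
  proof -
    obtain a b where ab: "x = to_fract a / to_fract b" "poly b 0 \<noteq> 0"
      using V0.mm_subset[OF x] by (rule val_ring_0_E)
    then have "[:0, 1:] dvd a" using x mm_0_iff[OF ab(2)] X_dvd_iff by simp
    then obtain a' where "a = [:0, 1:] * a'" by (rule dvdE)
    then have "x / tF = to_fract a' / to_fract b" by (simp add: ab del: mult_pCons_left)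
    then show ?thesis using val_ring_0_I[OF ab(2)] by simp
  qed
  show "\<exists>c. x - to_fract [:c:] \<in> V0.\<mm>" if x: "x \<in> val_ring_0" for x
  proof -
    obtain a b where ab: "x = to_fract a / to_fract b" "poly b 0 \<noteq> 0" using x by (rule val_ring_0_E)
    define c where "c = poly a 0 / poly b 0"
    have "b \<noteq> 0" using ab by auto
    then have "x - to_fract [:c:] = to_fract (a - [:c:] * b) / to_fract b"
      using ab by (simp only: to_fract_diff to_fract_mult) (simp add: diff_divide_distrib)
    moreover have "poly (a - [:c:] * b) 0 = 0" using ab by (simp add: c_def)
    ultimately have "x - to_fract [:c:] \<in> V0.\<mm>" using mm_0_iff[OF ab(2)] by metis
    then show ?thesis ..
  qed
  show "\<exists>a\<in>A. \<exists>b\<in>A. b \<notin> V0.\<mm> \<and> x = a / b" if x: "x \<in> val_ring_0" for x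
  proof -
    obtain a b where ab: "x = to_fract a / to_fract b" "poly b 0 \<noteq> 0" using x by (rule val_ring_0_E)
    define k where "k = degree a + degree b"
    have "k \<le> k * N" using N_ge_2 by simp
    moreover have "degree a \<le> k" "degree b \<le> k" by (simp_all add: k_def)
    ultimately have kN: "degree a \<le> k * N" "degree b \<le> k * N" by linarith+
    have "to_fract b / rF ^ k \<notin> V0.\<mm>"
      using mm_0_iff[of "\<rho> ^ k" b] ab rho_0 by (simp add: to_fract_power)
    moreover have "x = (to_fract a / rF ^ k) / (to_fract b / rF ^ k)" using rF_nonzero ab by simp
    ultimately show ?thesis using A_I[OF kN(1)] A_I[OF kN(2)] by blast
  qed
  show "\<exists>n. tF ^ n * x \<in> val_ring_0" for x :: "'f poly fract"
  proof -
    obtain a b where ab: "x = to_fract a / to_fract b" "b \<noteq> 0" by (cases x) (auto simp: Fract_conv_to_fract)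
    obtain b' where b': "b = [:- 0, 1:] ^ order 0 b * b'" "\<not> [:- 0, 1:] dvd b'" using order_decomp[OF ab(2)] by blast
    then have "poly b' 0 \<noteq> 0" using X_dvd_iff[of b'] by simp
    moreover have "tF ^ order 0 b * x = to_fract a / to_fract b'"
    proof -
      have "to_fract b = tF ^ order 0 b * to_fract b'" using b'(1) by (metis minus_zero to_fract_mult to_fract_power)
      then show ?thesis by (simp add: ab)
    qed
    ultimately have "tF ^ order 0 b * x \<in> val_ring_0" using val_ring_0_I by metis
    then show ?thesis ..
  qed
qed

section \<open>Generators of the two primes and the divisor of T_i\<close>

lemma genideal_eqI:
  assumes "ideal J (as_ring A)" "S \<subseteq> J" "\<And>J'. ideal J' (as_ring A) \<Longrightarrow> S \<subseteq> J' \<Longrightarrow> J \<subseteq> J'"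
  shows "Idl\<^bsub>as_ring A\<^esub> S = J"
  using assms unfolding genideal_def by blast

lemma ideal_sum:
  assumes "ideal J (as_ring A)" "\<And>i. i \<in> T \<Longrightarrow> g i \<in> J"
  shows "sum g T \<in> J"
proof -
  note j = assms(1)[unfolded A.ideal_iff]
  have "x + y \<in> J" if "x \<in> J" "y \<in> J" for x y
    using j that by (metis (no_types, opaque_lifting) diff_0 diff_minus_eq_add)
  then show ?thesis using assms(2) j by (induction T rule: infinite_finite_induct) auto
qed

lemma expand_fraction: "to_fract a / rF ^ k = (\<Sum>i\<le>degree a. to_fract [:coeff a i:] * (tF ^ i / rF ^ k))"
  by (subst to_fract_expand) (simp add: sum_divide_distrib)

text \<open>Vanishing at infinity makes the degree of the numerator strictly less than kN, and each
  t^i/\<rho>^k with i < kN has one of T_0, ..., T_(N-1) as a factor.\<close>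

lemma I_inf_eq: "I_inf \<rho> = inf.I"
  unfolding I_inf_def ring_A_eq degree_rho
proof (rule genideal_eqI[OF inf.ideal_I])
  show "T_fun \<rho> ` {0..<N} \<subseteq> inf.I"
  proof clarify
    fix i assume i: "i \<in> {0..<N}"
    have "to_fract (monom 1 i) / to_fract \<rho> \<in> Vinf.\<mm>"
      using mm_inf_iff[OF rho_nonzero, of "monom 1 i"] i by (simp add: degree_monom_eq degree_rho)
    then have "T_fun \<rho> i \<in> Vinf.\<mm>" by (simp add: T_eq to_fract_monom flip: one_pCons)
    then show "T_fun \<rho> i \<in> inf.I" using T_in_A i by (simp add: inf.I_def)
  qed
  fix J assume J: "ideal J (as_ring A)" "T_fun \<rho> ` {0..<N} \<subseteq> J"
  note j = J(1)[unfolded A.ideal_iff]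
  have mon: "i < k * N \<Longrightarrow> tF ^ i / rF ^ k \<in> J" for i k
  proof (induction k arbitrary: i)
    case (Suc k)
    show ?case
    proof (cases "i < N")
      case True
      have "tF ^ i / rF ^ Suc k = (tF ^ 0 / rF ^ k) * T_fun \<rho> i" by (simp add: T_eq)
      moreover have "tF ^ 0 / rF ^ k \<in> A" by (rule T_monomial[OF A.subring_set_axioms T_in_A]) auto
      moreover have "T_fun \<rho> i \<in> J" using J(2) True by auto
      ultimately show ?thesis using j by metis
    next
      case False
      have "tF ^ i / rF ^ Suc k = T_fun \<rho> N * (tF ^ (i - N) / rF ^ k)"
        using False by (simp add: T_eq flip: power_add)
      moreover have "T_fun \<rho> N \<in> A" using T_in_A by simp
      moreover have "tF ^ (i - N) / rF ^ k \<in> J" using Suc False by simp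
      ultimately show ?thesis using j by metis
    qed
  qed simp
  show "inf.I \<subseteq> J"
  proof
    fix x assume x: "x \<in> inf.I"
    then obtain a k where a: "x = to_fract a / rF ^ k" "degree a \<le> k * N" by (metis inf.I_def IntD1 A_E)
    have "a = 0 \<or> degree a < k * N"
      using x mm_inf_iff[of "\<rho> ^ k" a] a rho_nonzero by (simp add: inf.I_def to_fract_power degree_rho_power)
    then show "x \<in> J"
    proof
      assume "a = 0" then show ?thesis using a j by simp
    next
      assume "degree a < k * N"
      show ?thesis unfolding a(1) expand_fraction
      proof (rule ideal_sum[OF J(1)])
        fix i assume "i \<in> {..degree a}"
        then have "tF ^ i / rF ^ k \<in> J" using \<open>degree a < k * N\<close> by (intro mon) simp
        then show "to_fract [:coeff a i:] * (tF ^ i / rF ^ k) \<in> J" using j const_in_A by blast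
      qed
    qed
  qed
qed

text \<open>Vanishing at zero makes the numerator divisible by t, and each t^i/\<rho>^k with 0 < i
  \<le> kN has one of T_1, ..., T_N as a factor. The last of these is not a listed generator and has
  to be recovered.\<close>

lemma I_zero_eq: "I_zero \<rho> = zero.I"
  unfolding I_zero_def ring_A_eq degree_rho
proof (rule genideal_eqI[OF zero.ideal_I])
  have T0: "T_fun \<rho> 0 - to_fract [:1 / poly \<rho> 0:] \<in> V0.\<mm>"
  proof -
    have "T_fun \<rho> 0 - to_fract [:1 / poly \<rho> 0:] = to_fract (1 - [:1 / poly \<rho> 0:] * \<rho>) / to_fract \<rho>"
      using rho_nonzero by (simp only: to_fract_diff to_fract_mult T_eq) (simp add: diff_divide_distrib)
    then show ?thesis using mm_0_iff[OF rho_0, of "1 - [:1 / poly \<rho> 0:] * \<rho>"] rho_0 by simp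
  qed
  show "insert (T_fun \<rho> 0 - to_fract [:1 / poly \<rho> 0:]) (T_fun \<rho> ` {1..<N}) \<subseteq> zero.I"
  proof -
    have "T_fun \<rho> i \<in> zero.I" if i: "i \<in> {1..<N}" for i
    proof -
      have "to_fract (monom 1 i) / to_fract \<rho> \<in> V0.\<mm>"
        using mm_0_iff[OF rho_0, of "monom 1 i"] i by (simp add: poly_monom)
      then have "T_fun \<rho> i \<in> V0.\<mm>" by (simp add: T_eq to_fract_monom flip: one_pCons)
      then show ?thesis using T_in_A i by (simp add: zero.I_def)
    qed
    then show ?thesis using T0 T_in_A[of 0] const_in_A by (auto simp: zero.I_def intro!: A.diff)
  qed
  fix J assume J: "ideal J (as_ring A)" "insert (T_fun \<rho> 0 - to_fract [:1 / poly \<rho> 0:]) (T_fun \<rho> ` {1..<N}) \<subseteq> J"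
  note j = J(1)[unfolded A.ideal_iff]
  have Ti: "T_fun \<rho> i \<in> J" if "i \<in> {1..<N}" for i using J(2) that by auto
  \<comment> \<open>Dividing \<rho> by itself expresses 1 through T_0, ..., T_N with the
    coefficients of \<rho>; \<rho> is monic, and the 1 is absorbed into T_0 - 1/\<rho>(0).\<close>
  have TN: "T_fun \<rho> N \<in> J"
  proof -
    have "rF = (\<Sum>i\<le>N. to_fract [:coeff \<rho> i:] * tF ^ i)" by (subst to_fract_expand) (simp add: degree_rho)
    also have "\<dots> = (\<Sum>i<N. to_fract [:coeff \<rho> i:] * tF ^ i) + tF ^ N"
      using lead_coeff_rho degree_rho by (simp flip: lessThan_Suc_atMost one_pCons)
    finally have "1 = ((\<Sum>i<N. to_fract [:coeff \<rho> i:] * tF ^ i) + tF ^ N) / rF" using rF_nonzero by simp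
    also have "\<dots> = (\<Sum>i<N. to_fract [:coeff \<rho> i:] * T_fun \<rho> i) + T_fun \<rho> N"
      by (simp add: T_eq add_divide_distrib sum_divide_distrib)
    also have "{..<N} = insert 0 {1..<N}" using N_ge_2 by auto
    finally have "T_fun \<rho> N = 1 - to_fract [:coeff \<rho> 0:] * T_fun \<rho> 0 - (\<Sum>i\<in>{1..<N}. to_fract [:coeff \<rho> i:] * T_fun \<rho> i)"
      by (simp add: algebra_simps)
    moreover have "to_fract [:coeff \<rho> 0:] * to_fract [:1 / poly \<rho> 0:] = 1"
      using rho_0 by (simp add: poly_0_coeff_0 flip: to_fract_mult one_pCons)
    ultimately have eq: "T_fun \<rho> N = 0 - to_fract [:coeff \<rho> 0:] * (T_fun \<rho> 0 - to_fract [:1 / poly \<rho> 0:])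
        - (\<Sum>i\<in>{1..<N}. to_fract [:coeff \<rho> i:] * T_fun \<rho> i)"
      by (simp add: right_diff_distrib)
    have sumJ: "(\<Sum>i\<in>{1..<N}. to_fract [:coeff \<rho> i:] * T_fun \<rho> i) \<in> J"
      by (rule ideal_sum[OF J(1)]) (use Ti j const_in_A in auto)
    have "to_fract [:coeff \<rho> 0:] * (T_fun \<rho> 0 - to_fract [:1 / poly \<rho> 0:]) \<in> J"
      using J(2) j const_in_A by blast
    then have "0 - to_fract [:coeff \<rho> 0:] * (T_fun \<rho> 0 - to_fract [:1 / poly \<rho> 0:]) \<in> J"
      using j by blast
    then show ?thesis unfolding eq using j sumJ by blast
  qed
  have mon: "0 < i \<Longrightarrow> i \<le> k * N \<Longrightarrow> tF ^ i / rF ^ k \<in> J" for i k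
  proof (cases k)
    case (Suc l)
    assume i: "0 < i" "i \<le> k * N"
    define m where "m = min i N"
    have "tF ^ i / rF ^ k = (tF ^ (i - m) / rF ^ l) * T_fun \<rho> m" by (simp add: Suc T_eq m_def flip: power_add)
    moreover have "tF ^ (i - m) / rF ^ l \<in> A"
      by (rule T_monomial[OF A.subring_set_axioms T_in_A]) (use i Suc in \<open>auto simp: m_def\<close>)
    moreover have "T_fun \<rho> m \<in> J" using J(2) TN i by (cases "i < N") (auto simp: m_def)
    ultimately show ?thesis using j by metis
  qed simp
  show "zero.I \<subseteq> J"
  proof
    fix x assume x: "x \<in> zero.I"
    then obtain a k where a: "x = to_fract a / rF ^ k" "degree a \<le> k * N" by (metis zero.I_def IntD1 A_E)
    have "poly a 0 = 0"
      using x mm_0_iff[of "\<rho> ^ k" a] a rho_0 by (simp add: zero.I_def to_fract_power)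
    then have c0: "coeff a 0 = 0" by (simp add: poly_0_coeff_0)
    show "x \<in> J" unfolding a(1) expand_fraction
    proof (rule ideal_sum[OF J(1)])
      fix i assume i: "i \<in> {..degree a}"
      show "to_fract [:coeff a i:] * (tF ^ i / rF ^ k) \<in> J"
      proof (cases "i = 0")
        case True
        then show ?thesis using c0 j by simp
      next
        case False
        then have "tF ^ i / rF ^ k \<in> J" using i a(2) by (intro mon) auto
        then show ?thesis using j const_in_A by blast
      qed
    qed
  qed
qed

lemma I_inf_neq_zero: "inf.I \<noteq> zero.I"
proof
  assume "inf.I = zero.I"
  moreover have "T_fun \<rho> 0 \<in> inf.I"
    unfolding I_inf_eq[symmetric] I_inf_def genideal_def degree_rho using N_ge_2 by auto
  moreover have "T_fun \<rho> 0 \<notin> V0.\<mm>"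
    using mm_0_iff[OF rho_0, of 1] by (simp add: T_eq)
  ultimately show False by (simp add: zero.I_def)
qed

text \<open>Dividing T_i by (1/t)^(N-i) leaves t^N/\<rho>, a unit at infinity; dividing it by t^i
  leaves 1/\<rho>, a unit at zero.\<close>

lemma principal_T:
  assumes "i \<le> N"
  shows "ideal (PIdl\<^bsub>as_ring A\<^esub> (T_fun \<rho> i)) (as_ring A)" "PIdl\<^bsub>as_ring A\<^esub> (T_fun \<rho> i) \<noteq> {0}"
    "T_fun \<rho> i \<in> PIdl\<^bsub>as_ring A\<^esub> (T_fun \<rho> i)"
    "inf.has_ord (PIdl\<^bsub>as_ring A\<^esub> (T_fun \<rho> i)) (N - i)" "zero.has_ord (PIdl\<^bsub>as_ring A\<^esub> (T_fun \<rho> i)) i"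
proof -
  interpret R: cring "as_ring A" by (rule A.cring_as_ring)
  have P: "PIdl\<^bsub>as_ring A\<^esub> (T_fun \<rho> i) = {a * T_fun \<rho> i | a. a \<in> A}" by (simp add: cgenideal_def)
  show "ideal (PIdl\<^bsub>as_ring A\<^esub> (T_fun \<rho> i)) (as_ring A)"
    by (rule R.cgenideal_ideal) (use T_in_A assms in simp)
  show m: "T_fun \<rho> i \<in> PIdl\<^bsub>as_ring A\<^esub> (T_fun \<rho> i)" unfolding P using A.one by force
  moreover have "T_fun \<rho> i \<noteq> 0" using rF_nonzero by (simp add: T_eq)
  ultimately show "PIdl\<^bsub>as_ring A\<^esub> (T_fun \<rho> i) \<noteq> {0}" by auto
  have "T_fun \<rho> i / inverse tF ^ (N - i) = to_fract (monom 1 N) / to_fract \<rho>"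
    using assms by (simp add: T_eq to_fract_monom power_inverse divide_inverse mult_ac flip: one_pCons power_add)
  then have u: "T_fun \<rho> i / inverse tF ^ (N - i) \<in> val_ring_inf" "T_fun \<rho> i / inverse tF ^ (N - i) \<notin> Vinf.\<mm>"
    using val_ring_inf_iff[OF rho_nonzero, of "monom 1 N"] mm_inf_iff[OF rho_nonzero, of "monom 1 N"]
    by (auto simp: degree_rho degree_monom_eq)
  show "inf.has_ord (PIdl\<^bsub>as_ring A\<^esub> (T_fun \<rho> i)) (N - i)"
    unfolding inf.has_ord_def
  proof (intro conjI ballI bexI[OF _ m] u)
    fix x assume "x \<in> PIdl\<^bsub>as_ring A\<^esub> (T_fun \<rho> i)"
    then obtain a where "a \<in> A" "x = a * T_fun \<rho> i" unfolding P by blast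
    then show "x / inverse tF ^ (N - i) \<in> val_ring_inf"
      using Vinf.mult[OF _ u(1), of a] A_subset_inf by auto
  qed
  have "T_fun \<rho> i / tF ^ i = to_fract 1 / to_fract \<rho>" by (simp add: T_eq)
  then have v: "T_fun \<rho> i / tF ^ i \<in> val_ring_0" "T_fun \<rho> i / tF ^ i \<notin> V0.\<mm>"
    using val_ring_0_I[OF rho_0, of 1] mm_0_iff[OF rho_0, of 1] by auto
  show "zero.has_ord (PIdl\<^bsub>as_ring A\<^esub> (T_fun \<rho> i)) i"
    unfolding zero.has_ord_def
  proof (intro conjI ballI bexI[OF _ m] v)
    fix x assume "x \<in> PIdl\<^bsub>as_ring A\<^esub> (T_fun \<rho> i)"
    then obtain a where "a \<in> A" "x = a * T_fun \<rho> i" unfolding P by blast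
    then show "x / tF ^ i \<in> val_ring_0"
      using V0.mult[OF _ v(1), of a] A_subset_0 by auto
  qed
qed

text \<open>For x in the prime at infinity and y in the prime at zero, T_i divides x^(N-i) y^i in A.
  A prime containing T_i thus contains x or y for every such pair, and both primes are
  maximal.\<close>

lemma prime_containing_T:
  assumes P: "primeideal P (as_ring A)" and i: "i \<le> N" and T: "T_fun \<rho> i \<in> P"
  shows "P = inf.I \<or> P = zero.I"
proof (rule ccontr)
  assume "\<not> ?thesis"
  then have "\<not> inf.I \<subseteq> P" "\<not> zero.I \<subseteq> P" using inf.prime_eq_I[OF P] zero.prime_eq_I[OF P] by blast+
  then obtain x y where xy: "x \<in> inf.I" "x \<notin> P" "y \<in> zero.I" "y \<notin> P" by blast
  obtain a k where a: "x = to_fract a / rF ^ k" "degree a \<le> k * N" using xy(1) by (metis inf.I_def IntD1 A_E)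
  obtain b l where b: "y = to_fract b / rF ^ l" "degree b \<le> l * N" using xy(3) by (metis zero.I_def IntD1 A_E)
  have xA: "x \<in> A" "y \<in> A" using xy by (auto simp: inf.I_def zero.I_def)
  have "0 \<in> P" using P by (auto simp: A.primeideal_iff A.ideal_iff)
  then have nz: "a \<noteq> 0" "b \<noteq> 0" using xy a b by auto
  have da: "degree a < k * N"
    using xy(1) mm_inf_iff[of "\<rho> ^ k" a] a rho_nonzero nz by (simp add: inf.I_def to_fract_power degree_rho_power)
  have "poly b 0 = 0" using xy(3) mm_0_iff[of "\<rho> ^ l" b] b rho_0 by (simp add: zero.I_def to_fract_power)
  then have "[:0, 1:] dvd b" by (simp add: X_dvd_iff)
  then obtain c where c: "b = [:0, 1:] * c" by (rule dvdE)
  have c0: "c \<noteq> 0" using nz c by auto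
  then have dc: "degree c + 1 = degree b" unfolding c by (simp add: degree_mult_eq del: mult_pCons_left)
  \<comment> \<open>The cofactor of T_i in x^(N-i) y^i: \<rho> cancels the denominator of T_i, and
    each b has given up one factor t.\<close>
  define z where "z = to_fract (a ^ (N - i) * c ^ i * \<rho>) / rF ^ (k * (N - i) + l * i)"
  have "degree (a ^ (N - i) * c ^ i * \<rho>) = (N - i) * degree a + i * degree c + N"
    using nz c0 rho_nonzero by (simp add: degree_mult_eq degree_power_eq degree_rho)
  also have "\<dots> \<le> (k * (N - i) + l * i) * N"
  proof -
    have "(N - i) * Suc (degree a) \<le> (N - i) * (k * N)" by (rule mult_le_mono2) (use da in simp)
    moreover have "i * Suc (degree c) \<le> i * (l * N)" by (rule mult_le_mono2) (use dc b(2) in simp)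
    \<comment> \<open>Each of the n factors a and the i factors c falls short of its degree bound by
      at least one, which leaves n + i = N degrees for \<rho>.\<close>
    moreover define n where "n = N - i"
    moreover have "N = n + i" using i by (simp add: n_def)
    then have "n * degree a + i * degree c + N = n * Suc (degree a) + i * Suc (degree c)" by simp
    moreover have "(k * n + l * i) * N = n * (k * N) + i * (l * N)" by (simp add: algebra_simps)
    ultimately show ?thesis by (metis add_mono)
  qed
  finally have "z \<in> A" unfolding z_def by (rule A_I)
  then have "z * T_fun \<rho> i \<in> P" using T P by (auto simp: A.primeideal_iff A.ideal_iff)
  moreover have "z * T_fun \<rho> i = x ^ (N - i) * y ^ i"
  proof -
    have "to_fract b = tF * to_fract c" unfolding c by (rule to_fract_mult)
    then show ?thesis using rF_nonzero
      by (simp add: z_def a b T_eq to_fract_power power_divide power_mult_distrib power_add power_mult mult_ac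
          power_commute_exp[of rF l i])
  qed
  ultimately have "x ^ (N - i) * y ^ i \<in> P" by simp
  then show False using A.prime_power_mem[OF P xA(1) xy(2)] A.prime_power_mem[OF P xA(2) xy(4)] P xA A.power
    unfolding A.primeideal_iff by blast
qed

end

section \<open>Existence of places above a given one\<close>

text \<open>The heart of Chevalley's extension theorem: a subring maximal among those in which p
  stays a nonunit is a valuation ring.\<close>

locale maximal_subring = R: subring_set R for R :: "'a::field set" +
  fixes L :: "'a set" and p :: 'a
  assumes subfield: "subfield_set L" and R_subset: "R \<subseteq> L" and p_mem: "p \<in> R" and inverse_p: "inverse p \<notin> R"
    and maximal: "subring_set R' \<Longrightarrow> R \<subseteq> R' \<Longrightarrow> R' \<subseteq> L \<Longrightarrow> inverse p \<notin> R' \<Longrightarrow> R' = R"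
begin

lemma p_not_unit: "r \<in> R \<Longrightarrow> p * r \<noteq> 1"
  using inverse_p by (metis inverse_unique)

lemma p_nonzero: "p \<noteq> 0" using inverse_p R.zero by auto

lemma adjoin_represents:
  assumes "x \<in> L" "x \<notin> R"
  obtains f where "f \<in> R.polys" "p * poly f x = 1"
proof -
  have "inverse p \<in> R.adjoin x"
  proof (rule ccontr)
    assume "inverse p \<notin> R.adjoin x"
    moreover have "R.adjoin x \<subseteq> L"
      using subfield R_subset assms(1) by (intro R.adjoin_subset) (auto simp: subfield_set_def)
    ultimately have "R.adjoin x = R" using maximal R.subring_adjoin R.base_adjoin by blast
    then show False using R.gen_adjoin assms(2) by blast
  qed
  then obtain f where "f \<in> R.polys" "inverse p = poly f x" by (auto simp: R.adjoin_def)
  then show ?thesis using that p_nonzero by (metis right_inverse)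
qed

text \<open>If 1/c were missing for c = 1 - pr, adjoining it would invert p, and clearing
  denominators would put c^n in pR. But c^n is 1 modulo pR, so p would be a unit of R.\<close>

lemma inverse_one_minus:
  assumes r: "r \<in> R"
  shows "inverse (1 - p * r) \<in> R"
proof (rule ccontr)
  define c where "c = 1 - p * r"
  have c: "c \<in> R" "c \<noteq> 0" using p_not_unit[OF r] p_mem r by (auto simp: c_def intro: R.closed)
  assume "inverse (1 - p * r) \<notin> R"
  moreover have "inverse c \<in> L" using c(1) R_subset subfield_set.inverse[OF subfield] by blast
  ultimately obtain f where f: "f \<in> R.polys" "p * poly f (inverse c) = 1"
    using adjoin_represents[of "inverse c"] by (auto simp: c_def)
  define n where "n = degree f"
  define r' where "r' = (\<Sum>i\<le>n. coeff f i * c ^ (n - i))"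
  have r': "r' \<in> R" using f(1) c(1) unfolding r'_def R.polys_def by (intro R.sum R.mult R.power) auto
  have "c ^ n = c ^ n * (p * poly f (inverse c))" using f(2) by simp
  also have "\<dots> = p * (\<Sum>i\<le>n. coeff f i * (c ^ n * inverse c ^ i))"
    by (simp add: poly_altdef n_def sum_distrib_left mult_ac)
  also have "(\<Sum>i\<le>n. coeff f i * (c ^ n * inverse c ^ i)) = r'"
    unfolding r'_def
  proof (intro sum.cong refl arg_cong2[of _ _ _ _ "(*)"])
    fix i assume "i \<in> {..n}"
    then have "c ^ n = c ^ (n - i) * c ^ i" by (simp flip: power_add)
    then show "c ^ n * inverse c ^ i = c ^ (n - i)" using c(2) by (simp add: power_inverse)
  qed
  finally have cn: "c ^ n = p * r'" .
  have "\<exists>s\<in>R. c ^ n = 1 - p * s" for n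
  proof (induction n)
    case 0 then show ?case by (intro bexI[of _ 0]) (auto intro: R.zero)
  next
    case (Suc n)
    then obtain s where s: "s \<in> R" "c ^ n = 1 - p * s" by blast
    have "c ^ Suc n = c * (1 - p * s)" by (simp add: s(2))
    also have "\<dots> = 1 - p * (r + s - p * r * s)" by (simp add: c_def algebra_simps)
    finally have "c ^ Suc n = 1 - p * (r + s - p * r * s)" .
    moreover have "r + s - p * r * s \<in> R" using r s p_mem by (intro R.closed)
    ultimately show ?case by blast
  qed
  then obtain s where s: "s \<in> R" "c ^ n = 1 - p * s" by blast
  then have "p * (r' + s) = 1" using cn by (simp add: algebra_simps)
  then show False using p_not_unit[of "r' + s"] r' s(1) by (simp add: R.add)
qed

definition represents :: "'a \<Rightarrow> nat \<Rightarrow> bool" where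
  "represents z n \<longleftrightarrow> (\<exists>f\<in>R.polys. degree f \<le> n \<and> p * poly f z = 1)"

lemma represents_pos: "represents z n \<Longrightarrow> n > 0"
proof (rule ccontr)
  assume "represents z n" "\<not> n > 0"
  then obtain f where f: "f \<in> R.polys" "degree f = 0" "p * poly f z = 1" by (auto simp: represents_def)
  then obtain c where "f = [:c:]" by (metis degree_eq_zeroE)
  then have "p * c = 1" "c \<in> R" using f by (auto simp: R.polys_def dest: spec[of _ 0])
  then show False using p_not_unit by blast
qed

text \<open>The constant term of the relation for 1/z can be moved to the left, where 1 - p b_0 is a
  unit. Multiplying by z^n, with m \<le> n keeping exponents nonnegative, gives z^n = p h(z) with h
  of degree below n; this eliminates the top term for z.\<close>

lemma represents_reduce:
  assumes n: "represents z n" and m: "represents (inverse z) m" and mn: "m \<le> n" and z: "z \<noteq> 0"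
  shows "\<exists>n'<n. represents z n'"
proof -
  obtain f where f: "f \<in> R.polys" "degree f \<le> n" "p * poly f z = 1" using n by (auto simp: represents_def)
  obtain b where b: "b \<in> R.polys" "degree b \<le> m" "p * poly b (inverse z) = 1" using m by (auto simp: represents_def)
  have cR: "coeff f i \<in> R" "coeff b i \<in> R" for i using f b by (auto simp: R.polys_def)
  define v where "v = inverse (1 - p * coeff b 0)"
  have v: "v \<in> R" unfolding v_def by (rule inverse_one_minus[OF cR(2)])
  have v1: "v * (1 - p * coeff b 0) = 1" using p_not_unit[OF cR(2), of 0] by (simp add: v_def)
  have n0: "n > 0" by (rule represents_pos[OF n])
  define h where "h = (\<Sum>j\<in>{1..m}. monom (v * coeff b j) (n - j))"
  have "(\<Sum>j\<in>T. monom (v * coeff b j) (n - j)) \<in> R.polys" for T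
    by (induction T rule: infinite_finite_induct)
      (auto intro: R.polys_zero R.polys_add R.polys_monom R.mult v cR)
  then have hR: "h \<in> R.polys" unfolding h_def .
  have hdeg: "degree h \<le> n - 1" unfolding h_def
    by (rule degree_sum_le) (auto intro!: order_trans[OF degree_monom_le] diff_le_mono2)
  have "poly b (inverse z) = (\<Sum>j\<le>m. coeff b j * inverse z ^ j)"
    unfolding poly_altdef by (rule sum.mono_neutral_left) (use b(2) in \<open>auto simp: coeff_eq_0\<close>)
  also have "{..m} = insert 0 {1..m}" by auto
  finally have bz: "poly b (inverse z) = coeff b 0 + (\<Sum>j\<in>{1..m}. coeff b j * inverse z ^ j)" by simp
  have "1 - p * coeff b 0 = p * (\<Sum>j\<in>{1..m}. coeff b j * inverse z ^ j)"
    using b(3) unfolding bz by (simp add: algebra_simps)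
  then have "z ^ n * (v * (1 - p * coeff b 0)) = p * (\<Sum>j\<in>{1..m}. v * coeff b j * (z ^ n * inverse z ^ j))"
    by (simp add: sum_distrib_left mult_ac)
  also have "(\<Sum>j\<in>{1..m}. v * coeff b j * (z ^ n * inverse z ^ j)) = poly h z"
    unfolding h_def poly_sum poly_monom
  proof (intro sum.cong refl arg_cong2[of _ _ _ _ "(*)"])
    fix j assume "j \<in> {1..m}"
    then have "z ^ n = z ^ (n - j) * z ^ j" using mn by (simp flip: power_add)
    then show "z ^ n * inverse z ^ j = z ^ (n - j)" using z by (simp add: power_inverse)
  qed
  finally have zn: "z ^ n = p * poly h z" by (simp add: v1)
  define f' where "f' = (f - monom (coeff f n) n) + smult (p * coeff f n) h"
  have "f' \<in> R.polys" unfolding f'_def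
    by (intro R.polys_add R.polys_diff R.polys_smult R.polys_monom R.mult f hR cR p_mem)
  moreover have "degree f' \<le> n - 1" unfolding f'_def
  proof (rule degree_add_le)
    show "degree (f - monom (coeff f n) n) \<le> n - 1"
      using f(2) n0 by (intro degree_le) (auto simp: coeff_eq_0)
    show "degree (smult (p * coeff f n) h) \<le> n - 1"
      using hdeg degree_smult_le order_trans by blast
  qed
  moreover have "p * poly f' z = 1"
  proof -
    have "poly f' z = poly f z - coeff f n * z ^ n + coeff f n * (p * poly h z)"
      by (simp add: f'_def poly_monom mult_ac)
    then show ?thesis using f(3) unfolding zn by simp
  qed
  ultimately have "represents z (n - 1)" by (auto simp: represents_def)
  then show ?thesis using n0 by (intro exI[of _ "n - 1"]) auto
qed

text \<open>If neither z nor 1/z were in R, both would satisfy a relation of minimal degree, and the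
  larger of the two degrees could be reduced.\<close>

lemma valuation_set_R: "valuation_set R L"
proof (intro valuation_set.intro valuation_set_axioms.intro R.subring_set_axioms)
  show "subfield_set L" by (rule subfield)
  show "R \<subseteq> L" by (rule R_subset)
  show "z \<in> R \<or> inverse z \<in> R" if zL: "z \<in> L" for z
  proof (rule ccontr)
    assume *: "\<not> (z \<in> R \<or> inverse z \<in> R)"
    have z0: "z \<noteq> 0" using * R.zero by auto
    have iL: "inverse z \<in> L" using zL subfield_set.inverse[OF subfield] by blast
    have ex: "\<exists>n. represents w n" if w: "w \<in> L" "w \<notin> R" for w
      using adjoin_represents[OF w] unfolding represents_def by (metis order_refl)
    define n where "n = (LEAST n. represents z n)"
    define m where "m = (LEAST n. represents (inverse z) n)"
    have n: "represents z n" unfolding n_def using ex[of z] zL * LeastI_ex by metis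
    have m: "represents (inverse z) m" unfolding m_def using ex[of "inverse z"] iL * LeastI_ex by metis
    have nl: "\<not> represents z k" if "k < n" for k using that not_less_Least unfolding n_def by blast
    have ml: "\<not> represents (inverse z) k" if "k < m" for k using that not_less_Least unfolding m_def by blast
    consider "m \<le> n" | "n \<le> m" by linarith
    then show False
    proof cases
      case 1 then show ?thesis using represents_reduce[OF n m _ z0] nl by blast
    next
      case 2 then show ?thesis using represents_reduce[OF m _ 2] n ml z0 by fastforce
    qed
  qed
qed

end

text \<open>Zorn's lemma applies to the subrings of L over B without 1/p, since unions of chains
  keep this property. Omitting 1/p is what puts p into the place.\<close>

lemma exists_valuation_ring_above:
  fixes B L :: "'a::field set"
  assumes "subfield_set L" "subring_set B" "B \<subseteq> L" "p \<in> B" "inverse p \<notin> B"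
  obtains R where "valuation_set R L" "B \<subseteq> R" "p \<in> place_ideal R"
proof -
  define F where "F = {R. subring_set R \<and> B \<subseteq> R \<and> R \<subseteq> L \<and> inverse p \<notin> R}"
  have "\<exists>M\<in>F. \<forall>Y\<in>F. M \<subseteq> Y \<longrightarrow> Y = M"
  proof (rule subset_Zorn_nonempty)
    show "F \<noteq> {}" using assms by (auto simp: F_def)
    fix C assume C: "C \<noteq> {}" "subset.chain F C"
    have CF: "\<And>R. R \<in> C \<Longrightarrow> R \<in> F" using C by (auto simp: subset.chain_def)
    have chain: "R \<subseteq> R' \<or> R' \<subseteq> R" if "R \<in> C" "R' \<in> C" for R R' using C that by (auto simp: subset_chain_def)
    have common: "\<exists>R\<in>C. x \<in> R \<and> y \<in> R" if xy: "x \<in> \<Union>C" "y \<in> \<Union>C" for x y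
      using xy chain by blast
    have "subring_set (\<Union>C)"
    proof
      show "1 \<in> \<Union>C" using C(1) CF by (auto simp: F_def subring_set_def)
      fix x y assume "x \<in> \<Union>C" "y \<in> \<Union>C"
      then obtain R where R: "R \<in> C" "x \<in> R" "y \<in> R" using common by blast
      then have sR: "subring_set R" using CF by (auto simp: F_def)
      show "x - y \<in> \<Union>C" "x * y \<in> \<Union>C"
        by (rule UnionI[OF R(1)], rule subring_set.diff[OF sR R(2,3)])
          (rule UnionI[OF R(1)], rule subring_set.mult[OF sR R(2,3)])
    qed
    moreover have "B \<subseteq> \<Union>C" "\<Union>C \<subseteq> L" "inverse p \<notin> \<Union>C" using C(1) CF by (auto simp: F_def)
    ultimately show "\<Union>C \<in> F" by (simp add: F_def)
  qed
  then obtain R where R: "R \<in> F" "\<And>Y. Y \<in> F \<Longrightarrow> R \<subseteq> Y \<Longrightarrow> Y = R" by blast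
  interpret subring_set R using R(1) by (simp add: F_def)
  interpret maximal_subring R L p
  proof (intro maximal_subring.intro maximal_subring_axioms.intro)
    fix R' assume "subring_set R'" "R \<subseteq> R'" "R' \<subseteq> L" "inverse p \<notin> R'"
    moreover have "B \<subseteq> R" using R(1) by (simp add: F_def)
    ultimately show "R' = R" by (intro R(2)) (auto simp: F_def)
  qed (use R(1) assms in \<open>auto simp: F_def\<close>)
  show ?thesis
  proof (rule that[OF valuation_set_R])
    show "B \<subseteq> R" using R(1) by (simp add: F_def)
    show "p \<in> place_ideal R" using p_mem inverse_p by (simp add: place_ideal_def)
  qed
qed

section \<open>The Frobenius automorphism at a place of degree one\<close>

text \<open>\<open>v\<close> is \<open>u\<close> rescaled to a unit above the place: \<open>v\<^sup>W\<close> is a constant times factors that are \<open>1\<close> modulo the uniformizer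
  \<open>\<pi>\<close>. By \<open>s_v\<close>, \<open>s\<close> acts on \<open>v\<close> as the \<open>q\<close>-th power map modulo \<open>\<pi>\<close>, so \<open>s\<close> is the candidate for the Artin symbol.
  Assumption \<open>dominated\<close> records that the primes lie at places where all elements of \<open>A\<close> are regular.\<close>
locale kummer_place = kummer_extension \<rho> N \<eta> u W + degree_one_place A V \<pi>
  for \<rho> :: "'f::{finite,field} poly" and N \<eta> u W
    and A V :: "'f poly fract set" and \<pi> :: "'f poly fract" +
  fixes v :: "'f poly fract alg_closure" and g :: "'f poly fract" and s :: "'f poly fract alg_closure \<Rightarrow> 'f poly fract alg_closure"
    and d :: "nat \<Rightarrow> 'f poly fract alg_closure" and e :: "'f poly fract alg_closure" and n :: "nat \<Rightarrow> nat"
  assumes dominated: "Q \<in> valuation_rings const_field UNIV \<Longrightarrow> degree_one_place.I A V \<subseteq> Q \<Longrightarrow> A \<subseteq> Q"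
    and v_eq: "v = u * to_ac g" and g_nonzero: "g \<noteq> 0"
    and e: "e \<in> constants" "e \<noteq> 0" and d: "\<And>j. d j \<in> constants"
    and v_power: "v ^ W = e * (\<Prod>j<N. inverse (1 - d j * to_ac \<pi>) ^ n j)"
    and s: "s \<in> carrier (galois_group L (range to_ac))" "s \<eta> = \<eta> ^ CARD('f)"
    and s_v: "s v = (1 - d 0 * to_ac \<pi>) ^ (CARD('f) - 1) * v ^ CARD('f)"
begin

section \<open>Places of H^+ above the prime\<close>

abbreviation "y \<equiv> to_ac \<pi>"

lemma y_nonzero: "y \<noteq> 0" using pi_nonzero by simp

lemma V_expand:
  assumes "w \<in> V"
  obtains c w' where "w' \<in> V" "to_ac w = const_ac c + y * to_ac w'"
proof -
  obtain c where c: "w - to_fract [:c:] \<in> V.\<mm>" using residue[OF assms] by blast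
  have "w = to_fract [:c:] + \<pi> * ((w - to_fract [:c:]) / \<pi>)" using pi_nonzero by simp
  then have "to_ac w = const_ac c + y * to_ac ((w - to_fract [:c:]) / \<pi>)"
    unfolding const_ac_def by (metis to_ac_add to_ac_mult)
  then show ?thesis using that unif[OF c] by blast
qed

text \<open>Domination of the local ring V, a form of lying above I that gives direct access to
  units and to the uniformizer.\<close>

definition above :: "'f poly fract alg_closure set \<Rightarrow> bool" where
  "above R \<longleftrightarrow> valuation_set R L \<and> to_ac ` V \<subseteq> R \<and> y \<in> place_ideal R"

lemma const_not_mm: "to_fract [:c:] \<in> V.\<mm> \<Longrightarrow> c = 0"
proof (rule ccontr)
  assume c: "to_fract [:c:] \<in> V.\<mm>" "c \<noteq> 0"
  have "to_fract [:inverse c:] * to_fract [:c:] \<in> V.\<mm>" using A_subset const_in_A by (intro V.mm_mult c) auto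
  moreover have "to_fract [:inverse c:] * to_fract [:c:] = 1" using c(2) by (simp flip: to_fract_mult one_pCons)
  ultimately show False using V.mm_one by simp
qed

text \<open>A place over I contracts to a valuation ring of F_q(t) containing I, hence containing A
  by \<open>dominated\<close>. Elements of A outside I then become units, which brings in all of
  V.\<close>

lemma above_iff:
  "(R \<in> valuation_rings (to_ac ` const_field) L \<and> place_ideal R \<inter> to_ac ` A = to_ac ` I) \<longleftrightarrow> above R"
proof
  assume *: "R \<in> valuation_rings (to_ac ` const_field) L \<and> place_ideal R \<inter> to_ac ` A = to_ac ` I"
  then interpret R: valuation_set R L using valuation_ringsD(1)[OF _ L.subfield_set_axioms] by blast
  have "to_ac ` const_field \<subseteq> R"
    by (rule valuation_ringsD(2)[OF conjunct1[OF *] L.subfield_set_axioms])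
  then have cR: "to_ac (to_fract [:c:]) \<in> R" for c by (auto simp: const_field_eq)
  define Q where "Q = {x. to_ac x \<in> R}"
  have IQ: "to_ac x \<in> R.\<mm>" if "x \<in> I" for x using * that by blast
  obtain a where a: "a \<in> I" "a \<noteq> 0" using I_nonzero ideal_I[unfolded A.ideal_iff] by auto
  \<comment> \<open>A nonzero element of I is not constant and has no inverse in Q, so Q differs
    from both the constants and the whole field.\<close>
  have "Q \<in> valuation_rings const_field UNIV"
  proof -
    have "subring_set Q" by standard (auto simp: Q_def R.closed)
    moreover have "z \<in> Q \<or> inverse z \<in> Q" for z
      using R.val[of "to_ac z"] range_to_ac_subset_L by (auto simp: Q_def)
    moreover have "const_field \<subseteq> Q" using cR by (auto simp: Q_def const_field_eq)
    moreover have "a \<in> Q" "a \<notin> const_field"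
      using a IQ[OF a(1)] R.mm_subset const_not_mm by (auto simp: Q_def const_field_eq I_def)
    moreover have "inverse a \<notin> Q" using R.mm_not_unit[OF IQ[OF a(1)]] a(2) by (auto simp: Q_def)
    ultimately show ?thesis by (auto simp: valuation_rings_def subring_iff)
  qed
  then have "A \<subseteq> Q" by (rule dominated) (use IQ R.mm_subset in \<open>auto simp: Q_def\<close>)
  then have AR: "to_ac x \<in> R" if "x \<in> A" for x using that by (auto simp: Q_def)
  have inv: "inverse (to_ac b) \<in> R" if b: "b \<in> A" "b \<notin> V.\<mm>" for b
  proof (rule R.mm_unit[OF AR[OF b(1)]])
    show "to_ac b \<notin> R.\<mm>"
    proof
      assume "to_ac b \<in> R.\<mm>"
      then have "to_ac b \<in> to_ac ` I" using * b(1) by blast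
      then show False using b(2) by (auto simp: I_def)
    qed
  qed
  have "to_ac ` V \<subseteq> R"
  proof clarify
    fix w assume "w \<in> V"
    then obtain a b where "a \<in> A" "b \<in> A" "b \<notin> V.\<mm>" "w = a / b" using loc by blast
    then show "to_ac w \<in> R" using AR inv R.mult by (simp add: divide_inverse)
  qed
  moreover have "y \<in> R.\<mm>"
  proof -
    obtain a b where "a \<in> I" "b \<in> A" "b \<notin> V.\<mm>" "\<pi> = a / b" by (rule pi_frac)
    then show ?thesis using R.mm_mult[OF IQ inv, of a b] by (simp add: divide_inverse mult.commute)
  qed
  ultimately show "above R" unfolding above_def using R.valuation_set_axioms by blast
next
  assume ab: "above R"
  then interpret R: valuation_set R L by (simp add: above_def)
  have VR: "to_ac w \<in> R" if "w \<in> V" for w using ab that by (auto simp: above_def)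
  have ym: "y \<in> R.\<mm>" using ab by (simp add: above_def)
  have "R \<in> valuation_rings (to_ac ` const_field) L"
  proof -
    have "to_ac ` const_field \<subseteq> R" using VR A_subset const_in_A by (auto simp: const_field_eq)
    moreover have "y \<in> R" "y \<notin> to_ac ` const_field"
      using R.mm_subset[OF ym] pi_mem pi_nonzero const_not_mm by (auto simp: const_field_eq)
    moreover have "inverse y \<in> L" "inverse y \<notin> R"
      using R.mm_not_unit[OF ym y_nonzero] range_to_ac_subset_L by (auto intro: L.inverse)
    ultimately show ?thesis using R.subset R.val R.subring_set_axioms
      by (auto simp: valuation_rings_def subring_iff)
  qed
  moreover have "place_ideal R \<inter> to_ac ` A = to_ac ` I"
  proof -
    have "to_ac x \<in> R.\<mm> \<longleftrightarrow> x \<in> V.\<mm>" if x: "x \<in> A" for x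
    proof
      assume m: "x \<in> V.\<mm>"
      have "to_ac (x / \<pi>) * y \<in> R.\<mm>" by (intro R.mm_mult ym VR unif m)
      then show "to_ac x \<in> R.\<mm>" using y_nonzero by simp
    next
      assume m: "to_ac x \<in> R.\<mm>"
      show "x \<in> V.\<mm>"
      proof (rule ccontr)
        assume nm: "x \<notin> V.\<mm>"
        then have "to_ac (inverse x) \<in> R" using V.mm_unit A_subset x by (intro VR) blast
        moreover have "to_ac x \<noteq> 0" using nm V.mm_zero by auto
        ultimately show False using R.mm_not_unit[OF m] by simp
      qed
    qed
    then show ?thesis by (auto simp: I_def)
  qed
  ultimately show "R \<in> valuation_rings (to_ac ` const_field) L \<and> place_ideal R \<inter> to_ac ` A = to_ac ` I" ..
qed

text \<open>Chevalley applies because \<pi> is not a unit of V. Without a place above, the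
  congruence could not single out an automorphism.\<close>

lemma above_exists: obtains R where "above R"
proof (rule exists_valuation_ring_above[OF L.subfield_set_axioms, of "to_ac ` V" y])
  show "subring_set (to_ac ` V)"
  proof
    show "1 \<in> to_ac ` V" using V.one by force
    fix a b assume "a \<in> to_ac ` V" "b \<in> to_ac ` V"
    then show "a - b \<in> to_ac ` V" "a * b \<in> to_ac ` V"
      using V.diff V.mult by (auto simp flip: to_ac_diff to_ac_mult)
  qed
  show "to_ac ` V \<subseteq> L" using range_to_ac_subset_L by auto
  show "y \<in> to_ac ` V" using V.mm_subset[OF pi_mem] by simp
  show "inverse y \<notin> to_ac ` V" using V.mm_not_unit[OF pi_mem pi_nonzero] by (auto simp flip: to_ac_inverse)
qed (use that in \<open>auto simp: above_def\<close>)

text \<open>The inverses are included so that the equation for v^W holds inside B, where modulo y it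
  reduces to v^W = e.\<close>

definition gens :: "'f poly fract alg_closure set" where
  "gens = to_ac ` V \<union> {\<eta>, v} \<union> (\<lambda>j. inverse (1 - d j * y)) ` {..<N}"

definition B :: "'f poly fract alg_closure set" where
  "B = \<Inter>{S. subring_set S \<and> gens \<subseteq> S}"

lemma B_least: "subring_set S \<Longrightarrow> gens \<subseteq> S \<Longrightarrow> B \<subseteq> S" by (auto simp: B_def)

lemma gens_B: "gens \<subseteq> B" by (auto simp: B_def)

sublocale B: subring_set B
  by standard (auto simp: B_def subring_set_def)

lemma V_in_B: "w \<in> V \<Longrightarrow> to_ac w \<in> B" using gens_B by (auto simp: gens_def)
lemma y_in_B: "y \<in> B" by (intro V_in_B V.mm_subset pi_mem)
lemma eta_in_B: "\<eta> \<in> B" and v_in_B: "v \<in> B" using gens_B by (auto simp: gens_def)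
lemma inv_in_B: "j < N \<Longrightarrow> inverse (1 - d j * y) \<in> B" using gens_B by (auto simp: gens_def)

lemma const_in_V: "to_fract [:c:] \<in> V" using A_subset const_in_A by blast

lemma consts_subset_B: "constants \<subseteq> B"
  by (rule consts_subset[OF B.subring_set_axioms eta_in_B]) (simp add: const_ac_def V_in_B const_in_V)

lemma card_power_pos: "CARD('f) ^ N - 1 > 0"
  unfolding W_mult[symmetric] using W_pos card_ge_2 by simp

text \<open>Nonzero constants are roots of unity, and valuation rings are closed under
  roots.\<close>

lemma consts_in_above:
  assumes "above R" "c \<in> constants"
  shows "c \<in> R"
proof -
  interpret R: valuation_set R L using assms by (simp add: above_def)
  show ?thesis
  proof (cases "c = 0")
    case False
    then have "c ^ (CARD('f) ^ N - 1) \<in> R" using consts_power assms(2) R.one by metis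
    then show ?thesis using R.root_in[OF _ _ card_power_pos] assms(2) consts_subset_L by blast
  qed (simp add: R.zero)
qed

lemma one_minus_nonzero: "c \<in> constants \<Longrightarrow> 1 - c * y \<noteq> 0"
proof
  assume c: "c \<in> constants" "1 - c * y = 0"
  obtain R where ab: "above R" by (rule above_exists)
  then interpret R: valuation_set R L by (simp add: above_def)
  have "c * y \<in> R.\<mm>" using ab by (intro R.mm_mult consts_in_above[OF ab c(1)]) (simp add: above_def)
  then show False using c(2) R.mm_one by simp
qed

lemma gens_subset_above:
  assumes ab: "above R"
  shows "gens \<subseteq> R"
proof -
  interpret R: valuation_set R L using ab by (simp add: above_def)
  have ym: "y \<in> R.\<mm>" using ab by (simp add: above_def)
  have inv: "inverse (1 - d j * y) \<in> R" for j
    by (intro R.one_minus_unit R.mm_mult ym consts_in_above[OF ab] d)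
  have "v ^ W \<in> R" unfolding v_power by (intro R.mult R.prod R.power inv consts_in_above[OF ab] e)
  moreover have "v \<in> L" unfolding v_eq using u_in_L range_to_ac_subset_L by (intro L.mult) auto
  ultimately have "v \<in> R" using R.root_in W_pos by blast
  then show ?thesis using ab inv consts_in_above[OF ab eta_in_consts] by (auto simp: gens_def above_def)
qed

lemma B_subset_above: "above R \<Longrightarrow> B \<subseteq> R"
  using gens_subset_above B_least by (auto simp: above_def valuation_set_def)

section \<open>Congruences modulo the uniformizer in B\<close>

definition yB :: "'f poly fract alg_closure set" where "yB = (\<lambda>x. y * x) ` B"

lemma yB_I: "b \<in> B \<Longrightarrow> y * b \<in> yB" unfolding yB_def by (rule imageI)
lemma yB_zero: "0 \<in> yB" using yB_I[OF B.zero] by simp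
lemma yB_diff: "a \<in> yB \<Longrightarrow> b \<in> yB \<Longrightarrow> a - b \<in> yB"
  unfolding yB_def by (auto simp: right_diff_distrib[symmetric] intro: B.diff)
lemma yB_add: "a \<in> yB \<Longrightarrow> b \<in> yB \<Longrightarrow> a + b \<in> yB"
  unfolding yB_def by (auto simp: distrib_left[symmetric] intro: B.add)
lemma yB_mult: "a \<in> B \<Longrightarrow> b \<in> yB \<Longrightarrow> a * b \<in> yB"
  unfolding yB_def by (auto simp: mult.left_commute[of a] intro: B.mult)

definition one_units :: "'f poly fract alg_closure set" where "one_units = {b \<in> B. b - 1 \<in> yB}"

lemma one_units_one: "1 \<in> one_units" by (simp add: one_units_def B.one yB_zero)
lemma one_units_mult: "a \<in> one_units \<Longrightarrow> b \<in> one_units \<Longrightarrow> a * b \<in> one_units"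
proof -
  assume ab: "a \<in> one_units" "b \<in> one_units"
  have "a * b - 1 = a * (b - 1) + (a - 1)" by (simp add: algebra_simps)
  also have "\<dots> \<in> yB" using ab by (intro yB_add yB_mult) (auto simp: one_units_def)
  finally show "a * b \<in> one_units" using ab by (auto simp: one_units_def B.mult)
qed
lemma one_units_power: "a \<in> one_units \<Longrightarrow> a ^ k \<in> one_units"
  by (induction k) (auto intro: one_units_one one_units_mult)
lemma one_units_prod: "(\<And>i. i \<in> T \<Longrightarrow> f i \<in> one_units) \<Longrightarrow> prod f T \<in> one_units"
  by (induction T rule: infinite_finite_induct) (auto intro: one_units_one one_units_mult)

lemma inv_one_unit: "j < N \<Longrightarrow> inverse (1 - d j * y) \<in> one_units"
proof -
  assume j: "j < N"
  have "inverse (1 - d j * y) - 1 = y * (d j * inverse (1 - d j * y))"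
    using one_minus_nonzero[OF d[of j]] by (simp add: field_simps)
  then show ?thesis using inv_in_B[OF j] d consts_subset_B yB_I[of "d j * inverse (1 - d j * y)"]
    by (auto simp: one_units_def intro: B.mult)
qed

lemma v_power_one_unit: "v ^ (W * (CARD('f) ^ N - 1)) \<in> one_units"
proof -
  have "v ^ (W * (CARD('f) ^ N - 1)) = e ^ (CARD('f) ^ N - 1) * (\<Prod>j<N. inverse (1 - d j * y) ^ n j) ^ (CARD('f) ^ N - 1)"
    by (simp add: power_mult v_power power_mult_distrib)
  also have "e ^ (CARD('f) ^ N - 1) = 1" using consts_power e by blast
  finally show ?thesis by (auto intro!: one_units_power one_units_prod inv_one_unit)
qed

text \<open>The factor N makes the q^m-power map fix \<eta>. By Euler, (q^N)^totient is 1 modulo W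
  (q^N - 1), an exponent that carries v to 1 modulo y.\<close>

definition m :: nat where "m = N * totient (W * (CARD('f) ^ N - 1))"

lemma m_pos: "m > 0" and m_dvd: "W * (CARD('f) ^ N - 1) dvd CARD('f) ^ m - 1"
proof -
  let ?M = "W * (CARD('f) ^ N - 1)"
  have "CARD('f) ^ N - 1 = W * (CARD('f) - 1)" using W_mult by simp
  then have M: "?M > 0" using W_pos card_ge_2 by simp
  then show "m > 0" using N_ge_2 by (simp add: m_def)
  have "coprime (CARD('f) ^ N - 1) (CARD('f) ^ N)"
    by (metis coprime_diff_one_left_nat zero_less_power zero_less_card_finite)
  then have "coprime (CARD('f) ^ N) ?M" using coprime_W by (simp add: coprime_commute)
  then have "[(CARD('f) ^ N) ^ totient ?M = 1] (mod ?M)" by (rule euler_theorem)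
  then show "?M dvd CARD('f) ^ m - 1" unfolding m_def power_mult
    by (rule cong_to_1_nat)
qed

text \<open>\<open>B / yB\<close> is generated by elements of a finite field, so some power of Frobenius is the identity on it.\<close>
lemma frob_B: "b \<in> B \<Longrightarrow> b ^ CARD('f) ^ m - b \<in> yB"
proof -
  let ?Q = "CARD('f) ^ m"
  let ?S = "{b \<in> B. b ^ ?Q - b \<in> yB}"
  have Q: "?Q = Suc (?Q - 1)" by simp
  have QB: "b ^ ?Q \<in> B" if "b \<in> B" for b using that by (rule B.power)
  have "subring_set ?S"
  proof
    show "1 \<in> ?S" by (simp add: B.one yB_zero)
    fix a b assume ab: "a \<in> ?S" "b \<in> ?S"
    have "(a - b) ^ ?Q - (a - b) = (a ^ ?Q - a) - (b ^ ?Q - b)" by (simp add: frob_diff)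
    also have "\<dots> \<in> yB" by (rule yB_diff) (use ab in auto)
    finally show "a - b \<in> ?S" using ab by (auto intro: B.diff)
    have "(a * b) ^ ?Q - a * b = a ^ ?Q * (b ^ ?Q - b) + b * (a ^ ?Q - a)" by (simp add: power_mult_distrib algebra_simps)
    also have "\<dots> \<in> yB" using ab by (intro yB_add yB_mult) (auto intro: B.power)
    finally show "a * b \<in> ?S" using ab by (auto intro: B.mult)
  qed
  moreover have "gens \<subseteq> ?S"
  proof -
    have "to_ac w \<in> ?S" if w: "w \<in> V" for w
    proof -
      obtain c w' where *: "w' \<in> V" "to_ac w = const_ac c + y * to_ac w'" using V_expand[OF w] by blast
      have "to_ac w ^ ?Q - to_ac w = y * (y ^ (?Q - 1) * to_ac w' ^ ?Q - to_ac w')"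
      proof -
        have "y ^ ?Q = y * y ^ (?Q - 1)" by (metis Q power_Suc)
        then show ?thesis by (simp add: *(2) frob_add frob_const_ac power_mult_distrib right_diff_distrib)
      qed
      also have "\<dots> \<in> yB" by (intro yB_I B.diff B.mult B.power y_in_B V_in_B *)
      finally show ?thesis using V_in_B[OF w] by simp
    qed
    moreover have "\<eta> \<in> ?S"
    proof -
      have "conj_eta (N * k) = \<eta>" for k
        by (induction k) (simp_all add: conj_eta_N power_add power_mult)
      then show ?thesis using eta_in_B by (simp add: m_def yB_zero)
    qed
    moreover have "v \<in> ?S"
    proof -
      obtain k where k: "?Q - 1 = W * (CARD('f) ^ N - 1) * k" using m_dvd by (auto elim: dvdE)
      have "v ^ (?Q - 1) \<in> one_units" unfolding k power_mult[of v "W * (CARD('f) ^ N - 1)"]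
        by (intro one_units_power v_power_one_unit)
      then have "v * (v ^ (?Q - 1) - 1) \<in> yB" using v_in_B by (auto simp: one_units_def intro: yB_mult)
      moreover have "v ^ ?Q = v * v ^ (?Q - 1)" by (metis Q power_Suc)
      ultimately show ?thesis using v_in_B by (simp add: right_diff_distrib)
    qed
    moreover have "inverse (1 - d j * y) \<in> ?S" if j: "j < N" for j
    proof -
      let ?g = "inverse (1 - d j * y)"
      have "?g ^ ?Q - ?g = (?g ^ ?Q - 1) - (?g - 1)" by simp
      also have "\<dots> \<in> yB"
        by (rule yB_diff)
          (use inv_one_unit[OF j] one_units_power[OF inv_one_unit[OF j], of ?Q] in \<open>auto simp: one_units_def\<close>)
      finally show ?thesis using inv_in_B[OF j] by simp
    qed
    ultimately show ?thesis unfolding gens_def by blast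
  qed
  ultimately show "b \<in> B \<Longrightarrow> b ^ ?Q - b \<in> yB" using B_least by blast
qed

text \<open>Elements that some power of y carries into B form a subring; it contains K by
  \<open>pole\<close>, and also \<eta> and u.\<close>

lemma L_clear_pole: "x \<in> L \<Longrightarrow> \<exists>k. y ^ k * x \<in> B"
proof -
  let ?S = "{x. \<exists>k. y ^ k * x \<in> B}"
  have yk: "y ^ k \<in> B" for k by (intro B.power y_in_B)
  have S_mult: "a * b \<in> ?S" if ab: "a \<in> ?S" "b \<in> ?S" for a b
  proof -
    obtain k l where "y ^ k * a \<in> B" "y ^ l * b \<in> B" using ab by blast
    then have "y ^ k * a * (y ^ l * b) \<in> B" by (rule B.mult)
    then have "y ^ (k + l) * (a * b) \<in> B" by (simp add: power_add mult_ac)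
    then show ?thesis by blast
  qed
  have to_ac_S: "to_ac x \<in> ?S" for x
  proof -
    obtain k where "\<pi> ^ k * x \<in> V" using pole by blast
    from V_in_B[OF this] show ?thesis by auto
  qed
  have B_S: "b \<in> ?S" if "b \<in> B" for b using that by (auto intro: exI[of _ 0])
  have "subring_set ?S"
  proof
    show "1 \<in> ?S" by (rule B_S[OF B.one])
    fix a b assume ab: "a \<in> ?S" "b \<in> ?S"
    then show "a * b \<in> ?S" by (rule S_mult)
    obtain k l where "y ^ k * a \<in> B" "y ^ l * b \<in> B" using ab by blast
    then have "y ^ l * (y ^ k * a) - y ^ k * (y ^ l * b) \<in> B" by (metis B.diff B.mult yk)
    moreover have "y ^ l * (y ^ k * a) - y ^ k * (y ^ l * b) = y ^ (k + l) * (a - b)"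
      by (simp add: power_add algebra_simps)
    ultimately have "y ^ (k + l) * (a - b) \<in> B" by simp
    then show "a - b \<in> ?S" by blast
  qed
  moreover have "u \<in> ?S"
  proof -
    have "u = v * to_ac (inverse g)" using g_nonzero by (simp add: v_eq)
    then show ?thesis using S_mult[OF B_S[OF v_in_B] to_ac_S] by metis
  qed
  ultimately have "L \<subseteq> ?S" using B_S[OF eta_in_B] to_ac_S by (intro L_least) auto
  then show "x \<in> L \<Longrightarrow> \<exists>k. y ^ k * x \<in> B" by blast
qed

text \<open>Induction on the power of y needed to carry r into B. If b = y^(k+1) r is in B, it is in
  the place, and c = 1 - b^(Q-1) is a unit there with cb in yB; replacing r by cr saves one factor
  y.\<close>

lemma clear_denominator:
  assumes ab: "above R" and r: "r \<in> R"
  obtains c where "c \<in> B" "c \<notin> place_ideal R" "c * r \<in> B"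
proof -
  interpret R: valuation_set R L using ab by (simp add: above_def)
  have ym: "y \<in> R.\<mm>" using ab by (simp add: above_def)
  note BR = B_subset_above[OF ab]
  let ?Q = "CARD('f) ^ m"
  have Q1: "?Q - 1 > 0" using m_pos card_ge_2 self_le_power[of "CARD('f)" m] by linarith
  have Q: "?Q = Suc (?Q - 1)" by simp
  have "y ^ k * r \<in> B \<Longrightarrow> \<exists>c\<in>B. c \<notin> R.\<mm> \<and> c * r \<in> B" if "r \<in> R" for k r
    using that
  proof (induction k arbitrary: r)
    case 0
    then show ?case using B.one R.mm_one by (intro bexI[of _ 1]) auto
  next
    case (Suc k)
    define b where "b = y ^ Suc k * r"
    have bB: "b \<in> B" using Suc by (simp add: b_def)
    have "y ^ k * r * y \<in> R.\<mm>" using R.mm_subset[OF ym] Suc by (intro R.mm_mult ym R.mult R.power)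
    then have bm: "b \<in> R.\<mm>" by (simp add: b_def mult_ac)
    define c where "c = 1 - b ^ (?Q - 1)"
    have cB: "c \<in> B" unfolding c_def by (intro B.diff B.one B.power bB)
    have "b ^ (?Q - 2) * b \<in> R.\<mm>" using bB BR by (intro R.mm_mult bm R.power) auto
    moreover have "?Q - 1 = Suc (?Q - 2)" using Q1 by linarith
    ultimately have bQ: "b ^ (?Q - 1) \<in> R.\<mm>" by (simp add: mult.commute)
    have cm: "c \<notin> R.\<mm>"
    proof
      assume "c \<in> R.\<mm>"
      then have "c + b ^ (?Q - 1) \<in> R.\<mm>" using bQ by (rule R.mm_add)
      then show False using R.mm_one by (simp add: c_def)
    qed
    have "b ^ ?Q = b * b ^ (?Q - 1)" by (metis Q power_Suc)
    then have "c * b = - (b ^ ?Q - b)" by (simp add: c_def algebra_simps)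
    moreover have "b ^ ?Q - b \<in> yB" by (rule frob_B[OF bB])
    ultimately have "c * b \<in> yB" using yB_diff[OF yB_zero, of "b ^ ?Q - b"] by simp
    then obtain x where x: "x \<in> B" "c * b = y * x" by (auto simp: yB_def)
    have "y * (y ^ k * (c * r)) = y * x" using x(2) by (simp add: b_def mult_ac)
    then have "y ^ k * (c * r) \<in> B" using x(1) y_nonzero by simp
    moreover have "c * r \<in> R" using cB BR Suc by (intro R.mult) auto
    ultimately obtain c' where c': "c' \<in> B" "c' \<notin> R.\<mm>" "c' * (c * r) \<in> B" using Suc.IH by blast
    have "c' * c \<notin> R.\<mm>" using R.mm_prime[of c' c] c' cB cm BR by blast
    moreover have "c' * c * r \<in> B" using c'(3) by (simp add: mult.assoc)
    ultimately show ?case using B.mult[OF c'(1) cB] by blast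
  qed
  moreover obtain k where "y ^ k * r \<in> B" using L_clear_pole r R.subset by blast
  ultimately show ?thesis using that r by blast
qed

text \<open>The elements of R obeying the congruence form a subring, so the generators decide.
  Stability of R under s is not presupposed: s b lies in R because it differs from b^q by an element
  of the place.\<close>

lemma frobenius_B:
  assumes ab: "above R"
  shows "b \<in> B \<Longrightarrow> s b \<in> R \<and> s b - b ^ CARD('f) \<in> place_ideal R"
proof -
  interpret R: valuation_set R L using ab by (simp add: above_def)
  have ym: "y \<in> R.\<mm>" using ab by (simp add: above_def)
  have GR: "\<And>x. x \<in> gens \<Longrightarrow> x \<in> R" using gens_subset_above[OF ab] by blast
  have RL: "\<And>x. x \<in> R \<Longrightarrow> x \<in> L" using R.subset by blast
  note h = GalD(1)[OF s(1)]
  have one_power: "z ^ k - 1 \<in> R.\<mm>" if "z - 1 \<in> R.\<mm>" for z k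
  proof (induction k)
    case (Suc k)
    have "z ^ k \<in> R" using R.add[OF R.mm_subset[OF Suc] R.one] by simp
    then have "z ^ k * (z - 1) + (z ^ k - 1) \<in> R.\<mm>" using that Suc by (intro R.mm_add R.mm_mult)
    then show ?case by (simp add: algebra_simps)
  qed (simp add: R.mm_zero)
  have inv1: "inverse (1 - c * y) \<in> R" "inverse (1 - c * y) - 1 \<in> R.\<mm>" if c: "c \<in> constants" for c
  proof -
    have cR: "c \<in> R" by (rule consts_in_above[OF ab c])
    show i: "inverse (1 - c * y) \<in> R" by (intro R.one_minus_unit R.mm_mult ym cR)
    have "inverse (1 - c * y) - 1 = c * inverse (1 - c * y) * y"
      using one_minus_nonzero[OF c] by (simp add: field_simps)
    then show "inverse (1 - c * y) - 1 \<in> R.\<mm>" using R.mm_mult[OF ym R.mult[OF cR i]] by simp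
  qed
  let ?S = "{b \<in> R. s b - b ^ CARD('f) \<in> R.\<mm>}"
  have sR: "s b \<in> R" if "b \<in> ?S" for b
  proof -
    have "s b - b ^ CARD('f) \<in> R.\<mm>" "b \<in> R" using that by auto
    then have "(s b - b ^ CARD('f)) + b ^ CARD('f) \<in> R" by (metis R.add R.mm_subset R.power)
    then show ?thesis by simp
  qed
  have "subring_set ?S"
  proof
    show "1 \<in> ?S" by (simp add: R.one L.hom_on_one[OF h] R.mm_zero)
    fix a b assume ab': "a \<in> ?S" "b \<in> ?S"
    have "s (a - b) - (a - b) ^ CARD('f) = (s a - a ^ CARD('f)) - (s b - b ^ CARD('f))"
      using ab' RL frob_diff[where 'f='f and n=1, of a b] by (simp add: L.hom_on_diff[OF h])
    also have "\<dots> \<in> R.\<mm>" by (rule R.mm_diff) (use ab' in auto)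
    finally show "a - b \<in> ?S" using ab' by (auto intro: R.diff)
    have "s (a * b) - (a * b) ^ CARD('f) = s a * (s b - b ^ CARD('f)) + b ^ CARD('f) * (s a - a ^ CARD('f))"
      using ab' RL by (simp add: L.hom_on_mult[OF h] power_mult_distrib algebra_simps)
    also have "\<dots> \<in> R.\<mm>" using ab' sR by (intro R.mm_add R.mm_mult R.power) auto
    finally show "a * b \<in> ?S" using ab' by (auto intro: R.mult)
  qed
  moreover have "gens \<subseteq> ?S"
  proof -
    have "to_ac w \<in> ?S" if w: "w \<in> V" for w
    proof -
      obtain c w' where *: "w' \<in> V" "to_ac w = const_ac c + y * to_ac w'" using V_expand[OF w] by blast
      have w'R: "to_ac w' \<in> R" using *(1) by (intro GR) (auto simp: gens_def)
      have "y * to_ac w' \<in> R.\<mm>" using R.mm_mult[OF ym w'R] by (simp add: mult.commute)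
      moreover have "y ^ CARD('f) * to_ac w' ^ CARD('f) \<in> R.\<mm>"
      proof -
        have "CARD('f) = Suc (CARD('f) - 1)" by simp
        then have "y ^ CARD('f) = y ^ (CARD('f) - 1) * y" by (metis power_Suc2)
        moreover have "to_ac w' ^ CARD('f) * y ^ (CARD('f) - 1) * y \<in> R.\<mm>"
          by (intro R.mm_mult ym R.mult R.power w'R R.mm_subset)
        ultimately show ?thesis by (simp add: mult_ac)
      qed
      moreover have "s (to_ac w) - to_ac w ^ CARD('f) = y * to_ac w' - y ^ CARD('f) * to_ac w' ^ CARD('f)"
      proof -
        have "s (to_ac w) = const_ac c + y * to_ac w'" using Gal_to_ac[OF s(1), of w] *(2) by simp
        moreover have "to_ac w ^ CARD('f) = const_ac c + y ^ CARD('f) * to_ac w' ^ CARD('f)"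
          unfolding *(2) using frob_add[where 'f='f and n=1, of "const_ac c" "y * to_ac w'"] frob_const_ac[where n=1, of c]
          by (simp add: power_mult_distrib)
        ultimately show ?thesis by simp
      qed
      ultimately have "s (to_ac w) - to_ac w ^ CARD('f) \<in> R.\<mm>" by (simp add: R.mm_diff)
      moreover have "to_ac w \<in> R" using w by (intro GR) (auto simp: gens_def)
      ultimately show ?thesis by simp
    qed
    moreover have "\<eta> \<in> ?S" using GR[of \<eta>] s(2) by (simp add: gens_def R.mm_zero)
    moreover have "v \<in> ?S"
    proof -
      have vR: "v \<in> R" by (rule GR) (simp add: gens_def)
      have "- (d 0 * y) \<in> R.\<mm>" by (intro R.mm_uminus R.mm_mult ym consts_in_above[OF ab] d)
      then have "(1 - d 0 * y) ^ (CARD('f) - 1) - 1 \<in> R.\<mm>" by (intro one_power) simp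
      then have "v ^ CARD('f) * ((1 - d 0 * y) ^ (CARD('f) - 1) - 1) \<in> R.\<mm>" by (intro R.mm_mult R.power vR)
      then show ?thesis using vR by (simp add: s_v algebra_simps)
    qed
    moreover have "inverse (1 - d j * y) \<in> ?S" if j: "j < N" for j
    proof -
      let ?g = "inverse (1 - d j * y)"
      have gR: "?g \<in> R" by (rule inv1[OF d])
      have dL: "d j \<in> L" "y \<in> L" using d[of j] consts_subset_L range_to_ac_subset_L by auto
      have "s (1 - d j * y) = 1 - d j ^ CARD('f) * y"
        using Gal_consts[OF s(1), of 1 "d j"] s(2) d[of j] dL
        by (simp add: L.hom_on_diff[OF h] L.hom_on_mult[OF h] L.hom_on_one[OF h] Gal_to_ac[OF s(1)] L.one L.mult)
      then have "s ?g = inverse (1 - d j ^ CARD('f) * y)"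
        using L.hom_on_inverse[OF h, of "1 - d j * y"] dL RL[OF gR] by (simp add: L.closed)
      \<comment> \<open>The automorphism replaces d_j by its q-th power, yet both inverses are 1
        modulo the place.\<close>
      then have "s ?g - ?g ^ CARD('f) = (inverse (1 - d j ^ CARD('f) * y) - 1) - (?g ^ CARD('f) - 1)" by simp
      also have "\<dots> \<in> R.\<mm>" by (rule R.mm_diff) (intro one_power inv1 C.power d)+
      finally show ?thesis using gR by simp
    qed
    ultimately show ?thesis unfolding gens_def by blast
  qed
  ultimately have "B \<subseteq> ?S" by (rule B_least)
  then show "b \<in> B \<Longrightarrow> s b \<in> R \<and> s b - b ^ CARD('f) \<in> R.\<mm>" using sR by blast
qed

text \<open>With r = (cr)/c and both parts in B, the congruences for c and cr combine; division is
  possible because s c, congruent to c^q, is a unit.\<close>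

lemma frobenius_congruence:
  assumes ab: "above R" and r: "r \<in> R"
  shows "s r - r ^ CARD('f) \<in> place_ideal R"
proof -
  interpret R: valuation_set R L using ab by (simp add: above_def)
  obtain c where c: "c \<in> B" "c \<notin> R.\<mm>" "c * r \<in> B" by (rule clear_denominator[OF ab r])
  note h = GalD(1)[OF s(1)]
  have cR: "c \<in> R" using c(1) B_subset_above[OF ab] by blast
  note fc = frobenius_B[OF ab c(1)] and fr = frobenius_B[OF ab c(3)]
  have sc: "s c \<notin> R.\<mm>"
  proof
    assume "s c \<in> R.\<mm>"
    then have "s c - (s c - c ^ CARD('f)) \<in> R.\<mm>" by (rule R.mm_diff) (use fc in auto)
    then have "c ^ CARD('f) \<in> R.\<mm>" by simp
    then show False using R.mm_power cR c(2) by blast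
  qed
  have inv: "inverse (s c) \<in> R" using fc sc R.mm_unit by blast
  have "s (c * r) = s c * s r" using cR r R.subset by (intro L.hom_on_mult[OF h]) auto
  then have "s c * (s r - r ^ CARD('f)) = (s (c * r) - (c * r) ^ CARD('f)) - r ^ CARD('f) * (s c - c ^ CARD('f))"
    by (simp add: algebra_simps power_mult_distrib)
  also have "\<dots> \<in> R.\<mm>"
    by (rule R.mm_diff[OF conjunct2[OF fr] R.mm_mult[OF conjunct2[OF fc] R.power[OF r]]])
  finally have "inverse (s c) * (s c * (s r - r ^ CARD('f))) \<in> R.\<mm>" using inv by (rule R.mm_mult)
  moreover have "s c \<noteq> 0" using sc R.mm_zero by auto
  ultimately show ?thesis by (simp flip: mult.assoc)
qed

text \<open>Constants embed into the residue field, so the congruence fixes t(\<eta>). Then t is s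
  followed by a twist of u by a root of unity \<mu>; comparing at the unit v gives \<mu>^q = 1, and
  Frobenius is injective.\<close>

lemma frobenius_unique:
  assumes ab: "above R" and t: "t \<in> carrier Gal" and cong: "\<And>r. r \<in> R \<Longrightarrow> t r - r ^ CARD('f) \<in> place_ideal R"
  shows "t = s"
proof -
  interpret R: valuation_set R L using ab by (simp add: above_def)
  note h = GalD(1)[OF t] and hs = GalD(1)[OF s(1)]
  have const_unit: "c = 0" if "c \<in> constants" "c \<in> R.\<mm>" for c
  proof (rule ccontr)
    assume "c \<noteq> 0"
    then have "inverse c \<notin> R" using that R.mm_not_unit by blast
    then show False using consts_in_above[OF ab C.inverse[OF that(1)]] by blast
  qed
  have te: "t \<eta> = \<eta> ^ CARD('f)"
  proof -
    obtain j where "t \<eta> = conj_eta j" using Gal_eta_ex[OF t] by blast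
    then have "t \<eta> - \<eta> ^ CARD('f) \<in> constants" using conj_eta_in_consts[of j] eta_in_consts by (auto intro: C.diff C.power)
    moreover have "t \<eta> - \<eta> ^ CARD('f) \<in> R.\<mm>" by (intro cong consts_in_above[OF ab] eta_in_consts)
    ultimately show ?thesis using const_unit by fastforce
  qed
  define x where "x = inv\<^bsub>Gal\<^esub> s \<otimes>\<^bsub>Gal\<^esub> t"
  have x: "x \<in> carrier Gal" using s t by (simp add: x_def)
  have tx: "t = s \<otimes>\<^bsub>Gal\<^esub> x" using s t by (simp add: x_def Gal.m_assoc[symmetric])
  have "s (x \<eta>) = s \<eta>" using te s(2) tx Gal_mult[OF s(1) x eta_in_L] by simp
  moreover have "inj_on s L" using GalD(5)[OF s(1)] by (simp add: bij_betw_def)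
  ultimately have xe: "x \<eta> = \<eta>" using eta_in_L GalD(2)[OF x] by (meson inj_onD)
  obtain \<mu> where mu: "\<mu> ^ W = 1" "\<mu> \<in> constants" "x u = \<mu> * u" by (rule Gal_fix_eta[OF x xe])
  have vL: "v \<in> L" and gL: "to_ac g \<in> L" unfolding v_eq using u_in_L range_to_ac_subset_L by (auto intro: L.mult)
  have mL: "\<mu> \<in> L" using mu consts_subset_L by blast
  have "x v = \<mu> * v" unfolding v_eq using mu(3) u_in_L gL
    by (simp add: L.hom_on_mult[OF GalD(1)[OF x]] Gal_to_ac[OF x])
  then have tv: "t v = s \<mu> * s v" unfolding tx using Gal_mult[OF s(1) x vL] mL vL by (simp add: L.hom_on_mult[OF hs])
  have smu: "s \<mu> = \<mu> ^ CARD('f)" using Gal_consts[OF s(1), of 1] s(2) mu(2) by simp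
  have vR: "v \<in> R" using gens_subset_above[OF ab] by (auto simp: gens_def)
  have svR: "s v - v ^ CARD('f) \<in> R.\<mm>" by (rule frobenius_congruence[OF ab vR])
  have "(t v - v ^ CARD('f)) - (s v - v ^ CARD('f)) \<in> R.\<mm>" using cong[OF vR] svR by (rule R.mm_diff)
  then have prod: "(\<mu> ^ CARD('f) - 1) * s v \<in> R.\<mm>" by (simp add: tv smu algebra_simps)
  \<comment> \<open>Otherwise v^W would lie in the place, and clearing its unit factors would leave
    the nonzero constant e there.\<close>
  have "v \<notin> R.\<mm>"
  proof
    assume "v \<in> R.\<mm>"
    moreover obtain W' where "W = Suc W'" using W_pos by (cases W) auto
    ultimately have "v ^ W \<in> R.\<mm>" using R.mm_mult[OF _ R.power[OF vR], of v W'] by (simp add: mult.commute)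
    then have "e * (\<Prod>j<N. inverse (1 - d j * y) ^ n j) \<in> R.\<mm>" unfolding v_power .
    moreover have "(\<Prod>j<N. (1 - d j * y) ^ n j) \<in> R"
      using ab by (intro R.prod R.power R.diff R.one R.mult consts_in_above[OF ab] d R.mm_subset) (simp add: above_def)
    ultimately have "(\<Prod>j<N. (1 - d j * y) ^ n j) * (e * (\<Prod>j<N. inverse (1 - d j * y) ^ n j)) \<in> R.\<mm>"
      by (rule R.mm_mult)
    moreover have "(\<Prod>j<N. (1 - d j * y) ^ n j) * (e * (\<Prod>j<N. inverse (1 - d j * y) ^ n j)) =
        e * (\<Prod>j<N. (1 - d j * y) ^ n j * inverse (1 - d j * y) ^ n j)"
      by (simp add: prod.distrib mult_ac)
    moreover have "(\<Prod>j<N. (1 - d j * y) ^ n j * inverse (1 - d j * y) ^ n j) = 1"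
      using one_minus_nonzero[OF d] by (intro prod.neutral) (simp flip: power_mult_distrib)
    ultimately show False using const_unit e by simp
  qed
  then have "v ^ CARD('f) \<notin> R.\<mm>" using R.mm_power vR by blast
  have "s v \<notin> R.\<mm>"
  proof
    assume "s v \<in> R.\<mm>"
    then have "s v - (s v - v ^ CARD('f)) \<in> R.\<mm>" using svR by (rule R.mm_diff)
    then show False using \<open>v ^ CARD('f) \<notin> R.\<mm>\<close> by simp
  qed
  moreover have "s v \<in> R" using R.add[OF R.mm_subset[OF svR] R.power[OF vR, of "CARD('f)"]] by simp
  moreover have mc: "\<mu> ^ CARD('f) - 1 \<in> constants" using mu by (intro C.diff C.power C.one)
  ultimately have "\<mu> ^ CARD('f) - 1 \<in> R.\<mm>" using R.mm_prime[OF prod consts_in_above[OF ab mc]] by blast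
  then have "\<mu> ^ CARD('f) ^ 1 = 1 ^ CARD('f) ^ 1" using const_unit[OF mc] by simp
  then have "\<mu> = 1" by (simp only: frob_inj)
  then have "x = \<one>\<^bsub>Gal\<^esub>" using x xe mu(3) eta_in_L u_in_L by (intro Gal_ext) (auto simp: Gal_one)
  then show ?thesis using tx s(1) by simp
qed

lemma artin_symbol_prime_eq: "artin_symbol_prime A L I = s"
proof -
  have P: "(\<forall>R \<in> valuation_rings (to_ac ` const_field) L.
       place_ideal R \<inter> to_ac ` A = to_ac ` I \<longrightarrow> (\<forall>r\<in>R. t r - r ^ (CARD('f) ^ prime_degree A I) \<in> place_ideal R))
     \<longleftrightarrow> (\<forall>R. above R \<longrightarrow> (\<forall>r\<in>R. t r - r ^ CARD('f) \<in> place_ideal R))" for t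
    unfolding prime_degree_I power_one_right above_iff[symmetric] by blast
  show ?thesis unfolding artin_symbol_prime_def P
  proof (rule the_equality)
    show "s \<in> carrier Gal \<and> (\<forall>R. above R \<longrightarrow> (\<forall>r\<in>R. s r - r ^ CARD('f) \<in> place_ideal R))"
      using s(1) frobenius_congruence by blast
    fix t assume t: "t \<in> carrier Gal \<and> (\<forall>R. above R \<longrightarrow> (\<forall>r\<in>R. t r - r ^ CARD('f) \<in> place_ideal R))"
    obtain R where "above R" by (rule above_exists)
    then show "t = s" using t frobenius_unique by blast
  qed
qed

end

section \<open>The Artin symbols\<close>

context regular_functions
begin

text \<open>T_1 is the witness for \<open>dominated\<close>: it belongs to both primes and, as
  \<rho> has degree at least 2 and cannot divide t, it has a pole at \<rho>.\<close>

lemma T_1_not_in: "T_fun \<rho> 1 \<notin> val_ring_at \<rho>"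
proof
  assume "T_fun \<rho> 1 \<in> val_ring_at \<rho>"
  then obtain a b where ab: "tF / rF = to_fract a / to_fract b" "\<not> \<rho> dvd b" by (auto simp: T_eq val_ring_at_iff)
  then have "b \<noteq> 0" by auto
  then have "to_fract ([:0, 1:] * b) = to_fract (a * \<rho>)"
    using ab(1) rF_nonzero by (simp only: to_fract_mult) (simp add: frac_eq_eq)
  then have "[:0, 1:] * b = a * \<rho>" by (simp only: to_fract_eq_iff)
  then have "\<rho> dvd [:0, 1:]" using irreducible_dvd_mult[OF irreducible_rho, of "[:0, 1:]" b] ab(2) by simp
  then have "degree \<rho> \<le> degree [:0, 1 :: 'f:]" by (rule dvd_imp_degree_le) simp
  then show False using degree_rho N_ge_2 by simp
qed

lemma A_dominated:
  assumes "Q \<in> valuation_rings const_field UNIV" "T_fun \<rho> 1 \<in> Q"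
  shows "A \<subseteq> Q"
  using assms T_1_not_in unfolding ring_A_eq[symmetric] ring_A_def by auto

lemma T_1_mem: "T_fun \<rho> 1 \<in> inf.I" "T_fun \<rho> 1 \<in> zero.I"
  unfolding I_inf_eq[symmetric] I_zero_eq[symmetric] I_inf_def I_zero_def genideal_def degree_rho
  using N_ge_2 by auto

end

context kummer_extension
begin

sublocale RF: regular_functions \<rho> N
  by unfold_locales (use lead_coeff_rho irreducible_rho degree_rho N_ge_2 in auto)

text \<open>The total exponent of the factors in the radicand, so that \<theta>^W can be distributed
  over them, one power per factor.\<close>

lemma W_sum: "(\<Sum>j<N. CARD('f) ^ (N - 1 - j)) = W"
proof -
  have "(CARD('f) - 1) * (\<Sum>i<k. CARD('f) ^ i) = CARD('f) ^ k - 1" for k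
  proof (induction k)
    case (Suc k)
    have "CARD('f) ^ k \<le> CARD('f) * CARD('f) ^ k" by simp
    then show ?case using Suc card_ge_2 by (simp add: distrib_left diff_mult_distrib)
  qed simp
  moreover have "(\<Sum>j<N. CARD('f) ^ (N - 1 - j)) = (\<Sum>i<N. CARD('f) ^ i)"
    using sum.nat_diff_reindex[of "\<lambda>i. CARD('f) ^ i" N] by simp
  ultimately have "(CARD('f) - 1) * (\<Sum>j<N. CARD('f) ^ (N - 1 - j)) = (CARD('f) - 1) * W"
    using W_mult by (simp add: mult.commute)
  then show ?thesis using card_ge_2 by simp
qed

lemma theta_nonzero: "theta \<noteq> (0 :: 'f poly fract alg_closure)"
  using theta_minus_nonzero[OF C.zero] by simp

lemma minus_one_const: "-1 \<in> constants" by (intro C.uminus C.one)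

lemma minus_one_power: "(-1 :: 'f poly fract alg_closure) ^ (CARD('f) - 1) = 1"
proof -
  have "(-1 :: 'f poly fract alg_closure) * (-1) ^ (CARD('f) - 1) = (-1) ^ CARD('f)"
    by (simp flip: power_Suc)
  also have "\<dots> = -1" using frob_uminus[where 'f='f and n=1, of 1] by simp
  finally show ?thesis by simp
qed

text \<open>From \<theta> - \<eta>_j = \<theta> (1 - \<eta>_j/\<theta>) the parameters are the
  conjugates themselves and u\<theta> is a unit. Since \<sigma> fixes \<theta>, the rescaling turns
  (\<theta> - \<eta>)^(q-1) into (1 - \<eta>/\<theta>)^(q-1).\<close>

sublocale at_inf: kummer_place \<rho> N \<eta> u W RF.A val_ring_inf "inverse tF"
  "u * theta" tF \<sigma> conj_eta "(-1) ^ W" "\<lambda>j. CARD('f) ^ (N - 1 - j)"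
proof (intro kummer_place.intro kummer_place_axioms.intro kummer_extension_axioms RF.inf.degree_one_place_axioms)
  show "RF.A \<subseteq> Q" if "Q \<in> valuation_rings const_field UNIV" "RF.inf.I \<subseteq> Q" for Q
    using RF.A_dominated RF.T_1_mem that by blast
  show "u * theta = u * to_ac tF" by (simp add: theta_def)
  show "tF \<noteq> (0 :: 'f poly fract)" by simp
  show "(-1) ^ W \<in> constants" by (intro C.power minus_one_const)
  show "(-1) ^ W \<noteq> (0 :: 'f poly fract alg_closure)" by simp
  show "conj_eta j \<in> constants" for j by (rule conj_eta_in_consts)
  have y: "to_ac (inverse tF) = inverse (theta :: 'f poly fract alg_closure)" by (simp add: theta_def)
  have f: "1 - c * inverse theta = (theta - c) * inverse theta" for c :: "'f poly fract alg_closure"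
    using theta_nonzero by (simp add: left_diff_distrib)
  have "(u * theta) ^ W = rad * (\<Prod>j<N. theta ^ CARD('f) ^ (N - 1 - j))"
    by (simp only: power_mult_distrib u_power_rad power_sum[symmetric] W_sum)
  also have "\<dots> = (-1) ^ W * (\<Prod>j<N. inverse (1 - conj_eta j * inverse theta) ^ CARD('f) ^ (N - 1 - j))"
    unfolding f rad_def by (simp add: prod.distrib[symmetric] power_mult_distrib[symmetric] divide_inverse mult.assoc mult.commute)
  finally show "(u * theta) ^ W = (-1) ^ W * (\<Prod>j<N. inverse (1 - conj_eta j * to_ac (inverse tF)) ^ CARD('f) ^ (N - 1 - j))"
    unfolding y .
  show "\<sigma> \<in> carrier Gal" "\<sigma> \<eta> = \<eta> ^ CARD('f)" by (rule sigma_inf)+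
  have "\<sigma> (u * theta) = (theta - \<eta>) ^ (CARD('f) - 1) * u ^ CARD('f) * theta"
    using L.hom_on_mult[OF GalD(1)[OF sigma_inf(1)] u_in_L theta_in_L] sigma_inf(2) Gal_theta[OF sigma_inf(1)] by simp
  also have "\<dots> = ((theta - \<eta>) * inverse theta) ^ (CARD('f) - 1) * (u * theta) ^ CARD('f)"
  proof -
    have "theta ^ CARD('f) = theta ^ (CARD('f) - 1) * (theta :: 'f poly fract alg_closure)"
      by (simp flip: power_Suc2)
    then show ?thesis using theta_nonzero by (simp add: power_mult_distrib power_inverse)
  qed
  finally show "\<sigma> (u * theta) = (1 - conj_eta 0 * to_ac (inverse tF)) ^ (CARD('f) - 1) * (u * theta) ^ CARD('f)"
    unfolding y f by simp
qed

text \<open>From \<theta> - \<eta>_j = -\<eta>_j (1 - \<theta>/\<eta>_j) the parameters are the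
  inverse conjugates, and their product goes into the constant. The factor \<eta>^(1-q) in
  \<sigma>_0(u) turns (\<theta> - \<eta>)^(q-1) into (1 - \<theta>/\<eta>)^(q-1), as (-1)^(q-1) =
  1.\<close>

sublocale at_zero: kummer_place \<rho> N \<eta> u W RF.A RF.val_ring_0 tF
  u 1 \<sigma>\<^sub>0 "\<lambda>j. inverse (conj_eta j)"
  "(-1) ^ W * (\<Prod>j<N. (- inverse (conj_eta j)) ^ CARD('f) ^ (N - 1 - j))" "\<lambda>j. CARD('f) ^ (N - 1 - j)"
proof (intro kummer_place.intro kummer_place_axioms.intro kummer_extension_axioms RF.zero.degree_one_place_axioms)
  show "RF.A \<subseteq> Q" if "Q \<in> valuation_rings const_field UNIV" "RF.zero.I \<subseteq> Q" for Q
    using RF.A_dominated RF.T_1_mem that by blast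
  show "u = u * to_ac 1" by simp
  show "1 \<noteq> (0 :: 'f poly fract)" by simp
  have inv: "inverse (conj_eta j) \<in> constants" for j by (intro C.inverse conj_eta_in_consts)
  show "inverse (conj_eta j) \<in> constants" for j by (rule inv)
  show "(-1) ^ W * (\<Prod>j<N. (- inverse (conj_eta j)) ^ CARD('f) ^ (N - 1 - j)) \<in> constants"
    by (intro C.mult C.power C.prod minus_one_const C.uminus inv)
  show "(-1) ^ W * (\<Prod>j<N. (- inverse (conj_eta j)) ^ CARD('f) ^ (N - 1 - j)) \<noteq> 0"
    using eta_nonzero by simp
  have y: "to_ac tF = (theta :: 'f poly fract alg_closure)" by (simp add: theta_def)
  have "1 / (theta - conj_eta j) = - inverse (conj_eta j) * inverse (1 - inverse (conj_eta j) * theta)" for j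
  proof -
    have "conj_eta j \<noteq> 0" using eta_nonzero by simp
    then have "theta - conj_eta j = - conj_eta j * (1 - inverse (conj_eta j) * theta)"
      by (simp add: right_diff_distrib mult.assoc[symmetric])
    then show ?thesis by (simp add: divide_inverse)
  qed
  then show "u ^ W = (-1) ^ W * (\<Prod>j<N. (- inverse (conj_eta j)) ^ CARD('f) ^ (N - 1 - j)) *
      (\<Prod>j<N. inverse (1 - inverse (conj_eta j) * to_ac tF) ^ CARD('f) ^ (N - 1 - j))"
    unfolding u_power_rad rad_def y by (simp only: power_mult_distrib prod.distrib mult.assoc)
  show "\<sigma>\<^sub>0 \<in> carrier Gal" "\<sigma>\<^sub>0 \<eta> = \<eta> ^ CARD('f)" by (rule sigma_zero)+
  have "inverse \<eta> * (theta - \<eta>) = (-1) * (1 - inverse \<eta> * theta)"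
    using eta_nonzero by (simp add: right_diff_distrib)
  then have "inverse \<eta> ^ (CARD('f) - 1) * (theta - \<eta>) ^ (CARD('f) - 1) =
      (-1) ^ (CARD('f) - 1) * (1 - inverse \<eta> * theta) ^ (CARD('f) - 1)"
    by (simp only: power_mult_distrib[symmetric])
  also have "\<dots> = (1 - inverse \<eta> * theta) ^ (CARD('f) - 1)" by (simp only: minus_one_power mult_1)
  finally have s0: "inverse \<eta> ^ (CARD('f) - 1) * (theta - \<eta>) ^ (CARD('f) - 1) =
      (1 - inverse \<eta> * theta) ^ (CARD('f) - 1)" .
  show "\<sigma>\<^sub>0 u = (1 - inverse (conj_eta 0) * to_ac tF) ^ (CARD('f) - 1) * u ^ CARD('f)"
    unfolding sigma_zero(3) y s0 by simp
qed

text \<open>Only the two primes can contribute. Extending the product to both of them is harmless,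
  as exponent 0 gives the identity, and avoids distinguishing which exponents vanish.\<close>

lemma artin_symbol_eq:
  assumes I: "ideal J (as_ring RF.A)" "J \<noteq> {0}"
    and primes: "\<And>P. primeideal P (as_ring RF.A) \<Longrightarrow> J \<subseteq> P \<Longrightarrow> P = RF.inf.I \<or> P = RF.zero.I"
    and ord: "ideal_ord RF.A RF.inf.I J = int k" "ideal_ord RF.A RF.zero.I J = int l"
  shows "artin_symbol RF.A L J = \<sigma> [^]\<^bsub>Gal\<^esub> k \<otimes>\<^bsub>Gal\<^esub> \<sigma>\<^sub>0 [^]\<^bsub>Gal\<^esub> l"
proof -
  define S where "S = {P. primeideal P (as_ring RF.A) \<and> P \<noteq> {0} \<and> ideal_ord RF.A P J \<noteq> 0}"
  define h where "h P = artin_symbol_prime RF.A L P [^]\<^bsub>Gal\<^esub> ideal_ord RF.A P J" for P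
  have h: "h RF.inf.I = \<sigma> [^]\<^bsub>Gal\<^esub> k" "h RF.zero.I = \<sigma>\<^sub>0 [^]\<^bsub>Gal\<^esub> l"
    by (simp_all add: h_def ord at_inf.artin_symbol_prime_eq at_zero.artin_symbol_prime_eq int_pow_int)
  have carr: "h \<in> {RF.inf.I, RF.zero.I} \<rightarrow> carrier Gal"
    using h sigma_inf(1) sigma_zero(1) by auto
  have sub: "S \<subseteq> {RF.inf.I, RF.zero.I}"
    using primes RF.A.ideal_ord_eq_0[OF _ I(1)] by (auto simp: S_def)
  have "artin_symbol RF.A L J = finprod Gal h S"
    using RF.A.ideal_group_carrier[OF I] by (simp add: artin_symbol_def S_def h_def[abs_def])
  also have "\<dots> = finprod Gal h {RF.inf.I, RF.zero.I}"
  proof (rule Gal.finprod_mono_neutral_cong_left[OF _ sub _ _ carr])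
    show "h P = \<one>\<^bsub>Gal\<^esub>" if P: "P \<in> {RF.inf.I, RF.zero.I} - S" for P
    proof -
      from P have "ideal_ord RF.A P J = 0"
        using RF.inf.primeideal_I RF.inf.I_nonzero RF.zero.primeideal_I RF.zero.I_nonzero by (auto simp: S_def)
      then show ?thesis by (simp add: h_def)
    qed
  qed auto
  also have "\<dots> = h RF.inf.I \<otimes>\<^bsub>Gal\<^esub> h RF.zero.I"
    using carr RF.I_inf_neq_zero by simp
  finally show ?thesis unfolding h .
qed

lemma artin_symbol_I_inf: "artin_symbol RF.A L RF.inf.I = \<sigma>"
proof -
  have "\<not> RF.inf.I \<subseteq> RF.zero.I" using RF.inf.prime_eq_I[OF RF.zero.primeideal_I] RF.I_inf_neq_zero by blast
  then have "ideal_ord RF.A RF.zero.I RF.inf.I = 0"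
    by (rule RF.A.ideal_ord_eq_0[OF RF.zero.primeideal_I RF.inf.ideal_I])
  then have "artin_symbol RF.A L RF.inf.I = \<sigma> [^]\<^bsub>Gal\<^esub> (1::nat) \<otimes>\<^bsub>Gal\<^esub> \<sigma>\<^sub>0 [^]\<^bsub>Gal\<^esub> (0::nat)"
    using RF.inf.prime_eq_I RF.inf.ideal_ord_eq[OF RF.inf.has_ord_I]
    by (intro artin_symbol_eq RF.inf.ideal_I RF.inf.I_nonzero) auto
  then show ?thesis using sigma_inf(1) by simp
qed

lemma artin_symbol_I_zero: "artin_symbol RF.A L RF.zero.I = \<sigma>\<^sub>0"
proof -
  have "\<not> RF.zero.I \<subseteq> RF.inf.I" using RF.zero.prime_eq_I[OF RF.inf.primeideal_I] RF.I_inf_neq_zero by blast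
  then have "ideal_ord RF.A RF.inf.I RF.zero.I = 0"
    by (rule RF.A.ideal_ord_eq_0[OF RF.inf.primeideal_I RF.zero.ideal_I])
  then have "artin_symbol RF.A L RF.zero.I = \<sigma> [^]\<^bsub>Gal\<^esub> (0::nat) \<otimes>\<^bsub>Gal\<^esub> \<sigma>\<^sub>0 [^]\<^bsub>Gal\<^esub> (1::nat)"
    using RF.zero.prime_eq_I RF.zero.ideal_ord_eq[OF RF.zero.has_ord_I]
    by (intro artin_symbol_eq RF.zero.ideal_I RF.zero.I_nonzero) auto
  then show ?thesis using sigma_zero(1) by simp
qed

lemma artin_symbol_T:
  assumes i: "i \<le> N"
  shows "artin_symbol RF.A L (PIdl\<^bsub>as_ring RF.A\<^esub> (T_fun \<rho> i)) = M_aut \<eta> u (eta_star \<eta> N ^ i)"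
proof -
  note T = RF.principal_T[OF i]
  have "artin_symbol RF.A L (PIdl\<^bsub>as_ring RF.A\<^esub> (T_fun \<rho> i)) =
      \<sigma> [^]\<^bsub>Gal\<^esub> (N - i) \<otimes>\<^bsub>Gal\<^esub> \<sigma>\<^sub>0 [^]\<^bsub>Gal\<^esub> i"
    using RF.prime_containing_T[OF _ i] T(3) RF.inf.ideal_ord_eq[OF T(4)] RF.zero.ideal_ord_eq[OF T(5)]
    by (intro artin_symbol_eq T(1,2)) auto
  then show ?thesis using sigma_combination[OF i] by simp
qed

end

theorem proposition4p9:
  fixes \<rho> :: "'f::{finite,field} poly"
    and N :: nat
    and \<eta> u :: "'f poly fract alg_closure"
  assumes "Polynomial.lead_coeff \<rho> = 1"
    and "Factorial_Ring.irreducible \<rho>"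
    and "Polynomial.degree \<rho> = N"
    and "N \<ge> 2"
    and "poly (map_poly (\<lambda>c. to_ac (to_fract [:c:])) \<rho>) \<eta> = 0"
    and "u ^ W_num CARD('f) N =
           (-1) ^ W_num CARD('f) N * twisted_power (sigma_H \<eta>) (Theta \<eta>) (gamma_exp CARD('f) N)"
  shows "artin_symbol (ring_A \<rho>) (field_Hplus \<eta> u) (I_inf \<rho>) = sigma_inf \<eta> u \<and>
         artin_symbol (ring_A \<rho>) (field_Hplus \<eta> u) (I_zero \<rho>) = sigma_zero \<eta> u N \<and>
         (\<forall>i \<le> N - 1. artin_symbol (ring_A \<rho>) (field_Hplus \<eta> u)
                         (PIdl\<^bsub>as_ring (ring_A \<rho>)\<^esub> (T_fun \<rho> i)) = M_aut \<eta> u (eta_star \<eta> N ^ i))"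
proof -
  interpret constant_extension \<rho> N \<eta>
    by unfold_locales (use assms in \<open>auto simp: const_ac_def[abs_def]\<close>)
  interpret kummer_extension \<rho> N \<eta> u "W_num CARD('f) N"
    by unfold_locales (use assms(6) twisted_power_eq in auto)
  have "artin_symbol RF.A L (PIdl\<^bsub>as_ring RF.A\<^esub> (T_fun \<rho> i)) = M_aut \<eta> u (eta_star \<eta> N ^ i)"
    if "i \<le> N - 1" for i
    using that by (intro artin_symbol_T) simp
  then show ?thesis
    unfolding RF.ring_A_eq field_Hplus_eq RF.I_inf_eq RF.I_zero_eq
    using artin_symbol_I_inf artin_symbol_I_zero by blast
qed

end
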